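(* Let $F(z,v)=-\log\Big(1-\big(H(z)-(1-v)h_jz^j\big)\Big)$, $j\in\{1,2,\dots\}$, be a size-refined critical cycle composition scheme, i.e. $H(\rho_H)=1$, where $H$ has a singular exponent $0<\lambda_H<1$ (assumptions on $H$ as in the context). Let $X_{n,j}$ be the number of $\mathcal H$-components of size $j$ in structures of size $n$: $\mathbb P\{X_{n,j}=k\}=\frac{[z^nv^k]F(z,v)}{[z^n]F(z,1)}$. Let $j=j(n)$ with $h_j>0$. Then, for $j=o(n)$, $X_{n,j}$ has factorial moments of mixed Poisson type: for every integer $s\ge1$, as $n\to\infty$, $$\mathbb E\big(X_{n,j}(X_{n,j}-1)\cdots(X_{n,j}-s+1)\big)=\xi_{n,j}^s\cdot\mu_s\cdot(1+o(1)),\qquad \xi_{n,j}=\frac{\rho_H^{\,j}}{-c_H}h_j\,n^{\lambda_H},$$ where $\mu_s=\mathbb E(X^s)=\frac{\Gamma(s+1)}{\Gamma(s\lambda_H+1)}$ are the moments of a Mittag-Leffler distributed variable $X\sim\mathrm{ML}(\lambda_H)$. Moreover, $X_{n,j}$ converges to one of three limit laws: (i) if $j\ll n^{\lambda_H/(1+\lambda_H)}$, then $\xi_{n,j}\to\infty$ and $X_{n,j}/\xi_{n,j}\to X$ in distribution and with convergence of all moments; (ii) if $j\sim r\,n^{\lambda_H/(1+\lambda_H)}$ with $r\in(0,\infty)$, then $\xi_{n,j}\to\xi=r^{-(1+\lambda_H)}\frac{1}{-\Gamma(-\lambda_H)}$ and $X_{n,j}\to\mathrm{MPo}(\xi X)$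 in distribution and with convergence of all moments; (iii) if $j\gg n^{\lambda_H/(1+\lambda_H)}$, then $\xi_{n,j}\to0$ and $X_{n,j}$ converges in distribution to the Dirac distribution at $0$.
   Context: $H(z)=\sum_nh_nz^n$ is a power series with nonnegative coefficients, $H(0)=0$, finite radius of convergence $\rho_H>0$, whose only singularity on $|z|\le\rho_H$ is $z=\rho_H$; it is analytic in a domain $\{|z|<\rho_H+\varepsilon,\ |\arg(z-\rho_H)|>\theta\}$ for some $\varepsilon>0$, $0<\theta<\pi/2$, and there, as $z\to\rho_H$, $H(z)=H(\rho_H)+c_H(1-z/\rho_H)^{\lambda_H}(1+o(1))$ with $c_H\ne0$ (then $c_H<0$). $\mathrm{ML}(\alpha)$, $0<\alpha<1$, is the law of $S_\alpha^{-\alpha}$, where $S_\alpha>0$ has Laplace transform $\mathbb E(e^{-tS_\alpha})=e^{-t^\alpha}$. Mixed Poisson distribution: $Y\sim\mathrm{MPo}(\xi X)$ means $\mathbb P\{Y=\ell\}=\frac{\xi^\ell}{\ell!}\mathbb E(X^\ell e^{-\xi X})$ for integers $\ell\ge0$. $a_n\ll b_n$ (resp. $a_n\gg b_n$) means $a_n/b_n\to0$ (resp. $\to\infty$). *)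

theory Defs
  imports "HOL-Probability.Probability" "HOL-Complex_Analysis.Complex_Analysis"
    "HOL-Computational_Algebra.Computational_Algebra"
begin

text \<open>
  The domain of analyticity. The apex \<open>\<rho>\<close> itself is excluded since \<open>Arg 0 = 0\<close>. For
  \<open>\<theta> < pi / 2\<close> the domain contains every other point of the closed disc of radius \<open>\<rho>\<close>, so that
  analyticity here entails that \<open>\<rho>\<close> is the only possible singularity on the closed disc.
\<close>

definition Delta_domain :: "real \<Rightarrow> real \<Rightarrow> real \<Rightarrow> complex set" where
  "Delta_domain \<rho> \<epsilon> \<theta> = {z. norm z < \<rho> + \<epsilon> \<and> \<bar>Arg (z - of_real \<rho>)\<bar> > \<theta>}"

text \<open>
  Bivariate series are formal power series in \<open>z\<close> whose coefficients are polynomials in \<open>v\<close>: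
  \<open>[z^n v^k] F\<close> is \<open>coeff (F $ n) k\<close>, the variable \<open>v\<close> is \<open>[:0, 1:]\<close>, and the coefficient of \<open>z^n\<close>
  in \<open>F(z,1)\<close> is \<open>poly (F $ n) 1\<close>.
\<close>

definition fps_lift :: "real fps \<Rightarrow> real poly fps" where
  "fps_lift f = Abs_fps (\<lambda>n. [:f $ n:])"

definition refined_fps :: "(nat \<Rightarrow> real) \<Rightarrow> nat \<Rightarrow> real poly fps" where
  "refined_fps h j =
     fps_lift (Abs_fps h) - fps_const ((1 - [:0, 1:]) * [:h j:]) * fps_X ^ j"

text \<open>\<open>fps_ln 1\<close> is the series of \<open>log (1 + x)\<close>.\<close>

definition cycle_fps :: "(nat \<Rightarrow> real) \<Rightarrow> nat \<Rightarrow> real poly fps" where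
  "cycle_fps h j = - (fps_lift (fps_ln 1) oo - refined_fps h j)"

definition component_pmf :: "(nat \<Rightarrow> real) \<Rightarrow> nat \<Rightarrow> nat \<Rightarrow> nat pmf" where
  "component_pmf h j n =
     embed_pmf (\<lambda>k. coeff (cycle_fps h j $ n) k / poly (cycle_fps h j $ n) 1)"

definition factorial_moment :: "nat pmf \<Rightarrow> nat \<Rightarrow> real" where
  "factorial_moment p s = measure_pmf.expectation p (\<lambda>k. \<Prod>i<s. real k - real i)"

definition positive_stable :: "real \<Rightarrow> real measure \<Rightarrow> bool" where
  "positive_stable \<alpha> S \<longleftrightarrow> real_distribution S \<and> (AE x in S. 0 < x) \<and>
     (\<forall>t\<ge>0. (\<integral>x. exp (- t * x) \<partial>S) = exp (- (t powr \<alpha>)))"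

definition mittag_leffler :: "real \<Rightarrow> real measure \<Rightarrow> bool" where
  "mittag_leffler \<alpha> L \<longleftrightarrow>
     (\<exists>S. positive_stable \<alpha> S \<and> L = distr S borel (\<lambda>x. x powr (- \<alpha>)))"

text \<open>The mixed Poisson law of parameter \<open>\<xi> X\<close>, where \<open>L\<close> is the law of \<open>X\<close>.\<close>

definition mixed_poisson_pmf :: "real \<Rightarrow> real measure \<Rightarrow> nat pmf" where
  "mixed_poisson_pmf \<xi> L =
     embed_pmf (\<lambda>l. \<xi> ^ l / fact l * (\<integral>x. x ^ l * exp (- \<xi> * x) \<partial>L))"

text \<open>
  The two laws given by \<^const>\<open>embed_pmf\<close> have the intended point probabilities. For the component
  law this needs \<open>[z^n] F(z,1) \<noteq> 0\<close>, i.e. that there is a structure of size \<open>n\<close>; otherwise it is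
  unspecified.
\<close>

lemma refined_fps_nth:
  "refined_fps h j $ n = (if n = j then [:0, h j:] else [:h n:])"
  by (auto simp: refined_fps_def fps_lift_def one_pCons)

lemma cycle_fps_nth:
  "cycle_fps h j $ n = (\<Sum>i=1..n. smult (1 / real i) (refined_fps h j ^ i $ n))"
proof -
  have pm: "(- refined_fps h j) ^ i $ n = smult ((-1) ^ i) (refined_fps h j ^ i $ n)" for i
    by (cases "even i") (simp_all add: power_minus_even power_minus_odd)
  have "cycle_fps h j $ n =
      (\<Sum>i=0..n. - smult (fps_ln 1 $ i * (-1) ^ i) (refined_fps h j ^ i $ n))"
    by (simp add: cycle_fps_def fps_compose_nth fps_lift_def pm sum_negf mult.commute[of "fps_ln 1 $ _"])
  also have "\<dots> = (\<Sum>i=1..n. - smult (fps_ln 1 $ i * (-1) ^ i) (refined_fps h j ^ i $ n))"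
    by (intro sum.mono_neutral_right) (auto simp: not_less_eq_eq)
  also have "\<dots> = (\<Sum>i=1..n. smult (1 / real i) (refined_fps h j ^ i $ n))"
  proof (intro sum.cong refl)
    fix i assume i: "i \<in> {1..n}"
    then obtain m where m: "i = Suc m" by (cases i) auto
    have "(-1) ^ m * (-1) ^ m = (1::real)" by (simp flip: power_mult_distrib)
    then have "fps_ln 1 $ i * (-1) ^ i = - (1 / real i)"
      by (simp add: fps_ln_nth m del: of_nat_Suc)
    then show "- smult (fps_ln 1 $ i * (-1) ^ i) (refined_fps h j ^ i $ n) =
        smult (1 / real i) (refined_fps h j ^ i $ n)"
      by simp
  qed
  finally show ?thesis .
qed

lemma coeff_refined_fps_power_nonneg:
  assumes "\<And>n. h n \<ge> 0"
  shows "coeff (refined_fps h j ^ i $ n) k \<ge> 0"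
proof (induction i arbitrary: n k)
  case 0
  then show ?case by (simp add: coeff_1)
next
  case (Suc i)
  have "coeff (refined_fps h j $ m) l \<ge> 0" for m l
    using assms by (auto simp: refined_fps_nth coeff_pCons split: nat.split)
  with Suc show ?case
    by (auto simp: fps_mult_nth coeff_sum coeff_mult intro!: sum_nonneg mult_nonneg_nonneg)
qed

lemma coeff_cycle_fps_nonneg:
  assumes "\<And>n. h n \<ge> 0"
  shows "coeff (cycle_fps h j $ n) k \<ge> 0"
  using coeff_refined_fps_power_nonneg[OF assms]
  by (auto simp: cycle_fps_nth coeff_sum intro!: sum_nonneg)

lemma nn_integral_coeff_poly:
  fixes p :: "real poly"
  assumes "\<And>k. coeff p k \<ge> 0" "poly p 1 > 0"
  shows "(\<integral>\<^sup>+k. ennreal (coeff p k / poly p 1) \<partial>count_space UNIV) = 1"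
proof -
  have "(\<integral>\<^sup>+k. ennreal (coeff p k / poly p 1) \<partial>count_space UNIV) =
      (\<Sum>k. ennreal (coeff p k / poly p 1))"
    by (rule nn_integral_count_space_nat)
  also have "\<dots> = (\<Sum>k\<le>degree p. ennreal (coeff p k / poly p 1))"
    by (rule suminf_finite) (auto simp: coeff_eq_0)
  also have "\<dots> = ennreal (\<Sum>k\<le>degree p. coeff p k / poly p 1)"
    using assms by (intro sum_ennreal) auto
  also have "(\<Sum>k\<le>degree p. coeff p k / poly p 1) = 1"
    using assms(2) by (simp add: poly_altdef[of p 1] flip: sum_divide_distrib)
  finally show ?thesis by simp
qed

lemma pmf_component_pmf:
  assumes "\<And>n. h n \<ge> 0" "poly (cycle_fps h j $ n) 1 \<noteq> 0"
  shows "pmf (component_pmf h j n) k =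
    coeff (cycle_fps h j $ n) k / poly (cycle_fps h j $ n) 1"
proof -
  let ?p = "cycle_fps h j $ n"
  have c: "coeff ?p k \<ge> 0" for k
    using assms(1) by (rule coeff_cycle_fps_nonneg)
  have "poly ?p 1 \<ge> 0"
    using c by (auto simp: poly_altdef intro!: sum_nonneg)
  with assms(2) have "poly ?p 1 > 0" by simp
  then show ?thesis
    unfolding component_pmf_def using c by (intro pmf_embed_pmf nn_integral_coeff_poly) auto
qed

lemma pmf_mixed_poisson_pmf:
  assumes L: "real_distribution L" "AE x in L. 0 \<le> x" and \<xi>: "\<xi> \<ge> 0"
  shows "pmf (mixed_poisson_pmf \<xi> L) l = \<xi> ^ l / fact l * (\<integral>x. x ^ l * exp (- \<xi> * x) \<partial>L)"
proof -
  interpret real_distribution L by fact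
  define f where "f l x = \<xi> ^ l / fact l * (x ^ l * exp (- \<xi> * x))" for l x
  have f_eq: "f l x = (\<xi> * x) ^ l / fact l * exp (- (\<xi> * x))" for l x
    by (simp add: f_def power_mult_distrib)
  have meas: "f l \<in> borel_measurable L" for l
    unfolding f_def by measurable
  have nonneg: "AE x in L. f l x \<ge> 0" for l
    using L(2) \<xi> by (auto simp: f_def)
  have sums: "(\<lambda>l. f l x) sums 1" for x
  proof -
    have "(\<lambda>l. (\<xi> * x) ^ l / fact l * exp (- (\<xi> * x))) sums (exp (\<xi> * x) * exp (- (\<xi> * x)))"
      using exp_converges[of "\<xi> * x"] by (intro sums_mult2) (simp add: field_simps)
    then show ?thesis by (simp add: f_eq flip: exp_add)
  qed
  have le1: "AE x in L. norm (f l x) \<le> 1" for l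
    using L(2)
  proof eventually_elim
    case (elim x)
    then have pos: "f m x \<ge> 0" for m using \<xi> by (simp add: f_def)
    have "sum (\<lambda>m. f m x) {l} \<le> 1"
      using sums[of x] pos by (metis finite.emptyI finite.insertI sum_le_suminf sums_iff)
    with pos show ?case by simp
  qed
  have int: "integrable L (f l)" for l
    by (rule integrable_const_bound[OF le1 meas])
  have eq: "(\<integral>x. f l x \<partial>L) = \<xi> ^ l / fact l * (\<integral>x. x ^ l * exp (- \<xi> * x) \<partial>L)" for l
    unfolding f_def by (rule integral_mult_right_zero)
  have "(\<integral>\<^sup>+l. ennreal (\<integral>x. f l x \<partial>L) \<partial>count_space UNIV) = (\<Sum>l. ennreal (\<integral>x. f l x \<partial>L))"
    by (rule nn_integral_count_space_nat)
  also have "\<dots> = (\<Sum>l. \<integral>\<^sup>+x. ennreal (f l x) \<partial>L)"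
    using nn_integral_eq_integral[OF int nonneg] by simp
  also have "\<dots> = (\<integral>\<^sup>+x. (\<Sum>l. ennreal (f l x)) \<partial>L)"
    using meas by (intro nn_integral_suminf[symmetric]) auto
  also have "\<dots> = (\<integral>\<^sup>+x. 1 \<partial>L)"
  proof (rule nn_integral_cong_AE)
    show "AE x in L. (\<Sum>l. ennreal (f l x)) = 1"
      using L(2)
    proof eventually_elim
      case (elim x)
      then have "f m x \<ge> 0" for m using \<xi> by (simp add: f_def)
      then show ?case
        using suminf_ennreal_eq[of "\<lambda>l. f l x", OF _ sums[of x]] by (simp only: ennreal_1)
    qed
  qed
  also have "\<dots> = 1" using emeasure_space_1 by simp
  finally have "(\<integral>\<^sup>+l. ennreal (\<integral>x. f l x \<partial>L) \<partial>count_space UNIV) = 1" .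
  moreover have "(\<integral>x. f l x \<partial>L) \<ge> 0" for l
    by (rule integral_nonneg_AE[OF nonneg])
  ultimately show ?thesis
    unfolding mixed_poisson_pmf_def using eq by (intro pmf_embed_pmf) auto
qed

end

theory Submission
  imports Defs "HOL-Combinatorics.Stirling"
begin

text \<open>
  After rescaling to \<open>\<rho>\<^sub>H = 1\<close>, the substitution \<open>v \<mapsto> v + 1\<close> gives the factorial moments
  \<open>E (X)\<^sub>s = (s - 1)! h\<^sub>j\<^sup>s [z\<^sup>n\<^sup>-\<^sup>j\<^sup>s] (1 - H(z))\<^sup>-\<^sup>s / [z\<^sup>n] F(z, 1)\<close>, where
  \<open>n [z\<^sup>n] F(z, 1) = [z\<^sup>n] z H'(z) / (1 - H(z))\<close>. The coefficients of \<open>H\<close>, of \<open>(1 - H)\<^sup>-\<^sup>s\<close> and of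
  \<open>z H' / (1 - H)\<close> follow from a transfer theorem for functions analytic in a \<open>\<Delta>\<close>-domain. It is
  proved without Hankel contours: Cauchy's inequality in the \<open>\<Delta>\<close>-domain shows that a function
  \<open>o(\<bar>1 - z\<bar>\<^sup>-\<^sup>a)\<close> has derivatives \<open>o(\<bar>1 - z\<bar>\<^sup>-\<^sup>a\<^sup>-\<^sup>k)\<close>, and for exponents at least 2 the trivial bound on
  the circle of radius \<open>n / (n + 1)\<close> is already sharp. The moments of the Mittag-Leffler law grow so
  slowly that convergence of (factorial) moments implies convergence of characteristic functions,
  and Levy's theorem yields the limit laws.
\<close>

section \<open>Singularity analysis\<close>

text \<open>Sharpness for exponents at least 2 rests on \<open>norm (1 - z) \<ge> 1 - r\<close> on
  the circle of radius \<open>r\<close>: powers beyond the second are traded for powers of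
  \<open>1 - r\<close>, and the mean of the inverse square is known exactly. Smaller exponents, such
  as the \<open>- \<alpha>\<close> of \<open>1 - H\<close>, are lifted by differentiating; each
  derivative narrows the cone, which does no harm since finitely many suffice. The logarithm in
  \<open>F(z, 1)\<close> would call for logarithmic scales, whereas its derivative has the pure
  exponent 1. The asymptotics of \<open>h n\<close> also feed back: they make almost all
  \<open>h n\<close> positive, hence the series aperiodic; otherwise \<open>1 - H\<close> could
  vanish elsewhere on the circle. The second obstacle is the range of \<open>j\<close>. In regime
  (i) \<open>j n\<close> may stay bounded, where the asymptotics of \<open>h\<close> say nothing; in
  regime (iii) it may be comparable to \<open>n\<close>, where the factorial moments have no such
  asymptotics. Bounds on \<open>h\<close> at all indices and a bound on the mean for all
  \<open>j\<close> fill these gaps.\<close>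

text \<open>
  Near the dominant singularity 1 the \<open>\<Delta>\<close>-domain with opening angle \<open>\<theta>\<close> agrees with this cone
  for \<open>\<kappa> = cos \<theta>\<close>; unlike \<^const>\<open>Arg\<close>, the inequality is easily stable under perturbations.
\<close>

definition left_cone :: "real \<Rightarrow> complex set" where
  "left_cone \<kappa> = {z. Re (z - 1) < \<kappa> * norm (z - 1)}"

section \<open>Cones with apex 1 and Cauchy estimates inside them\<close>

lemma cone_mono: "\<kappa> \<le> \<kappa>' \<Longrightarrow> left_cone \<kappa> \<subseteq> left_cone \<kappa>'"
  unfolding left_cone_def by (smt (verit, best) Collect_mono_iff mult_right_mono norm_ge_zero)

lemma unit_disc_subset_cone:
  assumes "norm z < 1" "0 < \<kappa>"
  shows "z \<in> left_cone \<kappa>"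
proof -
  have "Re z < 1" using assms(1) complex_Re_le_cmod[of z] by linarith
  moreover have "0 \<le> \<kappa> * norm (z - 1)" using assms by simp
  ultimately show ?thesis by (simp add: left_cone_def)
qed

text \<open>With \<open>y = norm (z - 1)\<close>, the displacement raises the left side of the cone
  inequality by at most \<open>\<kappa> / 8 * y\<close> and lowers the right side by at most as much
  (as \<open>\<kappa> \<le> 1\<close>), in total less than the gap \<open>\<kappa> / 2 * y\<close>
  between the two cones.\<close>

lemma ball_subset_cone:
  assumes z: "z \<in> left_cone (\<kappa> / 2)" and \<kappa>: "0 < \<kappa>" "\<kappa> \<le> 1" and w: "norm (w - z) \<le> \<kappa> / 8 * norm (z - 1)"
  shows "w \<in> left_cone \<kappa>"
proof -
  have z1: "z \<noteq> 1" using z by (auto simp: left_cone_def)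
  then have p: "norm (z - 1) > 0" by simp
  have a: "Re (w - 1) \<le> Re (z - 1) + norm (w - z)"
    using complex_Re_le_cmod[of "w - z"] by simp
  have b: "norm (w - 1) \<ge> norm (z - 1) - norm (w - z)"
    using norm_triangle_ineq2[of "z - 1" "z - w"] by (simp add: norm_minus_commute)
  have "\<kappa> * norm (w - 1) \<ge> \<kappa> * (norm (z - 1) - norm (w - z))"
    using b \<kappa> by (intro mult_left_mono) auto
  moreover have "\<kappa> * norm (w - z) \<le> \<kappa> / 8 * norm (z - 1)"
    using w \<kappa> mult_right_mono[OF \<kappa>(2) norm_ge_zero[of "w - z"]] by linarith
  moreover have "Re (z - 1) < \<kappa> / 2 * norm (z - 1)" using z by (simp add: left_cone_def)
  moreover have "\<kappa> * norm (z - 1) > 0" using p \<kappa> by simp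
  ultimately have "Re (w - 1) < \<kappa> * norm (w - 1)"
    using a w by (simp add: algebra_simps)
  then show ?thesis by (simp add: left_cone_def)
qed

text \<open>Moves a real power from a Cauchy circle to its centre; the absolute value covers both
  signs of \<open>b\<close>.\<close>

lemma powr_le_two_powr:
  fixes x y :: real
  assumes "0 < y" "y / 2 \<le> x" "x \<le> 2 * y"
  shows "x powr b \<le> 2 powr \<bar>b\<bar> * y powr b"
proof -
  have x: "x > 0" using assms by simp
  have "(x / y) powr b \<le> 2 powr \<bar>b\<bar>"
  proof (cases "b \<ge> 0")
    case True
    have "(x / y) powr b \<le> 2 powr b"
      using assms x True by (intro powr_mono2) (auto simp: field_simps)
    then show ?thesis using True by simp
  next
    case False
    have "(x / y) powr b = (y / x) powr (- b)"
      using assms x by (simp add: powr_divide powr_minus field_simps)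
    also have "\<dots> \<le> 2 powr (- b)"
      using assms x False by (intro powr_mono2) (auto simp: field_simps)
    finally show ?thesis using False by simp
  qed
  then have "(x / y) powr b * y powr b \<le> 2 powr \<bar>b\<bar> * y powr b"
    by (intro mult_right_mono) auto
  then show ?thesis using assms x by (simp add: powr_divide)
qed

text \<open>The Cauchy discs have radius a fixed fraction of the distance to 1. On their boundaries
  \<open>norm (1 - w) powr (- a)\<close> is comparable to its value at the centre, and dividing by
  the radius costs exactly one power. The cone shrinks so that the discs stay inside the old
  one.\<close>

lemma deriv_little_o:
  fixes f :: "complex \<Rightarrow> complex" and a :: real
  assumes U: "open U" "f holomorphic_on U" and d: "d > 0" "left_cone \<kappa> \<inter> ball 1 d \<subseteq> U"
    and \<kappa>: "0 < \<kappa>" "\<kappa> \<le> 1"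
    and lim: "((\<lambda>z. norm (1 - z) powr a *\<^sub>R f z) \<longlongrightarrow> 0) (at 1 within left_cone \<kappa>)"
  shows "((\<lambda>z. norm (1 - z) powr (a + 1) *\<^sub>R deriv f z) \<longlongrightarrow> 0) (at 1 within left_cone (\<kappa> / 2))"
proof -
  \<comment> \<open>The first factor compares powers on the circle and at the centre;
    \<open>8 / \<kappa>\<close> is the ratio of the distance \<open>y\<close> to the radius
    \<open>R\<close> below.\<close>
  define C where "C = 2 powr \<bar>a\<bar> * 8 / \<kappa>"
  have C: "C > 0" using \<kappa> by (simp add: C_def)
  show ?thesis
    unfolding tendsto_iff
  proof (intro allI impI)
    fix e :: real assume e: "e > 0"
    define e' where "e' = e / (2 * C)"
    have e': "e' > 0" using e C by (simp add: e'_def)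
    have "\<forall>\<^sub>F z in at 1 within left_cone \<kappa>. norm (1 - z) powr a * norm (f z) < e'"
      using tendstoD[OF lim e'] by (simp add: dist_norm)
    then obtain d1 where d1: "d1 > 0"
      "\<And>z. z \<in> left_cone \<kappa> \<Longrightarrow> z \<noteq> 1 \<Longrightarrow> dist z 1 < d1 \<Longrightarrow> norm (1 - z) powr a * norm (f z) < e'"
      unfolding eventually_at by blast
    \<comment> \<open>Halved because points of the Cauchy disc may be farther from 1 than its
      centre, by a factor below 2.\<close>
    define d2 where "d2 = min d d1 / 2"
    have d2: "d2 > 0" using d1 d by (simp add: d2_def)
    have main: "norm (1 - z) powr (a + 1) * norm (deriv f z) < e"
      if z: "z \<in> left_cone (\<kappa> / 2)" "z \<noteq> 1" "dist z 1 < d2" for z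
    proof -
      define y where "y = norm (1 - z)"
      have y: "y > 0" "y < d2" using z by (auto simp: y_def dist_norm norm_minus_commute)
      define R where "R = \<kappa> / 8 * y"
      have R: "R > 0" "R \<le> y / 2" using y \<kappa> by (auto simp: R_def)
      have inside: "w \<in> left_cone \<kappa>" "w \<in> ball 1 (min d d1)" "w \<noteq> 1" "y / 2 \<le> norm (1 - w)" "norm (1 - w) \<le> 2 * y"
        if w: "norm (z - w) \<le> R" for w
      proof -
        show "w \<in> left_cone \<kappa>"
          using w by (intro ball_subset_cone[OF z(1) \<kappa>]) (simp add: R_def y_def norm_minus_commute)
        have "norm (1 - w) \<le> y + norm (z - w)"
          unfolding y_def using norm_triangle_ineq[of "1 - z" "z - w"] by simp
        then show "norm (1 - w) \<le> 2 * y" "w \<in> ball 1 (min d d1)"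
          using w R y by (auto simp: dist_norm d2_def)
        show yw: "y / 2 \<le> norm (1 - w)"
          unfolding y_def using norm_triangle_ineq2[of "1 - z" "w - z"] w R
          by (simp add: norm_minus_commute y_def)
        show "w \<noteq> 1" using yw y by auto
      qed
      have sub: "cball z R \<subseteq> U"
        using inside d by (auto simp: dist_norm subset_iff)
      have bd: "norm (f w) \<le> e' * 2 powr \<bar>a\<bar> * y powr (- a)" if "norm (z - w) = R" for w
      proof -
        note i = inside[of w]
        have "norm (1 - w) powr a * norm (f w) < e'"
          using i that by (intro d1) (auto simp: dist_commute)
        then have "norm (f w) \<le> e' * norm (1 - w) powr (- a)"
          using i that y by (auto simp: powr_minus field_simps)
        also have "\<dots> \<le> e' * (2 powr \<bar>- a\<bar> * y powr (- a))"
          using i that y e' by (intro mult_left_mono powr_le_two_powr) auto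
        finally show ?thesis by (simp add: mult_ac)
      qed
      have "norm ((deriv ^^ 1) f z) \<le> fact 1 * (e' * 2 powr \<bar>a\<bar> * y powr (- a)) / R ^ 1"
      proof (rule Cauchy_inequality)
        show "f holomorphic_on ball z R"
          using U(2) sub ball_subset_cball by (metis holomorphic_on_subset)
        show "continuous_on (cball z R) f"
          using holomorphic_on_imp_continuous_on[OF holomorphic_on_subset[OF U(2) sub]] .
      qed (use R bd in auto)
      then have "norm (deriv f z) \<le> e' * 2 powr \<bar>a\<bar> * y powr (- a) / R" by simp
      also have "\<dots> = e' * C * (y powr (- a) / y)"
        using \<kappa> y by (simp add: R_def C_def field_simps)
      also have "y powr (- a) / y = y powr (- (a + 1))"
        using y by (simp add: powr_diff)
      finally have "norm (deriv f z) \<le> e' * C * y powr (- (a + 1))" .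
      then have "y powr (a + 1) * norm (deriv f z) \<le> y powr (a + 1) * (e' * C * y powr (- (a + 1)))"
        by (intro mult_left_mono) auto
      also have "\<dots> = e' * C * y powr ((a + 1) + (- (a + 1)))"
        by (simp only: powr_add mult_ac)
      also have "\<dots> = e' * C" using y by simp
      also have "\<dots> < e" using e C by (simp add: e'_def)
      finally show ?thesis by (simp add: y_def)
    qed
    show "\<forall>\<^sub>F z in at 1 within left_cone (\<kappa> / 2). dist (norm (1 - z) powr (a + 1) *\<^sub>R deriv f z) 0 < e"
      unfolding eventually_at using main d2 by (auto intro!: exI[of _ d2])
  qed
qed

text \<open>
  On the circle \<open>\<bar>z\<bar> = r\<close> one has \<open>\<bar>1 - z\<bar>\<^sup>2 = (1 - z) (z - r\<^sup>2) / z\<close>, which turns the mean of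
  \<open>\<bar>1 - z\<bar>\<^sup>-\<^sup>2\<close> into a Cauchy integral.
\<close>

lemma circle_integral_inverse_square:
  fixes r :: real
  assumes r: "0 < r" "r < 1"
  shows "((\<lambda>t. 1 / norm (1 - of_real r * exp (2 * of_real pi * \<i> * of_real t)) ^ 2)
            has_integral 1 / (1 - r\<^sup>2)) {0..1::real}"
proof -
  let ?e = "\<lambda>t. exp (2 * of_real pi * \<i> * of_real t) :: complex"
  have h: "(\<lambda>z. 1 / (1 - z)) holomorphic_on ball 0 1" by (auto intro!: holomorphic_intros)
  have sub: "cball 0 r \<subseteq> ball (0::complex) 1" using r by auto
  have r2: "r\<^sup>2 < r" using r by (simp add: power2_eq_square)
  have "((\<lambda>u. 1 / (1 - u) / (u - of_real (r\<^sup>2))) has_contour_integral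
          (2 * of_real pi * \<i> * (1 / (1 - of_real (r\<^sup>2))))) (circlepath 0 r)"
  proof (rule Cauchy_integral_circlepath)
    show "continuous_on (cball 0 r) (\<lambda>z::complex. 1 / (1 - z))"
      using holomorphic_on_imp_continuous_on[OF h] sub by (rule continuous_on_subset)
    show "(\<lambda>z::complex. 1 / (1 - z)) holomorphic_on ball 0 r"
      using h by (rule holomorphic_on_subset) (use sub in auto)
    show "norm (of_real (r\<^sup>2) - 0 :: complex) < r"
      using r2 by (simp add: norm_power)
  qed
  then have "((\<lambda>t. 1 / (1 - of_real r * ?e t) / (of_real r * ?e t - of_real (r\<^sup>2)) *
        (2 * of_real pi * \<i> * of_real r * ?e t))
      has_integral (2 * of_real pi * \<i> * (1 / (1 - of_real (r\<^sup>2))))) {0..1}"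
    unfolding has_contour_integral_def
    by (rule has_integral_eq[rotated])
       (simp add: vector_derivative_circlepath01, simp add: circlepath)
  from has_integral_mult_right[OF this, of "1 / (2 * of_real pi * \<i>)"]
  have I: "((\<lambda>t. 1 / (2 * of_real pi * \<i>) * (1 / (1 - of_real r * ?e t) / (of_real r * ?e t - of_real (r\<^sup>2)) *
        (2 * of_real pi * \<i> * of_real r * ?e t)))
      has_integral (of_real (1 / (1 - r\<^sup>2)))) {0..1}"
    by simp
  have eq: "1 / (2 * of_real pi * \<i>) * (1 / (1 - of_real r * ?e t) / (of_real r * ?e t - of_real (r\<^sup>2)) *
        (2 * of_real pi * \<i> * of_real r * ?e t)) =
      of_real (1 / norm (1 - of_real r * ?e t) ^ 2)" for t :: real
  proof -
    define z where "z = ?e t"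
    have z0: "z \<noteq> 0" by (simp add: z_def)
    have "norm z = 1" by (simp add: z_def)
    then have cz: "z * cnj z = 1" by (simp flip: complex_norm_square)
    have n: "of_real (norm (1 - of_real r * z) ^ 2) = (1 - of_real r * z) * (1 - of_real r * cnj z)"
      unfolding complex_norm_square by simp
    have "(1 - of_real r * cnj z) * (of_real r * z) = of_real r * z - of_real r * of_real r * (z * cnj z)"
      by (simp add: algebra_simps)
    then have q: "of_real r * z - of_real (r\<^sup>2) = (1 - of_real r * cnj z) * (of_real r * z)"
      by (simp add: cz power2_eq_square)
    have "1 / (2 * of_real pi * \<i>) * (1 / (1 - of_real r * z) / (of_real r * z - of_real (r\<^sup>2)) *
        (2 * of_real pi * \<i> * of_real r * z)) =
       1 / (1 - of_real r * z) * (of_real r * z / (of_real r * z - of_real (r\<^sup>2)))"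
      by simp
    also have "of_real r * z / (of_real r * z - of_real (r\<^sup>2)) = 1 / (1 - of_real r * cnj z)"
      unfolding q using z0 r by simp
    also have "1 / (1 - of_real r * z) * (1 / (1 - of_real r * cnj z)) = 1 / of_real (norm (1 - of_real r * z) ^ 2)"
      unfolding n by simp
    finally show ?thesis by (simp add: z_def)
  qed
  from has_integral_Re[OF I[unfolded eq]] show ?thesis by (simp only: Re_complex_of_real)
qed


lemma fps_expansion_deriv_nth:
  "fps_expansion (deriv f) 0 $ n = of_nat (Suc n) * fps_expansion f 0 $ Suc n"
  by (simp add: fps_expansion_def funpow_Suc_right field_simps del: funpow.simps of_nat_Suc)

text \<open>The mean of \<open>1 / norm (1 - z) ^ 2\<close> over the circle is
  \<open>1 / (1 - r\<^sup>2)\<close>, while its maximum is \<open>1 / (1 - r)\<^sup>2\<close>. Using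
  the mean gains the factor \<open>1 - r\<close> that makes the later coefficient bound sharp;
  \<open>M\<close> is for the arc away from 1.\<close>

lemma fps_expansion_nth_circle_bound:
  fixes r :: real
  assumes f: "f holomorphic_on ball 0 1" and r: "0 < r" "r < 1"
    and bd: "\<And>z. norm z = r \<Longrightarrow> norm (f z) \<le> A / norm (1 - z) ^ 2 + M"
  shows "norm (fps_expansion f 0 $ n) \<le> (A / (1 - r\<^sup>2) + M) / r ^ n"
proof -
  let ?e = "\<lambda>t. of_real r * exp (2 * of_real pi * \<i> * of_real t) :: complex"
  have sub: "cball 0 r \<subseteq> ball (0::complex) 1" using r by auto
  have ne: "norm (?e t) = r" for t :: real using r by (simp add: norm_mult)
  have "((\<lambda>u. f u / (u - 0) ^ (Suc n)) has_contour_integral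
      (2 * of_real pi * \<i>) / fact n * (deriv ^^ n) f 0) (circlepath 0 r)"
    using Cauchy_has_contour_integral_higher_derivative_circlepath[of 0 r f 0 n] r
      holomorphic_on_imp_continuous_on[OF holomorphic_on_subset[OF f sub]]
      holomorphic_on_subset[OF f order_trans[OF ball_subset_cball sub]] by simp
  then have "((\<lambda>t. f (?e t) / (?e t) ^ Suc n * (2 * of_real pi * \<i> * ?e t))
      has_integral (2 * of_real pi * \<i>) / fact n * (deriv ^^ n) f 0) {0..1}"
    unfolding has_contour_integral_def
    by (rule has_integral_eq[rotated])
       (simp add: vector_derivative_circlepath01, simp add: circlepath mult_ac)
  from has_integral_mult_right[OF this, of "1 / (2 * of_real pi * \<i>)"]
  have I: "((\<lambda>t. 1 / (2 * of_real pi * \<i>) * (f (?e t) / (?e t) ^ Suc n * (2 * of_real pi * \<i> * ?e t)))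
      has_integral fps_expansion f 0 $ n) {0..1}" (is "(?g has_integral _) _")
    by (simp add: fps_expansion_def)
  have J: "((\<lambda>t. (A * (1 / norm (1 - ?e t) ^ 2) + M) / r ^ n) has_integral
      (A * (1 / (1 - r\<^sup>2)) + M) / r ^ n) {0..1}"
    using has_integral_add[OF has_integral_mult_right[OF circle_integral_inverse_square[OF r]]
       has_integral_const_real[of M 0 1]]
    by (intro has_integral_divide) simp
  have "norm (integral {0..1} ?g) \<le> integral {0..1} (\<lambda>t. (A * (1 / norm (1 - ?e t) ^ 2) + M) / r ^ n)"
  proof (rule integral_norm_bound_integral)
    fix t :: real
    have "norm (?g t) = norm (f (?e t)) / r ^ n"
      using ne[of t] r by (simp add: norm_mult norm_divide norm_power)
    also have "\<dots> \<le> (A / norm (1 - ?e t) ^ 2 + M) / r ^ n"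
      using bd[OF ne[of t]] r by (intro divide_right_mono) auto
    finally show "norm (?g t) \<le> (A * (1 / norm (1 - ?e t) ^ 2) + M) / r ^ n" by simp
  qed (use I J in auto)
  then show ?thesis
    unfolding integral_unique[OF I] integral_unique[OF J] by simp
qed

text \<open>For \<open>r = n / (n + 1)\<close> the bound \<open>norm (1 - z) powr (- a)\<close> is
  at most \<open>(1 - r) powr (2 - a) / norm (1 - z) ^ 2\<close>, because
  \<open>2 - a \<le> 0\<close>. The mean of the latter is of order
  \<open>(1 - r) powr (1 - a)\<close>, that is \<open>n powr (a - 1)\<close>.\<close>

lemma transfer_little_o_ge_2:
  fixes f :: "complex \<Rightarrow> complex" and a :: real
  assumes U: "cball 0 1 - {1} \<subseteq> U" "f holomorphic_on U" and \<kappa>: "0 < \<kappa>" and a: "a \<ge> 2"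
    and lim: "((\<lambda>z. norm (1 - z) powr a *\<^sub>R f z) \<longlongrightarrow> 0) (at 1 within left_cone \<kappa>)"
  shows "(\<lambda>n. real n powr (1 - a) * norm (fps_expansion f 0 $ n)) \<longlonglongrightarrow> 0"
proof (rule LIMSEQ_I, goal_cases)
  case (1 e)
  \<comment> \<open>The 6 is 3, which bounds \<open>1 / r ^ n\<close>, times 2, which leaves half of
    \<open>e\<close> for \<open>M\<close>; \<open>2 powr (a - 1)\<close> absorbs
    \<open>n + 1 \<le> 2 * n\<close>.\<close>
  define e' where "e' = e / (6 * 2 powr (a - 1))"
  have e': "e' > 0" using 1 by (simp add: e'_def)
  have "\<forall>\<^sub>F z in at 1 within left_cone \<kappa>. norm (1 - z) powr a * norm (f z) < e'"
    using tendstoD[OF lim e'] by (simp add: dist_norm)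
  then obtain d1 where d1: "d1 > 0"
    "\<And>z. z \<in> left_cone \<kappa> \<Longrightarrow> z \<noteq> 1 \<Longrightarrow> dist z 1 < d1 \<Longrightarrow> norm (1 - z) powr a * norm (f z) < e'"
    unfolding eventually_at by blast
  have "compact (cball (0::complex) 1 - ball 1 d1)" by (intro compact_diff) auto
  moreover have "continuous_on (cball 0 1 - ball 1 d1) f"
    using U d1(1) by (intro holomorphic_on_imp_continuous_on) (auto intro!: holomorphic_on_subset[OF U(2)])
  ultimately have "bounded (f ` (cball 0 1 - ball 1 d1))"
    by (intro compact_imp_bounded compact_continuous_image)
  then obtain M where M: "M > 0" "\<And>z. z \<in> cball 0 1 - ball 1 d1 \<Longrightarrow> norm (f z) \<le> M"
    unfolding bounded_pos by auto
  have holo: "f holomorphic_on ball 0 1"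
    using U by (auto intro!: holomorphic_on_subset[OF U(2)])
  have coeff: "norm (fps_expansion f 0 $ n) \<le> 3 * (e' * (real n + 1) powr (a - 1) + M)" if n: "n \<ge> 1" for n
  proof -
    define r where "r = real n / (real n + 1)"
    have r: "0 < r" "r < 1" using n by (auto simp: r_def)
    have r1: "1 - r = 1 / (real n + 1)" by (simp add: r_def field_simps)
    have "norm (fps_expansion f 0 $ n) \<le> (e' * (1 - r) powr (2 - a) / (1 - r\<^sup>2) + M) / r ^ n"
    proof (rule fps_expansion_nth_circle_bound[OF holo r])
      fix z :: complex assume z: "norm z = r"
      have y: "norm (1 - z) \<ge> 1 - r" using norm_triangle_ineq2[of 1 z] z by simp
      have y0: "norm (1 - z) > 0" using y r by linarith
      show "norm (f z) \<le> e' * (1 - r) powr (2 - a) / norm (1 - z) ^ 2 + M"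
      proof (cases "dist z 1 < d1")
        case True
        have "norm (1 - z) powr a * norm (f z) < e'"
          using z r \<kappa> True by (intro d1 unit_disc_subset_cone) auto
        then have "norm (f z) \<le> e' / norm (1 - z) powr a" using y0 by (simp add: field_simps)
        also have "\<dots> = e' * (norm (1 - z) powr (2 - a) / norm (1 - z) ^ 2)"
          using y0 by (simp add: powr_diff)
        also have "\<dots> \<le> e' * ((1 - r) powr (2 - a) / norm (1 - z) ^ 2)"
          using e' y r a by (intro mult_left_mono divide_right_mono powr_mono2') auto
        finally show ?thesis using M by simp
      next
        case False
        then have "norm (f z) \<le> M" using z r by (intro M) (auto simp: dist_commute)
        moreover have "e' * (1 - r) powr (2 - a) / norm (1 - z) ^ 2 \<ge> 0" using e' by simp
        ultimately show ?thesis by linarith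
      qed
    qed
    also have "\<dots> \<le> (e' * (real n + 1) powr (a - 1) + M) * 3"
    proof -
      have "r\<^sup>2 \<le> r" using r by (simp add: power2_eq_square)
      then have "e' * (1 - r) powr (2 - a) / (1 - r\<^sup>2) \<le> e' * (1 - r) powr (2 - a) / (1 - r)"
        using e' r by (intro divide_left_mono mult_pos_pos) auto
      also have "\<dots> = e' * (1 - r) powr (1 - a)"
      proof -
        have "(1 - r) powr (2 - a) = (1 - r) powr (1 - a) * (1 - r) powr 1"
          by (simp only: powr_add[symmetric]) simp
        then show ?thesis using r by simp
      qed
      also have "(1 - r) powr (1 - a) = (real n + 1) powr (a - 1)"
        unfolding r1 by (simp add: powr_divide powr_diff)
      finally have A: "e' * (1 - r) powr (2 - a) / (1 - r\<^sup>2) + M \<le> e' * (real n + 1) powr (a - 1) + M" by simp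
      have "1 / r ^ n = (1 + 1 / real n) ^ n"
        using n by (simp add: r_def field_simps power_divide)
      also have "\<dots> \<le> exp (1 / real n) ^ n" by (intro power_mono exp_ge_add_one_self) auto
      also have "\<dots> = exp 1" using n by (simp flip: exp_of_nat_mult)
      also have "\<dots> \<le> 3" by (rule exp_le)
      finally have "1 / r ^ n \<le> 3" .
      then have "(e' * (1 - r) powr (2 - a) / (1 - r\<^sup>2) + M) * (1 / r ^ n) \<le> (e' * (real n + 1) powr (a - 1) + M) * 3"
        using A e' M r by (intro mult_mono) auto
      then show ?thesis by simp
    qed
    finally show ?thesis by (simp add: mult_ac)
  qed
  \<comment> \<open>Away from 1 only boundedness is available; its contribution is negligible
    because \<open>1 - a < 0\<close>.\<close>
  have "(\<lambda>n. 3 * M * real n powr (1 - a)) \<longlonglongrightarrow> 3 * M * 0"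
    using a by (intro tendsto_mult_left tendsto_neg_powr filterlim_real_sequentially) auto
  then have "\<forall>\<^sub>F n in sequentially. 3 * M * real n powr (1 - a) < e / 2"
    using 1 by (intro order_tendstoD) auto
  then obtain n0 where n0: "\<And>n. n \<ge> n0 \<Longrightarrow> 3 * M * real n powr (1 - a) < e / 2"
    unfolding eventually_sequentially by blast
  have "norm (real n powr (1 - a) * norm (fps_expansion f 0 $ n) - 0) < e" if n: "n \<ge> max n0 1" for n
  proof -
    have "real n powr (1 - a) * norm (fps_expansion f 0 $ n) \<le>
        real n powr (1 - a) * (3 * (e' * (real n + 1) powr (a - 1) + M))"
      using coeff n by (intro mult_left_mono) auto
    also have "\<dots> \<le> real n powr (1 - a) * (3 * (e' * (2 * real n) powr (a - 1) + M))"
      using e' a n by (intro mult_left_mono add_right_mono powr_mono2) auto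
    also have "\<dots> = 3 * e' * 2 powr (a - 1) * (real n powr (1 - a) * real n powr (a - 1)) + 3 * M * real n powr (1 - a)"
      by (simp add: powr_mult algebra_simps)
    also have "real n powr (1 - a) * real n powr (a - 1) = 1"
      using n by (simp flip: powr_add)
    also have "3 * e' * 2 powr (a - 1) * 1 = e / 2" by (simp add: e'_def)
    finally show ?thesis using n0[of n] n by (simp add: abs_mult)
  qed
  then show ?case by blast
qed

lemma tendsto_within_left_cone_half:
  assumes "(F \<longlongrightarrow> l) (at 1 within left_cone \<kappa>)" "0 < \<kappa>"
  shows "(F \<longlongrightarrow> l) (at 1 within left_cone (\<kappa> / 2))"
  using assms by (intro tendsto_within_subset[OF assms(1) cone_mono]) auto

text \<open>
  Differentiating raises \<open>a\<close> by 1 and multiplies the coefficients by \<open>n\<close>, so it suffices to treat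
  \<open>a \<ge> 2\<close>.
\<close>

theorem transfer_little_o:
  fixes f :: "complex \<Rightarrow> complex" and a :: real
  assumes U: "open U" "cball 0 1 - {1} \<subseteq> U" "f holomorphic_on U"
    and d: "d > 0" "left_cone \<kappa> \<inter> ball 1 d \<subseteq> U"
    and \<kappa>: "0 < \<kappa>" "\<kappa> \<le> 1"
    and lim: "((\<lambda>z. norm (1 - z) powr a *\<^sub>R f z) \<longlongrightarrow> 0) (at 1 within left_cone \<kappa>)"
  shows "(\<lambda>n. real n powr (1 - a) * norm (fps_expansion f 0 $ n)) \<longlonglongrightarrow> 0"
proof -
  \<comment> \<open>After \<open>k\<close> derivatives the exponent is at least 2. The cone
    parameter is generalised too, since every derivative halves it.\<close>
  have "(\<lambda>n. real n powr (1 - a) * norm (fps_expansion f 0 $ n)) \<longlonglongrightarrow> 0" if "a + real k \<ge> 2" for k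
    using that U(3) d(2) \<kappa> lim
  proof (induction k arbitrary: f a \<kappa>)
    case 0
    then show ?case using U by (intro transfer_little_o_ge_2[of U f \<kappa>]) auto
  next
    case (Suc k)
    have "(\<lambda>n. real n powr (1 - (a + 1)) * norm (fps_expansion (deriv f) 0 $ n)) \<longlonglongrightarrow> 0"
    proof (rule Suc.IH[where \<kappa> = "\<kappa> / 2"])
      show "deriv f holomorphic_on U" using Suc.prems U by (intro holomorphic_deriv)
      show "left_cone (\<kappa> / 2) \<inter> ball 1 d \<subseteq> U" using Suc.prems cone_mono[of "\<kappa> / 2" \<kappa>] by auto
      show "((\<lambda>z. norm (1 - z) powr (a + 1) *\<^sub>R deriv f z) \<longlongrightarrow> 0) (at 1 within left_cone (\<kappa> / 2))"
        using Suc.prems U d by (intro deriv_little_o[of U f d]) auto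
    qed (use Suc.prems in auto)
    then have A: "(\<lambda>n. real n powr (- a) * (real (Suc n) * norm (fps_expansion f 0 $ Suc n))) \<longlonglongrightarrow> 0"
      by (simp add: fps_expansion_deriv_nth norm_mult del: of_nat_Suc)
    \<comment> \<open>Differentiation shifted the index: this ratio trades
      \<open>n powr (- a)\<close> for \<open>Suc n powr (- a)\<close>, and the factor
      \<open>Suc n\<close> raises the exponent to \<open>1 - a\<close>.\<close>
    have "(\<lambda>n. (real (Suc n) / real n) powr (- a)) \<longlonglongrightarrow> 1 powr (- a)"
      by (intro tendsto_powr LIMSEQ_Suc_n_over_n tendsto_const) auto
    from tendsto_mult[OF A this]
    have "(\<lambda>n. real n powr (- a) * (real (Suc n) * norm (fps_expansion f 0 $ Suc n)) *
        (real (Suc n) / real n) powr (- a)) \<longlonglongrightarrow> 0" by simp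
    then have "(\<lambda>n. real (Suc n) powr (1 - a) * norm (fps_expansion f 0 $ Suc n)) \<longlonglongrightarrow> 0"
    proof (rule Lim_transform_eventually)
      show "\<forall>\<^sub>F n in sequentially. real n powr (- a) * (real (Suc n) * norm (fps_expansion f 0 $ Suc n)) *
        (real (Suc n) / real n) powr (- a) = real (Suc n) powr (1 - a) * norm (fps_expansion f 0 $ Suc n)"
        using eventually_gt_at_top[of 0]
      proof eventually_elim
        case (elim n)
        have "real (Suc n) powr (1 - a) = real (Suc n) powr 1 * real (Suc n) powr (- a)"
          by (simp only: powr_add[symmetric]) simp
        then show ?case using elim by (simp add: powr_divide del: of_nat_Suc)
      qed
    qed
    then show ?case by (subst (asm) filterlim_sequentially_Suc)
  qed
  moreover obtain k where "2 - a \<le> real k" using real_arch_simple by blast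
  ultimately show ?thesis by (auto simp: algebra_simps)
qed

section \<open>Comparison with powers of \<open>1 - z\<close>\<close>

definition slit :: "complex set" where
  "slit = {z. 1 - z \<notin> \<real>\<^sub>\<le>\<^sub>0}"

lemma open_slit: "open slit"
proof -
  have "slit = (\<lambda>z. 1 - z) -` (- \<real>\<^sub>\<le>\<^sub>0)" by (auto simp: slit_def)
  moreover have "open ((\<lambda>z. 1 - z) -` (- \<real>\<^sub>\<le>\<^sub>0 :: complex set))"
    by (intro open_vimage open_Compl closed_nonpos_Reals_complex continuous_intros)
  ultimately show ?thesis by simp
qed

text \<open>\<open>slit\<close> is the plane without the reals from 1 on, the domain on which
  principal powers of \<open>1 - z\<close> are holomorphic. On the removed ray
  \<open>Re (z - 1) = norm (z - 1)\<close>, which contradicts the cone inequality when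
  \<open>\<kappa> \<le> 1\<close>.\<close>

lemma cone_subset_slit:
  assumes "\<kappa> \<le> 1"
  shows "left_cone \<kappa> \<subseteq> slit"
proof
  fix z assume z: "z \<in> left_cone \<kappa>"
  show "z \<in> slit"
  proof (rule ccontr)
    assume "z \<notin> slit"
    then obtain x where x: "1 - z = of_real x" "x \<le> 0"
      by (auto simp: slit_def elim!: nonpos_Reals_cases)
    then have "z - 1 = of_real (- x)" by (simp add: algebra_simps flip: x(1))
    with z have "- x < \<kappa> * \<bar>x\<bar>"
      unfolding left_cone_def mem_Collect_eq by (metis Re_complex_of_real abs_minus_cancel norm_of_real)
    moreover have "\<kappa> * \<bar>x\<bar> \<le> 1 * \<bar>x\<bar>" using assms by (intro mult_right_mono) auto
    ultimately show False using x by simp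
  qed
qed

lemma unit_cball_subset_slit: "cball 0 1 - {1} \<subseteq> slit"
proof
  fix z :: complex assume z: "z \<in> cball 0 1 - {1}"
  show "z \<in> slit"
  proof (rule ccontr)
    assume "z \<notin> slit"
    then obtain x where x: "1 - z = of_real x" "x \<le> 0"
      by (auto simp: slit_def elim!: nonpos_Reals_cases)
    then have "z = of_real (1 - x)" by (simp flip: x(1))
    then have "norm z = 1 - x" using x by (simp del: of_real_diff)
    then show False using z x by auto
  qed
qed

lemma holomorphic_powr_slit: "(\<lambda>z. (1 - z) powr c) holomorphic_on slit"
  by (auto intro!: holomorphic_intros simp: slit_def)

lemma fps_expansion_one_minus_powr_nth:
  fixes c :: complex
  shows
  "fps_expansion (\<lambda>z. (1 - z) powr c) 0 $ n = (-1) ^ n * (c gchoose n)"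
proof -
  have ev: "\<forall>\<^sub>F u in nhds 0. (\<lambda>n. ((-1) ^ n * (c gchoose n)) * u ^ n) sums (1 - u) powr c"
  proof -
    have "\<forall>\<^sub>F u::complex in nhds 0. u \<in> ball 0 1" by (intro eventually_nhds_in_open) auto
    then show ?thesis
    proof eventually_elim
      case (elim u)
      have "(\<lambda>n. (c gchoose n) * (- u) ^ n) sums (1 + (- u)) powr c"
        using elim by (intro gen_binomial_complex) auto
      then show ?case by (simp add: power_minus[of u] mult_ac)
    qed
  qed
  have "(\<lambda>z. (1 - z) powr c) has_fps_expansion Abs_fps (\<lambda>n. (-1) ^ n * (c gchoose n))"
    using ev by (intro has_fps_expansionI) simp
  from fps_expansion_eqI[OF this] show ?thesis by simp
qed

text \<open>With the entire function \<open>rGamma\<close> the limit is 0 at nonpositive integers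
  \<open>a\<close>, where the function is a polynomial near 0, so these need no separate
  case.\<close>

lemma one_minus_powr_coeff_asymptotics:
  fixes a :: real
  shows "(\<lambda>n. of_real (real n powr (1 - a)) * fps_expansion (\<lambda>z::complex. (1 - z) powr of_real (- a)) 0 $ n)
           \<longlonglongrightarrow> of_real (rGamma a)"
proof -
  have "(\<lambda>n. (of_real (- a) gchoose n) / ((- 1) ^ n / exp ((of_real (- a) + 1) * of_real (ln (real n)))))
     \<longlonglongrightarrow> inverse (Gamma (- of_real (- a) :: complex))"
    by (rule gbinomial_asymptotic)
  then have "(\<lambda>n. (of_real (- a) gchoose n) / ((- 1) ^ n / exp ((of_real (- a) + 1) * of_real (ln (real n)))))
     \<longlonglongrightarrow> complex_of_real (rGamma a)"
    by (simp add: rGamma_inverse_Gamma Gamma_complex_of_real)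
  then show ?thesis
  proof (rule Lim_transform_eventually)
    show "\<forall>\<^sub>F n in sequentially. (of_real (- a) gchoose n) / ((- 1) ^ n / exp ((of_real (- a) + 1) * of_real (ln (real n))))
      = of_real (real n powr (1 - a)) * fps_expansion (\<lambda>z::complex. (1 - z) powr of_real (- a)) 0 $ n"
      using eventually_gt_at_top[of 0]
    proof eventually_elim
      case (elim n)
      have "exp ((of_real (- a) + 1) * of_real (ln (real n))) = complex_of_real (exp ((1 - a) * ln (real n)))"
        by (simp flip: exp_of_real)
      also have "\<dots> = of_real (real n powr (1 - a))" using elim by (simp add: powr_def)
      finally have e: "exp ((of_real (- a) + 1) * of_real (ln (real n))) = complex_of_real (real n powr (1 - a))" .
      have sq: "inverse ((-1) ^ n) = ((-1) ^ n :: complex)"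
        by (simp add: power_inverse[symmetric])
      show ?case
        unfolding e fps_expansion_one_minus_powr_nth by (simp add: divide_inverse sq mult_ac)
    qed
  qed
qed

text \<open>For real \<open>a\<close> the modulus of \<open>(1 - z) powr a\<close> is exactly
  \<open>norm (1 - z) powr a\<close>, whatever the argument of \<open>1 - z\<close>. This links a
  singular expansion stated as a limit to the error form used by
  \<open>transfer_little_o\<close>.\<close>

lemma tendsto_one_minus_powr_iff:
  fixes f :: "complex \<Rightarrow> complex" and a :: real
  shows "((\<lambda>z. f z * (1 - z) powr of_real a) \<longlongrightarrow> C) (at 1 within S) \<longleftrightarrow>
     ((\<lambda>z. norm (1 - z) powr a *\<^sub>R (f z - C * (1 - z) powr of_real (- a))) \<longlongrightarrow> 0) (at 1 within S)"
proof -
  have "((\<lambda>z. f z * (1 - z) powr of_real a) \<longlongrightarrow> C) (at 1 within S) \<longleftrightarrow>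
     ((\<lambda>z. norm (f z * (1 - z) powr of_real a - C)) \<longlongrightarrow> 0) (at 1 within S)"
    by (simp add: LIM_zero_iff tendsto_norm_zero_iff)
  also have "\<dots> \<longleftrightarrow> ((\<lambda>z. norm (norm (1 - z) powr a *\<^sub>R (f z - C * (1 - z) powr of_real (- a)))) \<longlongrightarrow> 0) (at 1 within S)"
  proof (rule filterlim_cong[OF refl refl])
    show "\<forall>\<^sub>F z in at 1 within S. norm (f z * (1 - z) powr of_real a - C) =
        norm (norm (1 - z) powr a *\<^sub>R (f z - C * (1 - z) powr of_real (- a)))"
      unfolding eventually_at
    proof (intro exI[of _ 1] conjI ballI impI)
      fix z :: complex assume "z \<in> S" "z \<noteq> 1 \<and> dist z 1 < 1"
      then have z: "1 - z \<noteq> 0" by auto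
      have "f z * (1 - z) powr of_real a - C = (1 - z) powr of_real a * (f z - C * (1 - z) powr of_real (- a))"
        using z by (simp add: powr_minus field_simps)
      then show "norm (f z * (1 - z) powr of_real a - C) =
        norm (norm (1 - z) powr a *\<^sub>R (f z - C * (1 - z) powr of_real (- a)))"
        by (simp add: norm_mult norm_powr_real_powr')
    qed simp
  qed
  also have "\<dots> \<longleftrightarrow> ((\<lambda>z. norm (1 - z) powr a *\<^sub>R (f z - C * (1 - z) powr of_real (- a))) \<longlongrightarrow> 0) (at 1 within S)"
    by (rule tendsto_norm_zero_iff)
  finally show ?thesis .
qed

text \<open>Subtract the model \<open>C * (1 - z) powr (- a)\<close>: the difference falls under
  \<open>transfer_little_o\<close>, the model under the binomial series. The domain is intersected
  with \<open>slit\<close>, where the model is holomorphic.\<close>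

theorem transfer:
  fixes f :: "complex \<Rightarrow> complex" and a :: real
  assumes U: "open U" "cball 0 1 - {1} \<subseteq> U" "f holomorphic_on U"
    and d: "d > 0" "left_cone \<kappa> \<inter> ball 1 d \<subseteq> U"
    and \<kappa>: "0 < \<kappa>" "\<kappa> \<le> 1"
    and lim: "((\<lambda>z. f z * (1 - z) powr of_real a) \<longlongrightarrow> C) (at 1 within left_cone \<kappa>)"
  shows "(\<lambda>n. of_real (real n powr (1 - a)) * fps_expansion f 0 $ n) \<longlonglongrightarrow> C * of_real (rGamma a)"
proof -
  define p where "p = (\<lambda>z::complex. (1 - z) powr of_real (- a))"
  define g where "g = (\<lambda>z. f z - C * p z)"
  have p: "p holomorphic_on slit" unfolding p_def by (rule holomorphic_powr_slit)
  have "(\<lambda>n. real n powr (1 - a) * norm (fps_expansion g 0 $ n)) \<longlonglongrightarrow> 0"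
  proof (rule transfer_little_o)
    show "open (U \<inter> slit)" using U open_slit by auto
    show "cball 0 1 - {1} \<subseteq> U \<inter> slit" using U unit_cball_subset_slit by auto
    show "g holomorphic_on U \<inter> slit"
      unfolding g_def using U p by (auto intro!: holomorphic_intros intro: holomorphic_on_subset)
    show "left_cone \<kappa> \<inter> ball 1 d \<subseteq> U \<inter> slit" using d cone_subset_slit[OF \<kappa>(2)] by auto
    show "((\<lambda>z. norm (1 - z) powr a *\<^sub>R g z) \<longlongrightarrow> 0) (at 1 within left_cone \<kappa>)"
      using lim unfolding tendsto_one_minus_powr_iff g_def p_def .
  qed (use d \<kappa> in auto)
  then have "(\<lambda>n. norm (of_real (real n powr (1 - a)) * fps_expansion g 0 $ n)) \<longlonglongrightarrow> 0"
    by (simp add: norm_mult)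
  then have 1: "(\<lambda>n. of_real (real n powr (1 - a)) * fps_expansion g 0 $ n) \<longlonglongrightarrow> 0"
    by (rule tendsto_norm_zero_cancel)
  have 2: "(\<lambda>n. C * (of_real (real n powr (1 - a)) * fps_expansion p 0 $ n)) \<longlonglongrightarrow> C * of_real (rGamma a)"
    unfolding p_def by (intro tendsto_mult_left one_minus_powr_coeff_asymptotics)
  have f: "f has_fps_expansion fps_expansion f 0"
    using U by (intro has_fps_expansion_fps_expansion[of U]) auto
  have "p has_fps_expansion fps_expansion p 0"
    using p open_slit unit_cball_subset_slit by (intro has_fps_expansion_fps_expansion[of slit]) auto
  then have "g has_fps_expansion fps_expansion f 0 - fps_const C * fps_expansion p 0"
    unfolding g_def using f by (intro fps_expansion_intros)
  then have "fps_expansion g 0 = fps_expansion f 0 - fps_const C * fps_expansion p 0"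
    by (rule fps_expansion_eqI)
  then have "fps_expansion g 0 $ n = fps_expansion f 0 $ n - C * fps_expansion p 0 $ n" for n
    by simp
  with tendsto_add[OF 1 2] show ?thesis
    by (simp add: algebra_simps)
qed


section \<open>Coefficient asymptotics of the critical series\<close>

definition fps_complex :: "real fps \<Rightarrow> complex fps" where
  "fps_complex f = Abs_fps (\<lambda>n. of_real (f $ n))"

lemma fps_complex_nth [simp]: "fps_complex f $ n = of_real (f $ n)"
  by (simp add: fps_complex_def)

lemma fps_complex_1 [simp]: "fps_complex 1 = 1"
  by (simp add: fps_eq_iff)

lemma fps_complex_diff: "fps_complex (f - g) = fps_complex f - fps_complex g"
  by (simp add: fps_eq_iff)

lemma fps_complex_mult: "fps_complex (f * g) = fps_complex f * fps_complex g"
  by (simp add: fps_eq_iff fps_mult_nth)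

lemma fps_complex_power: "fps_complex (f ^ n) = fps_complex f ^ n"
  by (induction n) (simp_all add: fps_complex_mult)

lemma fps_complex_deriv: "fps_complex (fps_deriv f) = fps_deriv (fps_complex f)"
  by (simp add: fps_eq_iff)

lemma fps_complex_X [simp]: "fps_complex fps_X = fps_X"
  by (simp add: fps_eq_iff fps_X_def)

lemma fps_complex_inverse:
  fixes f :: "real fps"
  assumes "f $ 0 \<noteq> 0"
  shows "fps_complex (inverse f) = inverse (fps_complex f)"
proof -
  have "fps_complex f * fps_complex (inverse f) = 1"
    using assms by (simp add: inverse_mult_eq_1' flip: fps_complex_mult)
  then show ?thesis by (metis fps_inverse_unique)
qed

text \<open>The normalised situation \<open>\<rho>\<^sub>H = 1\<close>, with \<open>b = - c\<^sub>H\<close>.\<close>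

locale unit_delta_series =
  fixes h :: "nat \<Rightarrow> real" and H :: "complex \<Rightarrow> complex" and U :: "complex set"
    and \<kappa> d \<alpha> b :: real
  assumes h_nonneg: "\<And>n. h n \<ge> 0" and h_0: "h 0 = 0"
    and open_U: "open U" and cball_U: "cball 0 1 - {1} \<subseteq> U" and holo_H: "H holomorphic_on U"
    and d_pos: "d > 0" and cone_U: "left_cone \<kappa> \<inter> ball 1 d \<subseteq> U"
    and \<kappa>: "0 < \<kappa>" "\<kappa> \<le> 1"
    and H_sums: "\<And>z. norm z < 1 \<Longrightarrow> (\<lambda>n. of_real (h n) * z ^ n) sums H z"
    and h_sums: "h sums 1"
    and \<alpha>: "0 < \<alpha>" "\<alpha> < 1" and b: "b \<noteq> 0"
    and H_lim: "((\<lambda>z. (1 - H z) * (1 - z) powr of_real (- \<alpha>)) \<longlongrightarrow> of_real b) (at 1 within left_cone \<kappa>)"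
begin

lemma H_expansion: "H has_fps_expansion fps_complex (Abs_fps h)"
proof -
  have "\<forall>\<^sub>F u::complex in nhds 0. u \<in> ball 0 1" by (intro eventually_nhds_in_open) auto
  then show ?thesis
    by (intro has_fps_expansionI) (auto elim!: eventually_mono intro: H_sums)
qed

text \<open>Transfer of \<open>1 - H\<close> with \<open>a = - \<alpha>\<close>; the constant 1
  affects only index 0. As \<open>rGamma (- \<alpha>) < 0\<close>, this limit of nonnegative terms
  also reveals the sign of \<open>b\<close>.\<close>

lemma h_asymp: "(\<lambda>n. real n powr (1 + \<alpha>) * h n) \<longlonglongrightarrow> - b * rGamma (- \<alpha>)"
proof -
  have "(\<lambda>n. of_real (real n powr (1 - (- \<alpha>))) * fps_expansion (\<lambda>z. 1 - H z) 0 $ n)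
          \<longlonglongrightarrow> of_real b * of_real (rGamma (- \<alpha>))"
    by (rule transfer[OF open_U cball_U _ d_pos cone_U \<kappa> H_lim]) (intro holomorphic_intros holo_H)
  moreover have "fps_expansion (\<lambda>z. 1 - H z) 0 = 1 - fps_complex (Abs_fps h)"
    by (intro fps_expansion_eqI fps_expansion_intros H_expansion)
  ultimately have "(\<lambda>n. of_real (real n powr (1 + \<alpha>)) * (1 - fps_complex (Abs_fps h)) $ n)
          \<longlonglongrightarrow> of_real b * complex_of_real (rGamma (- \<alpha>))" by simp
  then have "(\<lambda>n. of_real (- (real n powr (1 + \<alpha>) * h n))) \<longlonglongrightarrow> complex_of_real b * of_real (rGamma (- \<alpha>))"
  proof (rule Lim_transform_eventually)
    show "\<forall>\<^sub>F n in sequentially. of_real (real n powr (1 + \<alpha>)) * (1 - fps_complex (Abs_fps h)) $ n =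
        of_real (- (real n powr (1 + \<alpha>) * h n))"
      using eventually_gt_at_top[of 0] by eventually_elim auto
  qed
  then have "(\<lambda>n. - (real n powr (1 + \<alpha>) * h n)) \<longlonglongrightarrow> b * rGamma (- \<alpha>)"
    unfolding of_real_mult[symmetric] tendsto_of_real_iff .
  from tendsto_minus[OF this] show ?thesis by simp
qed

lemma rGamma_neg: "rGamma (- \<alpha>) < 0"
proof -
  have "rGamma (1 - \<alpha>) > 0" using \<alpha> by (simp add: rGamma_inverse_Gamma)
  moreover have "rGamma (- \<alpha>) = (- \<alpha>) * rGamma (1 - \<alpha>)"
    using rGamma_plus1[of "- \<alpha>"] by simp
  ultimately show ?thesis using \<alpha> by (simp add: mult_pos_pos)
qed

lemma b_pos: "b > 0"
proof -
  have "- b * rGamma (- \<alpha>) \<ge> 0"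
    using h_asymp by (rule tendsto_lowerbound) (auto intro!: always_eventually mult_nonneg_nonneg h_nonneg)
  then show ?thesis using rGamma_neg b by (simp add: mult_le_0_iff)
qed

lemma h_limit_pos: "- b * rGamma (- \<alpha>) > 0"
  using b_pos rGamma_neg by (simp add: mult_pos_neg)

lemma eventually_h_pos: "\<forall>\<^sub>F n in sequentially. h n > 0"
  using order_tendstoD(1)[OF h_asymp h_limit_pos]
  by eventually_elim (metis h_nonneg less_eq_real_def mult_zero_right)

text \<open>\<open>1 - Re (H z)\<close> is the sum of the nonnegative terms
  \<open>h n * (1 - Re (z ^ n))\<close>, so each single term is a lower bound. On the circle, where
  \<open>H\<close> is given by continuation, this follows by a radial limit.\<close>

lemma Re_H_le:
  assumes "z \<in> cball 0 1 - {1}"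
  shows "h m * (1 - Re (z ^ m)) \<le> 1 - Re (H z)"
proof -
  have disc: "h m * (1 - Re (z ^ m)) \<le> 1 - Re (H z)" if z: "norm z < 1" for z
  proof -
    have "(\<lambda>n. Re (of_real (h n) * z ^ n)) sums Re (H z)"
      using H_sums[OF z] by (rule sums_Re)
    then have s: "(\<lambda>n. h n * (1 - Re (z ^ n))) sums (1 - Re (H z))"
      using sums_diff[OF h_sums] by (simp add: algebra_simps)
    have nn: "h n * (1 - Re (z ^ n)) \<ge> 0" for n
    proof -
      have "Re (z ^ n) \<le> norm (z ^ n)" by (rule complex_Re_le_cmod)
      also have "\<dots> \<le> 1" using z by (simp add: norm_power power_le_one)
      finally show ?thesis using h_nonneg[of n] by simp
    qed
    have "sum (\<lambda>n. h n * (1 - Re (z ^ n))) {m} \<le> (\<Sum>n. h n * (1 - Re (z ^ n)))"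
      using s nn by (intro sum_le_suminf) (auto simp: sums_iff)
    then show ?thesis using s by (simp add: sums_iff)
  qed
  define w where "w k = of_real (1 - inverse (real (Suc k))) * z" for k
  have "(\<lambda>k. 1 - inverse (real (Suc k))) \<longlonglongrightarrow> 1 - 0"
    by (intro tendsto_intros LIMSEQ_inverse_real_of_nat)
  then have "w \<longlonglongrightarrow> of_real (1 - 0) * z"
    unfolding w_def by (intro tendsto_mult_right tendsto_of_real)
  then have w: "w \<longlonglongrightarrow> z" by simp
  have "isCont H z"
    using holomorphic_on_imp_continuous_on[OF holo_H] open_U assms cball_U
    by (meson continuous_on_eq_continuous_at subsetD)
  then have "(\<lambda>k. H (w k)) \<longlonglongrightarrow> H z" using w by (rule isCont_tendsto_compose)
  then have 1: "(\<lambda>k. 1 - Re (H (w k))) \<longlonglongrightarrow> 1 - Re (H z)" by (intro tendsto_intros)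
  have 2: "(\<lambda>k. h m * (1 - Re (w k ^ m))) \<longlonglongrightarrow> h m * (1 - Re (z ^ m))"
    using w by (intro tendsto_intros)
  have wn: "norm (w k) < 1" for k
  proof -
    have "norm (w k) = (1 - inverse (real (Suc k))) * norm z"
      by (simp add: w_def norm_mult del: of_real_diff of_nat_Suc) (simp add: field_simps)
    also have "\<dots> \<le> (1 - inverse (real (Suc k))) * 1"
      using assms by (intro mult_left_mono) (auto simp: field_simps)
    also have "\<dots> < 1" by simp
    finally show ?thesis .
  qed
  show ?thesis
    using disc[OF wn] by (intro LIMSEQ_le[OF 2 1]) auto
qed

text \<open>
  Since \<open>h\<^sub>n > 0\<close> for all large \<open>n\<close>, the series is aperiodic and 1 is attained only at \<open>z = 1\<close>.
\<close>

lemma H_neq_1: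
  assumes "z \<in> cball 0 1 - {1}"
  shows "H z \<noteq> 1"
proof
  assume H1: "H z = 1"
  have pow: "z ^ m = 1" if "h m > 0" for m
  proof -
    have "h m * (1 - Re (z ^ m)) \<le> 0" using Re_H_le[OF assms, of m] H1 by simp
    then have "Re (z ^ m) \<ge> 1" using that by (simp add: mult_le_0_iff)
    moreover have n: "norm (z ^ m) \<le> 1" using assms by (simp add: norm_power power_le_one)
    moreover have "Re (z ^ m) \<le> norm (z ^ m)" by (rule complex_Re_le_cmod)
    ultimately have e: "norm (z ^ m) = 1" "Re (z ^ m) = 1" by linarith+
    then have "Im (z ^ m) = 0" using cmod_power2[of "z ^ m"] by simp
    with e show ?thesis by (simp add: complex_eq_iff)
  qed
  obtain N where N: "\<And>n. n \<ge> N \<Longrightarrow> h n > 0"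
    using eventually_h_pos unfolding eventually_sequentially by blast
  \<comment> \<open>Two consecutive exponents with power 1 leave only \<open>z = 1\<close>.\<close>
  have "z ^ Suc N = z * z ^ N" by simp
  then have "z = 1" using pow[of N] pow[of "Suc N"] N by simp
  then show False using assms by simp
qed


text \<open>The later transfers divide by \<open>1 - H\<close>. Near 1 it does not vanish since its
  normalised limit \<open>b\<close> is nonzero, on the rest of the closed disc by
  \<open>H_neq_1\<close>. A transfer asks only for an open set, without uniform width beyond the
  circle, so removing the solutions of \<open>H z = 1\<close> from \<open>U\<close> is
  enough.\<close>

lemma domain_H_neq_1:
  obtains V e where "open V" "V \<subseteq> U" "cball 0 1 - {1} \<subseteq> V" "e > 0" "left_cone \<kappa> \<inter> ball 1 e \<subseteq> V"
    "\<And>z. z \<in> V \<Longrightarrow> H z \<noteq> 1"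
proof -
  have "\<forall>\<^sub>F z in at 1 within left_cone \<kappa>. (1 - H z) * (1 - z) powr of_real (- \<alpha>) \<noteq> 0"
    using b by (intro tendsto_imp_eventually_ne[OF H_lim]) auto
  then obtain e where e: "e > 0"
    "\<And>z. z \<in> left_cone \<kappa> \<Longrightarrow> z \<noteq> 1 \<Longrightarrow> dist z 1 < e \<Longrightarrow> (1 - H z) * (1 - z) powr of_real (- \<alpha>) \<noteq> 0"
    unfolding eventually_at by blast
  define V where "V = {z \<in> U. H z \<in> - {1}}"
  have "open V"
    unfolding V_def using continuous_open_preimage[OF holomorphic_on_imp_continuous_on[OF holo_H] open_U open_Compl[OF closed_singleton[of 1]]]
    by (simp add: vimage_def Int_def)
  moreover have "left_cone \<kappa> \<inter> ball 1 (min d e) \<subseteq> V"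
  proof
    fix z assume z: "z \<in> left_cone \<kappa> \<inter> ball 1 (min d e)"
    then have "z \<in> U" using cone_U by auto
    moreover have "z \<noteq> 1" using z by (auto simp: left_cone_def)
    then have "(1 - H z) * (1 - z) powr of_real (- \<alpha>) \<noteq> 0"
      using z by (intro e) (auto simp: dist_commute)
    ultimately show "z \<in> V" by (auto simp: V_def)
  qed
  ultimately show ?thesis
    using cball_U H_neq_1 d_pos e(1) by (intro that[of V "min d e"]) (auto simp: V_def)
qed

lemma inverse_power_asymp:
  "(\<lambda>n. real n powr (1 - real s * \<alpha>) * inverse ((1 - Abs_fps h) ^ s) $ n)
     \<longlonglongrightarrow> rGamma (real s * \<alpha>) / b ^ s"
proof -
  define f where "f = (\<lambda>z. inverse ((1 - H z) ^ s))"
  from domain_H_neq_1 obtain V e where V: "open V" "V \<subseteq> U" "cball 0 1 - {1} \<subseteq> V" "e > 0"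
    "left_cone \<kappa> \<inter> ball 1 e \<subseteq> V" "\<And>z. z \<in> V \<Longrightarrow> H z \<noteq> 1" by blast
  have "((\<lambda>z. inverse (((1 - H z) * (1 - z) powr of_real (- \<alpha>)) ^ s)) \<longlongrightarrow> inverse (of_real b ^ s)) (at 1 within left_cone \<kappa>)"
    using b by (intro tendsto_intros H_lim) auto
  then have lim: "((\<lambda>z. f z * (1 - z) powr of_real (real s * \<alpha>)) \<longlongrightarrow> inverse (of_real b ^ s)) (at 1 within left_cone \<kappa>)"
  proof (rule Lim_transform_eventually)
    show "\<forall>\<^sub>F z in at 1 within left_cone \<kappa>. inverse (((1 - H z) * (1 - z) powr of_real (- \<alpha>)) ^ s) =
      f z * (1 - z) powr of_real (real s * \<alpha>)"
      unfolding eventually_at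
    proof (intro exI[of _ 1] conjI ballI impI)
      fix z :: complex assume "z \<in> left_cone \<kappa>" "z \<noteq> 1 \<and> dist z 1 < 1"
      then have z: "1 - z \<noteq> 0" by auto
      have "((1 - z) powr of_real (- \<alpha>)) ^ s = (1 - z) powr (of_nat s * of_real (- \<alpha>))"
        using z by (simp add: powr_def mult.assoc flip: exp_of_nat_mult)
      then have "inverse (((1 - z) powr of_real (- \<alpha>)) ^ s) = (1 - z) powr of_real (real s * \<alpha>)"
        by (simp add: powr_minus)
      then show "inverse (((1 - H z) * (1 - z) powr of_real (- \<alpha>)) ^ s) =
          f z * (1 - z) powr of_real (real s * \<alpha>)"
        by (simp only: f_def power_mult_distrib inverse_mult_distrib)
    qed simp
  qed
  have "(\<lambda>n. of_real (real n powr (1 - real s * \<alpha>)) * fps_expansion f 0 $ n)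
          \<longlonglongrightarrow> inverse (of_real b ^ s) * of_real (rGamma (real s * \<alpha>))"
  proof (rule transfer[OF V(1,3) _ V(4,5) \<kappa> lim])
    show "f holomorphic_on V"
      unfolding f_def using V by (auto intro!: holomorphic_intros holomorphic_on_subset[OF holo_H])
  qed
  moreover have "fps_expansion f 0 = fps_complex (inverse ((1 - Abs_fps h) ^ s))"
  proof (rule fps_expansion_eqI)
    have "f has_fps_expansion inverse ((1 - fps_complex (Abs_fps h)) ^ s)"
      unfolding f_def using h_0 by (intro fps_expansion_intros H_expansion) (simp add: fps_power_zeroth)
    then show "f has_fps_expansion fps_complex (inverse ((1 - Abs_fps h) ^ s))"
      using h_0 by (simp add: fps_complex_inverse fps_complex_power fps_complex_diff fps_power_zeroth)
  qed
  ultimately have "(\<lambda>n. complex_of_real (real n powr (1 - real s * \<alpha>) * inverse ((1 - Abs_fps h) ^ s) $ n))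
          \<longlonglongrightarrow> of_real (rGamma (real s * \<alpha>) / b ^ s)"
    by (simp add: field_simps)
  then show ?thesis unfolding tendsto_of_real_iff .
qed

text \<open>Near 1 the quotient behaves as \<open>b * \<alpha> * (1 - z) powr (\<alpha> - 1)\<close>
  over \<open>b * (1 - z) powr \<alpha>\<close>, so as \<open>\<alpha> / (1 - z)\<close>. An
  asymptotic relation cannot be differentiated in general; here \<open>deriv_little_o\<close>
  differentiates the error term \<open>g\<close>, at the price of the cone
  \<open>\<kappa> / 2\<close>.\<close>

lemma log_deriv_asymp:
  "(\<lambda>n. (fps_X * fps_deriv (Abs_fps h) * inverse (1 - Abs_fps h)) $ n) \<longlonglongrightarrow> \<alpha>"
proof -
  define f where "f = (\<lambda>z. z * deriv H z * inverse (1 - H z))"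
  from domain_H_neq_1 obtain V e where V: "open V" "V \<subseteq> U" "cball 0 1 - {1} \<subseteq> V" "e > 0"
    "left_cone \<kappa> \<inter> ball 1 e \<subseteq> V" "\<And>z. z \<in> V \<Longrightarrow> H z \<noteq> 1" by blast
  define p where "p = (\<lambda>z::complex. (1 - z) powr of_real \<alpha>)"
  define g where "g = (\<lambda>z. 1 - H z - of_real b * p z)"
  have hp: "p holomorphic_on slit" unfolding p_def by (rule holomorphic_powr_slit)
  have oUs: "open (U \<inter> slit)" using open_U open_slit by auto
  have sub: "left_cone \<kappa> \<inter> ball 1 d \<subseteq> U \<inter> slit" using cone_U cone_subset_slit[OF \<kappa>(2)] by auto
  have hg: "g holomorphic_on U \<inter> slit"
    unfolding g_def by (intro holomorphic_intros holomorphic_on_subset[OF holo_H] holomorphic_on_subset[OF hp]) auto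
  have "((\<lambda>z. norm (1 - z) powr (- \<alpha>) *\<^sub>R g z) \<longlongrightarrow> 0) (at 1 within left_cone \<kappa>)"
    using H_lim unfolding tendsto_one_minus_powr_iff g_def p_def by simp
  from deriv_little_o[OF oUs hg d_pos sub \<kappa> this]
  have D: "((\<lambda>z. norm (1 - z) powr (1 - \<alpha>) *\<^sub>R deriv g z) \<longlongrightarrow> 0) (at 1 within left_cone (\<kappa> / 2))"
    by (simp add: add.commute)
  have dg: "deriv g z = - deriv H z + of_real (b * \<alpha>) * (1 - z) powr of_real (- (1 - \<alpha>))" if z: "z \<in> U \<inter> slit" for z
  proof -
    have 1: "(H has_field_derivative deriv H z) (at z)"
      using z open_U holo_H by (auto intro: holomorphic_derivI)
    have 2: "(p has_field_derivative - (of_real \<alpha> * (1 - z) powr (of_real \<alpha> - 1))) (at z)"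
      unfolding p_def using z by (auto simp: slit_def intro!: derivative_eq_intros)
    have "(g has_field_derivative (0 - deriv H z - of_real b * (- (of_real \<alpha> * (1 - z) powr (of_real \<alpha> - 1))))) (at z)"
      unfolding g_def by (intro derivative_intros 1 DERIV_cmult 2)
    from DERIV_imp_deriv[OF this] show ?thesis by simp
  qed
  have "((\<lambda>z. norm (1 - z) powr (1 - \<alpha>) *\<^sub>R
      (deriv H z - of_real (b * \<alpha>) * (1 - z) powr of_real (- (1 - \<alpha>)))) \<longlongrightarrow> 0) (at 1 within left_cone (\<kappa> / 2))"
    using tendsto_minus[OF D, unfolded minus_zero]
  proof (rule Lim_transform_eventually)
    show "\<forall>\<^sub>F z in at 1 within left_cone (\<kappa> / 2). - (norm (1 - z) powr (1 - \<alpha>) *\<^sub>R deriv g z) =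
      norm (1 - z) powr (1 - \<alpha>) *\<^sub>R (deriv H z - of_real (b * \<alpha>) * (1 - z) powr of_real (- (1 - \<alpha>)))"
      unfolding eventually_at
    proof (intro exI[of _ d] conjI ballI impI d_pos)
      fix z :: complex assume "z \<in> left_cone (\<kappa> / 2)" "z \<noteq> 1 \<and> dist z 1 < d"
      then have "z \<in> U \<inter> slit"
        using sub cone_mono[of "\<kappa> / 2" \<kappa>] \<kappa> by (auto simp: dist_commute)
      from dg[OF this] show "- (norm (1 - z) powr (1 - \<alpha>) *\<^sub>R deriv g z) =
        norm (1 - z) powr (1 - \<alpha>) *\<^sub>R (deriv H z - of_real (b * \<alpha>) * (1 - z) powr of_real (- (1 - \<alpha>)))"
        by (simp only: scaleR_minus_right[symmetric]) simp
    qed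
  qed
  then have H': "((\<lambda>z. deriv H z * (1 - z) powr of_real (1 - \<alpha>)) \<longlongrightarrow> of_real (b * \<alpha>)) (at 1 within left_cone (\<kappa> / 2))"
    unfolding tendsto_one_minus_powr_iff .
  have lim1: "((\<lambda>z. z * (deriv H z * (1 - z) powr of_real (1 - \<alpha>)) * inverse ((1 - H z) * (1 - z) powr of_real (- \<alpha>)))
      \<longlongrightarrow> 1 * of_real (b * \<alpha>) * inverse (of_real b)) (at 1 within left_cone (\<kappa> / 2))"
    using b by (intro tendsto_intros H' tendsto_within_left_cone_half[OF H_lim \<kappa>(1)]) auto
  have lim: "((\<lambda>z. f z * (1 - z) powr of_real 1) \<longlongrightarrow> of_real \<alpha>) (at 1 within left_cone (\<kappa> / 2))"
  proof (rule Lim_transform_eventually)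
    show "((\<lambda>z. z * (deriv H z * (1 - z) powr of_real (1 - \<alpha>)) * inverse ((1 - H z) * (1 - z) powr of_real (- \<alpha>)))
      \<longlongrightarrow> of_real \<alpha>) (at 1 within left_cone (\<kappa> / 2))"
      using lim1 b by (simp add: field_simps)
    show "\<forall>\<^sub>F z in at 1 within left_cone (\<kappa> / 2).
      z * (deriv H z * (1 - z) powr of_real (1 - \<alpha>)) * inverse ((1 - H z) * (1 - z) powr of_real (- \<alpha>)) =
      f z * (1 - z) powr of_real 1"
      unfolding eventually_at
    proof (intro exI[of _ 1] conjI ballI impI)
      fix z :: complex assume "z \<in> left_cone (\<kappa> / 2)" "z \<noteq> 1 \<and> dist z 1 < 1"
      have i: "inverse ((1 - z) powr of_real (- \<alpha>)) = (1 - z) powr of_real \<alpha>"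
        by (simp add: powr_minus)
      have "(1 - z) powr of_real (1 - \<alpha>) * (1 - z) powr of_real \<alpha> = (1 - z) powr of_real 1"
        by (simp flip: powr_add)
      then show "z * (deriv H z * (1 - z) powr of_real (1 - \<alpha>)) * inverse ((1 - H z) * (1 - z) powr of_real (- \<alpha>)) =
        f z * (1 - z) powr of_real 1"
        unfolding inverse_mult_distrib i f_def by (simp add: mult_ac)
    qed simp
  qed
  have "(\<lambda>n. of_real (real n powr (1 - 1)) * fps_expansion f 0 $ n) \<longlonglongrightarrow> of_real \<alpha> * of_real (rGamma 1)"
  proof (rule transfer[OF V(1,3) _ V(4) _ _ _ lim])
    show "f holomorphic_on V"
      unfolding f_def using V
      by (auto intro!: holomorphic_intros holomorphic_on_subset[OF holo_H]
          holomorphic_on_subset[OF holomorphic_deriv[OF holo_H open_U]])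
    show "left_cone (\<kappa> / 2) \<inter> ball 1 e \<subseteq> V" using V cone_mono[of "\<kappa> / 2" \<kappa>] \<kappa> by auto
  qed (use \<kappa> in auto)
  moreover have "fps_expansion f 0 = fps_complex (fps_X * fps_deriv (Abs_fps h) * inverse (1 - Abs_fps h))"
  proof (rule fps_expansion_eqI)
    have "f has_fps_expansion fps_X * fps_deriv (fps_complex (Abs_fps h)) * inverse (1 - fps_complex (Abs_fps h))"
      unfolding f_def using h_0 by (intro fps_expansion_intros H_expansion) simp
    then show "f has_fps_expansion fps_complex (fps_X * fps_deriv (Abs_fps h) * inverse (1 - Abs_fps h))"
      using h_0 by (simp only: fps_complex_mult fps_complex_X fps_complex_deriv fps_complex_diff fps_complex_inverse)
        (simp add: fps_complex_inverse fps_complex_diff)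
  qed
  ultimately have "(\<lambda>n. complex_of_real (real n powr 0 * (fps_X * fps_deriv (Abs_fps h) * inverse (1 - Abs_fps h)) $ n))
          \<longlonglongrightarrow> of_real \<alpha>"
    by (simp add: rGamma_inverse_Gamma del: powr_zero_eq_one)
  then have "(\<lambda>n. real n powr 0 * (fps_X * fps_deriv (Abs_fps h) * inverse (1 - Abs_fps h)) $ n) \<longlonglongrightarrow> \<alpha>"
    unfolding tendsto_of_real_iff .
  then show ?thesis
    by (rule Lim_transform_eventually) (use eventually_gt_at_top[of 0] in eventually_elim, simp)
qed

end

section \<open>Factorial moments of the number of components\<close>

lemma fps_lift_nth [simp]: "fps_lift f $ n = [:f $ n:]"
  by (simp add: fps_lift_def)

lemma fps_lift_1: "fps_lift 1 = 1"
  by (simp add: fps_eq_iff one_pCons)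

lemma fps_lift_mult: "fps_lift (f * g) = fps_lift f * fps_lift g"
proof -
  have sum: "[:sum f A:] = (\<Sum>x\<in>A. [:f x:])" for f :: "nat \<Rightarrow> real" and A
    by (simp add: poly_eq_iff coeff_sum coeff_pCons split: nat.split)
  show ?thesis by (simp add: fps_eq_iff fps_mult_nth sum mult.commute)
qed

lemma fps_lift_power: "fps_lift (f ^ n) = fps_lift f ^ n"
  by (induction n) (simp_all add: fps_lift_1 fps_lift_mult)

text \<open>Binomial expansion of \<open>H + h j * (v - 1) * z ^ j\<close>, where
  \<open>[:-1, 1:]\<close> is \<open>v - 1\<close>. Powers of \<open>v - 1\<close> are kept because
  the shift \<open>v \<mapsto> v + 1\<close> turns them into monomials.\<close>

lemma refined_fps_power_nth:
  "(refined_fps h j ^ i) $ n = (\<Sum>k\<le>i. smult (real (i choose k) * h j ^ k *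
      (if j * k \<le> n then (Abs_fps h ^ (i - k)) $ (n - j * k) else 0)) ([:-1, 1:] ^ k))"
proof -
  have eq: "refined_fps h j = fps_const (smult (h j) [:-1, 1:]) * fps_X ^ j + fps_lift (Abs_fps h)"
    by (simp add: fps_eq_iff refined_fps_nth)
  have "refined_fps h j ^ i = (\<Sum>k\<le>i. of_nat (i choose k) *
      (fps_const (smult (h j) [:-1, 1:]) * fps_X ^ j) ^ k * fps_lift (Abs_fps h ^ (i - k)))"
    unfolding eq binomial_ring by (simp add: fps_lift_power)
  also have "\<dots> = (\<Sum>k\<le>i. fps_const (smult (real (i choose k) * h j ^ k) ([:-1, 1:] ^ k)) *
      (fps_X ^ (j * k) * fps_lift (Abs_fps h ^ (i - k))))"
  proof (intro sum.cong refl)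
    fix k
    have "of_nat (i choose k) = (fps_const [:real (i choose k):] :: real poly fps)"
      by (simp add: fps_of_nat of_nat_poly flip: fps_of_nat)
    moreover have "[:- h j, h j:] ^ k = smult (h j ^ k) ([:-1, 1:] ^ k)"
      using smult_power[of "h j" "[:-1, 1:]" k] by simp
    ultimately show "of_nat (i choose k) *
      (fps_const (smult (h j) [:-1, 1:]) * fps_X ^ j) ^ k * fps_lift (Abs_fps h ^ (i - k)) =
      fps_const (smult (real (i choose k) * h j ^ k) ([:-1, 1:] ^ k)) *
      (fps_X ^ (j * k) * fps_lift (Abs_fps h ^ (i - k)))"
      by (simp add: power_mult_distrib power_mult fps_const_power smult_power mult_ac)
  qed
  finally have *: "refined_fps h j ^ i = \<dots>" .
  show ?thesis
    unfolding * by (auto simp: fps_sum_nth fps_X_power_mult_nth mult_ac intro!: sum.cong)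
qed

lemma pcompose_shift_power: "pcompose ([:-1, 1:] ^ k) [:1, 1:] = monom (1::real) k"
proof (induction k)
  case 0
  then show ?case by (simp add: pcompose_1 one_pCons)
next
  case (Suc k)
  have "pcompose [:-1, 1:] [:1, 1::real:] = [:0, 1:]" by (simp add: pcompose_pCons)
  then show ?case by (simp only: power_Suc pcompose_mult Suc) (simp add: monom_Suc)
qed

text \<open>Taylor expansion at \<open>v = 1\<close>: the coefficient of \<open>v ^ s\<close> in
  \<open>(1 + v) ^ k\<close> is \<open>k choose s\<close>, and \<open>fact s\<close> times it is the
  falling factorial. For the generating polynomial in \<open>v\<close> this yields unnormalised
  factorial moments.\<close>

lemma coeff_pcompose_shift:
  fixes p :: "real poly"
  shows "fact s * coeff (pcompose p [:1, 1:]) s =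
    (\<Sum>k\<le>degree p. coeff p k * (\<Prod>i<s. real k - real i))"
proof -
  have "p = (\<Sum>k\<le>degree p. smult (coeff p k) (monom 1 k))"
    by (subst (1) poly_as_sum_of_monoms[symmetric]) (simp add: smult_monom)
  then have "pcompose p [:1, 1:] = pcompose (\<Sum>k\<le>degree p. smult (coeff p k) (monom 1 k)) [:1, 1:]"
    by simp
  also have "\<dots> = (\<Sum>k\<le>degree p. smult (coeff p k) ([:1, 1:] ^ k))"
  proof -
    have "pcompose (monom 1 k) [:1, 1:] = [:1, 1::real:] ^ k" for k
    proof (induction k)
      case (Suc k)
      then show ?case by (simp add: monom_Suc pcompose_pCons)
    qed (simp add: pcompose_1)
    then show ?thesis by (simp add: pcompose_sum pcompose_smult)
  qed
  finally have "pcompose p [:1, 1:] = (\<Sum>k\<le>degree p. smult (coeff p k) ([:1, 1:] ^ k))" .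
  then have "fact s * coeff (pcompose p [:1, 1:]) s = (\<Sum>k\<le>degree p. coeff p k * (fact s * coeff ([:1, 1:] ^ k) s))"
    by (simp add: coeff_sum sum_distrib_left mult_ac)
  also have "\<dots> = (\<Sum>k\<le>degree p. coeff p k * (\<Prod>i<s. real k - real i))"
  proof (intro sum.cong refl arg_cong2[of _ _ _ _ "(*)"])
    fix k
    have "coeff ([:1, 1:] ^ k) s = real (k choose s)"
    proof (cases "s \<le> k")
      case True
      then show ?thesis by (simp add: coeff_linear_poly_power)
    next
      case False
      have "degree ([:1, 1::real:] ^ k) \<le> 1 * k"
        using degree_power_le[of "[:1, 1::real:]" k] by simp
      then show ?thesis using False by (simp add: coeff_eq_0 binomial_eq_0)
    qed
    then show "fact s * coeff ([:1, 1:] ^ k) s = (\<Prod>i<s. real k - real i)"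
      using gbinomial_mult_fact[of s "real k"] by (simp add: binomial_gbinomial atLeast0LessThan)
  qed
  finally show ?thesis .
qed

lemma coeff_cycle_fps_shift:
  "coeff (pcompose (cycle_fps h j $ n) [:1, 1:]) s =
     (\<Sum>i=1..n. 1 / real i * (real (i choose s) * h j ^ s *
        (if j * s \<le> n then (Abs_fps h ^ (i - s)) $ (n - j * s) else 0)))"
proof -
  have "coeff (pcompose (refined_fps h j ^ i $ n) [:1, 1:]) s = real (i choose s) * h j ^ s *
        (if j * s \<le> n then (Abs_fps h ^ (i - s)) $ (n - j * s) else 0)" for i
  proof -
    define c where "c k = real (i choose k) * h j ^ k *
      (if j * k \<le> n then (Abs_fps h ^ (i - k)) $ (n - j * k) else 0)" for k
    have "coeff (pcompose (refined_fps h j ^ i $ n) [:1, 1:]) s = (\<Sum>k\<le>i. c k * (if k = s then 1 else 0))"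
      unfolding refined_fps_power_nth c_def[symmetric]
      by (simp add: pcompose_sum pcompose_smult pcompose_shift_power coeff_sum)
    also have "\<dots> = (if s \<le> i then c s else 0)"
      by (simp add: sum.delta' if_distrib cong: if_cong)
    \<comment> \<open>For \<open>s > i\<close> the truncated difference \<open>i - s\<close> inside
      \<open>c s\<close> is harmless: the binomial coefficient vanishes.\<close>
    also have "\<dots> = c s" by (auto simp: c_def binomial_eq_0)
    finally show ?thesis by (simp add: c_def)
  qed
  then show ?thesis
    unfolding cycle_fps_nth by (simp add: pcompose_sum pcompose_smult coeff_sum)
qed

text \<open>Negative binomial series in \<open>f\<close>. As \<open>f ^ l\<close> starts at order
  \<open>l\<close> or later, the sum may stop at any \<open>N \<ge> m\<close>; this freedom lets it
  match the truncated sums of \<open>cycle_fps_nth\<close>.\<close>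

lemma inverse_one_minus_power_nth:
  fixes f :: "real fps"
  assumes f: "f $ 0 = 0" and s: "s \<ge> 1" and N: "m \<le> N"
  shows "inverse ((1 - f) ^ s) $ m = (\<Sum>l\<le>N. real (l + s - 1 choose (s - 1)) * (f ^ l) $ m)"
proof -
  have "inverse ((1 - f) ^ s) = inverse ((1 - fps_X) ^ s) oo f"
    using f by (simp add: fps_inverse_compose fps_compose_power[symmetric] fps_compose_sub_distrib fps_power_zeroth)
  also have "inverse ((1 - fps_X) ^ s) = Abs_fps (\<lambda>k. real (s + k - 1 choose k))"
    using one_minus_const_fps_X_neg_power'[of s "1::real"] s by simp
  finally have "inverse ((1 - f) ^ s) $ m = (\<Sum>l=0..m. real (s + l - 1 choose l) * (f ^ l) $ m)"
    by (simp add: fps_compose_nth)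
  also have "\<dots> = (\<Sum>l=0..m. real (l + s - 1 choose (s - 1)) * (f ^ l) $ m)"
  proof (intro sum.cong refl)
    fix l
    have "(s + l - 1 choose l) = (l + s - 1 choose (s - 1))"
      using s by (subst binomial_symmetric) (auto simp: add.commute)
    then show "real (s + l - 1 choose l) * (f ^ l) $ m = real (l + s - 1 choose (s - 1)) * (f ^ l) $ m" by simp
  qed
  also have "\<dots> = (\<Sum>l\<le>N. real (l + s - 1 choose (s - 1)) * (f ^ l) $ m)"
    using N by (intro sum.mono_neutral_left) (auto simp: startsby_zero_power_prefix[OF f])
  finally show ?thesis .
qed

text \<open>The operator \<open>z d/dz\<close> multiplies the coefficient of \<open>z ^ n\<close> by
  \<open>n\<close> and sends \<open>H ^ i / i\<close> to \<open>z H' H ^ (i - 1)\<close>; the sum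
  over \<open>i\<close> is geometric. The value at \<open>v = 1\<close> is the case
  \<open>s = 0\<close> of \<open>coeff_cycle_fps_shift\<close>.\<close>

lemma poly_cycle_fps_1:
  assumes "h 0 = 0"
  shows "real n * poly (cycle_fps h j $ n) 1 =
    (fps_X * fps_deriv (Abs_fps h) * inverse (1 - Abs_fps h)) $ n"
proof -
  let ?f = "Abs_fps h"
  have "poly (cycle_fps h j $ n) 1 = coeff (pcompose (cycle_fps h j $ n) [:1, 1:]) 0"
    by (simp add: coeff_pcompose_0)
  also have "\<dots> = (\<Sum>i=1..n. 1 / real i * (?f ^ i) $ n)"
    unfolding coeff_cycle_fps_shift by simp
  finally have "real n * poly (cycle_fps h j $ n) 1 = (\<Sum>i=1..n. 1 / real i * (real n * (?f ^ i) $ n))"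
    by (simp add: sum_distrib_left mult_ac)
  also have "\<dots> = (\<Sum>i=1..n. ((fps_X * fps_deriv ?f) * ?f ^ (i - 1)) $ n)"
  proof (intro sum.cong refl)
    fix i assume i: "i \<in> {1..n}"
    then obtain n' where n': "n = Suc n'" by (cases n) auto
    have "real n * (?f ^ i) $ n = (fps_X * fps_deriv (?f ^ i)) $ n"
      by (simp add: n')
    also have "fps_X * fps_deriv (?f ^ i) = fps_const (real i) * (fps_X * fps_deriv ?f * ?f ^ (i - 1))"
      by (simp add: fps_deriv_power mult_ac)
    finally show "1 / real i * (real n * (?f ^ i) $ n) = ((fps_X * fps_deriv ?f) * ?f ^ (i - 1)) $ n"
      using i by simp
  qed
  also have "\<dots> = (\<Sum>i<n. ((fps_X * fps_deriv ?f) * ?f ^ i) $ n)"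
    by (rule sum.reindex_bij_witness[of _ Suc "\<lambda>i. i - 1"]) auto
  also have "\<dots> = (\<Sum>k=0..n. (fps_X * fps_deriv ?f) $ k * (\<Sum>i<n. (?f ^ i) $ (n - k)))"
    unfolding fps_mult_nth[of _ "?f ^ _"] by (subst sum.swap) (simp add: sum_distrib_left)
  also have "\<dots> = (\<Sum>k=0..n. (fps_X * fps_deriv ?f) $ k * inverse (1 - ?f) $ (n - k))"
  proof (intro sum.cong refl)
    fix k assume k: "k \<in> {0..n}"
    show "(fps_X * fps_deriv ?f) $ k * (\<Sum>i<n. (?f ^ i) $ (n - k)) =
        (fps_X * fps_deriv ?f) $ k * inverse (1 - ?f) $ (n - k)"
    \<comment> \<open>The sum stops at \<open>n - 1\<close>, one term short when
      \<open>k = 0\<close>; there the coefficient of \<open>z H'\<close> is zero.\<close>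
    proof (cases "k = 0")
      case False
      then have "{..<n} = {..n - 1}" "n - k \<le> n - 1" using k by auto
      then show ?thesis using inverse_one_minus_power_nth[of ?f 1 "n - k" "n - 1"] assms by simp
    qed simp
  qed
  finally show ?thesis by (simp add: fps_mult_nth)
qed

text \<open>The \<open>s\<close>-fold derivative of the cycle series in \<open>v\<close> at 1 is
  \<open>(s - 1)! (h\<^sub>j z\<^sup>j)\<^sup>s / (1 - H)\<^sup>s\<close>. On coefficients this is
  the absorption identity \<open>s * (i choose s) = i * (i - 1 choose (s - 1))\<close>, which
  cancels the weight \<open>1 / i\<close> of a cycle.\<close>

lemma cycle_fps_falling_factorial:
  assumes h0: "h 0 = 0" and j: "j \<ge> 1" and s: "s \<ge> 1"
  shows "(\<Sum>k\<le>degree (cycle_fps h j $ n). coeff (cycle_fps h j $ n) k * (\<Prod>i<s. real k - real i)) =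
    (if j * s \<le> n then fact (s - 1) * h j ^ s * inverse ((1 - Abs_fps h) ^ s) $ (n - j * s) else 0)"
proof -
  let ?f = "Abs_fps h"
  have "fact s * coeff (pcompose (cycle_fps h j $ n) [:1, 1:]) s =
    (if j * s \<le> n then fact (s - 1) * h j ^ s * inverse ((1 - Abs_fps h) ^ s) $ (n - j * s) else 0)"
  proof (cases "j * s \<le> n")
    case True
    have sn: "s \<le> n" using order_trans[OF mult_le_mono1[OF j, of s] True] by simp
    \<comment> \<open>\<open>j \<ge> 1\<close> makes the cut-off \<open>l \<le> n - s\<close> late
      enough for the coefficient at \<open>n - j * s\<close>.\<close>
    have m: "n - j * s \<le> n - s" using j by (intro diff_le_mono2) simp
    have fs: "fact s = real s * fact (s - 1)" using s by (simp add: fact_reduce)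
    have "fact s * coeff (pcompose (cycle_fps h j $ n) [:1, 1:]) s =
       fact (s - 1) * h j ^ s * (\<Sum>i=1..n. (real s * real (i choose s) / real i) * (?f ^ (i - s)) $ (n - j * s))"
      unfolding coeff_cycle_fps_shift fs using True by (simp add: sum_distrib_left mult_ac)
    also have "(\<Sum>i=1..n. (real s * real (i choose s) / real i) * (?f ^ (i - s)) $ (n - j * s)) =
        (\<Sum>i=1..n. real (i - 1 choose (s - 1)) * (?f ^ (i - s)) $ (n - j * s))"
    proof (intro sum.cong refl)
      fix i assume i: "i \<in> {1..n}"
      have "s * (i choose s) = i * (i - 1 choose (s - 1))"
        using i s binomial_absorption[of "s - 1" i] by simp
      then have "real s * real (i choose s) = real i * real (i - 1 choose (s - 1))"
        by (simp flip: of_nat_mult)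
      then show "(real s * real (i choose s) / real i) * (?f ^ (i - s)) $ (n - j * s) =
        real (i - 1 choose (s - 1)) * (?f ^ (i - s)) $ (n - j * s)"
        using i by simp
    qed
    also have "\<dots> = (\<Sum>i=s..n. real (i - 1 choose (s - 1)) * (?f ^ (i - s)) $ (n - j * s))"
      using s by (intro sum.mono_neutral_right) (auto simp: binomial_eq_0)
    also have "\<dots> = (\<Sum>l\<le>n - s. real (l + s - 1 choose (s - 1)) * (?f ^ l) $ (n - j * s))"
      using sn by (intro sum.reindex_bij_witness[of _ "\<lambda>l. l + s" "\<lambda>i. i - s"]) auto
    also have "\<dots> = inverse ((1 - ?f) ^ s) $ (n - j * s)"
      using h0 s m by (intro inverse_one_minus_power_nth[symmetric]) auto
    finally show ?thesis using True by simp
  next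
    case False
    then show ?thesis unfolding coeff_cycle_fps_shift by simp
  qed
  then show ?thesis unfolding coeff_pcompose_shift .
qed

lemma factorial_moment_component_pmf:
  assumes h: "\<And>n. h n \<ge> 0" "h 0 = 0" and j: "j \<ge> 1" and s: "s \<ge> 1"
    and nz: "poly (cycle_fps h j $ n) 1 \<noteq> 0"
  shows "factorial_moment (component_pmf h j n) s =
    (if j * s \<le> n then fact (s - 1) * h j ^ s * inverse ((1 - Abs_fps h) ^ s) $ (n - j * s) else 0) /
      poly (cycle_fps h j $ n) 1"
proof -
  let ?p = "cycle_fps h j $ n"
  have "factorial_moment (component_pmf h j n) s =
    (\<Sum>k\<le>degree ?p. (\<Prod>i<s. real k - real i) * pmf (component_pmf h j n) k)"
    unfolding factorial_moment_def
  proof (rule integral_measure_pmf_real)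
    fix k assume "k \<in> set_pmf (component_pmf h j n)"
    then have "coeff ?p k \<noteq> 0" using h nz by (auto simp: set_pmf_iff pmf_component_pmf)
    then show "k \<in> {..degree ?p}" by (simp add: le_degree)
  qed simp
  also have "\<dots> = (\<Sum>k\<le>degree ?p. coeff ?p k * (\<Prod>i<s. real k - real i)) / poly ?p 1"
    using h nz by (simp add: pmf_component_pmf sum_divide_distrib mult_ac)
  finally show ?thesis by (simp only: cycle_fps_falling_factorial[where h = h, OF h(2) j s])
qed

section \<open>Rescaling to radius 1 leaves the component law unchanged\<close>

lemma smult_sum_right: "smult a (\<Sum>x\<in>A. f x) = (\<Sum>x\<in>A. smult a (f x))"
  by (simp add: poly_eq_iff coeff_sum sum_distrib_left)

lemma cycle_fps_scale:
  "cycle_fps (\<lambda>n. h n * \<rho> ^ n) j $ n = smult (\<rho> ^ n) (cycle_fps h j $ n)"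
proof -
  have "(refined_fps (\<lambda>n. h n * \<rho> ^ n) j ^ i) $ n = smult (\<rho> ^ n) ((refined_fps h j ^ i) $ n)" for i n
  proof (induction i arbitrary: n)
    case 0
    then show ?case by simp
  next
    case (Suc i)
    have r: "refined_fps (\<lambda>n. h n * \<rho> ^ n) j $ k = smult (\<rho> ^ k) (refined_fps h j $ k)" for k
      by (simp add: refined_fps_nth mult_ac)
    show ?case
      unfolding power_Suc fps_mult_nth smult_sum_right
    proof (intro sum.cong refl)
      fix k assume "k \<in> {0..n}"
      then have "\<rho> ^ n = \<rho> ^ k * \<rho> ^ (n - k)" by (simp flip: power_add)
      then show "refined_fps (\<lambda>n. h n * \<rho> ^ n) j $ k * (refined_fps (\<lambda>n. h n * \<rho> ^ n) j ^ i) $ (n - k) =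
        smult (\<rho> ^ n) (refined_fps h j $ k * (refined_fps h j ^ i) $ (n - k))"
        by (simp add: r Suc.IH mult_ac)
    qed
  qed
  then show ?thesis by (simp add: cycle_fps_nth smult_sum_right mult_ac)
qed

lemma component_pmf_scale:
  assumes "\<rho> > 0"
  shows "component_pmf (\<lambda>n. h n * \<rho> ^ n) j n = component_pmf h j n"
  using assms by (simp add: component_pmf_def cycle_fps_scale)

section \<open>Moments and weak convergence\<close>

text \<open>With \<open>N = Suc M\<close>, Pascal's rule makes the remainder for
  \<open>Suc k\<close> equal to \<open>1 + w\<close> times that for \<open>k\<close> plus
  \<open>(k choose M) * w ^ Suc M\<close>. As \<open>1 + w\<close> has modulus at most 1, the bounds
  add up by Pascal's rule again.\<close>

lemma norm_binomial_truncation_le: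
  fixes w :: complex
  assumes "norm (1 + w) \<le> 1"
  shows "norm ((1 + w) ^ k - (\<Sum>s<N. of_nat (k choose s) * w ^ s)) \<le> real (k choose N) * norm w ^ N"
proof (cases N)
  case 0
  then show ?thesis using assms by (simp add: norm_power power_le_one)
next
  case (Suc M)
  show ?thesis
    unfolding Suc
  proof (induction k)
    case 0
    have "(\<Sum>s<Suc M. of_nat (0 choose s) * w ^ s) = (\<Sum>s\<in>{0}. of_nat (0 choose s) * w ^ s)"
      by (intro sum.mono_neutral_right) auto
    then show ?case by simp
  next
    case (Suc k)
    define T where "T k = (\<Sum>s<Suc M. of_nat (k choose s) * w ^ s)" for k
    have "T (Suc k) = 1 + (\<Sum>s<M. of_nat (Suc k choose Suc s) * w ^ Suc s)"
      unfolding T_def by (subst sum.lessThan_Suc_shift) simp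
    also have "\<dots> = 1 + (\<Sum>s<M. of_nat (k choose Suc s) * w ^ Suc s) + w * (\<Sum>s<M. of_nat (k choose s) * w ^ s)"
      by (simp add: algebra_simps sum.distrib sum_distrib_left)
    also have "1 + (\<Sum>s<M. of_nat (k choose Suc s) * w ^ Suc s) = T k"
      unfolding T_def by (subst sum.lessThan_Suc_shift) simp
    also have "(\<Sum>s<M. of_nat (k choose s) * w ^ s) = T k - of_nat (k choose M) * w ^ M"
      by (simp add: T_def)
    finally have "(1 + w) ^ Suc k - T (Suc k) = (1 + w) * ((1 + w) ^ k - T k) + of_nat (k choose M) * w ^ Suc M"
      by (simp add: algebra_simps)
    then have "norm ((1 + w) ^ Suc k - T (Suc k)) \<le> norm (1 + w) * norm ((1 + w) ^ k - T k) + real (k choose M) * norm w ^ Suc M"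
      by (metis (no_types, lifting) norm_mult norm_of_nat norm_power norm_triangle_ineq)
    also have "\<dots> \<le> 1 * (real (k choose Suc M) * norm w ^ Suc M) + real (k choose M) * norm w ^ Suc M"
      using assms Suc.IH unfolding T_def by (intro add_right_mono mult_mono) auto
    also have "\<dots> = real (Suc k choose Suc M) * norm w ^ Suc M"
      by (simp add: algebra_simps)
    finally show ?case by (simp add: T_def)
  qed
qed

text \<open>
  The method of moments, for characteristic functions whose error after \<open>N\<close> terms is controlled by
  the \<open>N\<close>-th moment.
\<close>

lemma tendsto_of_expansion:
  fixes \<phi> :: "nat \<Rightarrow> complex" and c :: "nat \<Rightarrow> complex" and m :: "nat \<Rightarrow> nat \<Rightarrow> real"
  assumes m: "\<And>s. (\<lambda>n. m n s) \<longlonglongrightarrow> \<mu> s"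
    and \<phi>: "\<And>N. \<forall>\<^sub>F n in sequentially. norm (\<phi> n - (\<Sum>s\<le>N. c s * of_real (m n s))) \<le> 2 * norm (c N) * m n N"
    and l: "\<And>N. norm (l - (\<Sum>s\<le>N. c s * of_real (\<mu> s))) \<le> 2 * norm (c N) * \<mu> N"
    and tail: "(\<lambda>N. norm (c N) * \<mu> N) \<longlonglongrightarrow> 0"
  shows "\<phi> \<longlonglongrightarrow> l"
  unfolding tendsto_iff
proof (intro allI impI)
  fix e :: real assume e: "e > 0"
  have "\<forall>\<^sub>F N in sequentially. norm (c N) * \<mu> N < e / 4"
    using tail e by (intro order_tendstoD) auto
  then obtain N where N: "norm (c N) * \<mu> N < e / 4"
    unfolding eventually_sequentially by blast
  \<comment> \<open>Truncation error of \<open>\<phi> n\<close>, distance of the partial sums,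
    truncation error of \<open>l\<close>. In the limit the middle term vanishes and the others add
    up to \<open>4 * (norm (c N) * \<mu> N)\<close>, hence the \<open>e / 4\<close> above.\<close>
  define B where "B n = 2 * norm (c N) * m n N + norm (\<Sum>s\<le>N. c s * of_real (m n s - \<mu> s)) + 2 * norm (c N) * \<mu> N" for n
  have "B \<longlonglongrightarrow> 2 * norm (c N) * \<mu> N + norm (\<Sum>s\<le>N. c s * of_real (\<mu> s - \<mu> s)) + 2 * norm (c N) * \<mu> N"
    unfolding B_def by (intro tendsto_intros m)
  then have B_lim: "B \<longlonglongrightarrow> 4 * (norm (c N) * \<mu> N)" by (simp add: mult_ac)
  have "\<forall>\<^sub>F n in sequentially. B n < e"
    by (rule order_tendstoD(2)[OF B_lim]) (use N in simp)
  with \<phi>[of N] show "\<forall>\<^sub>F n in sequentially. dist (\<phi> n) l < e"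
  proof eventually_elim
    case (elim n)
    have "\<phi> n - l = (\<phi> n - (\<Sum>s\<le>N. c s * of_real (m n s))) + (\<Sum>s\<le>N. c s * of_real (m n s - \<mu> s))
        + - (l - (\<Sum>s\<le>N. c s * of_real (\<mu> s)))"
      by (simp add: algebra_simps sum_subtractf)
    then have "norm (\<phi> n - l) \<le> norm (\<phi> n - (\<Sum>s\<le>N. c s * of_real (m n s))) + norm (\<Sum>s\<le>N. c s * of_real (m n s - \<mu> s))
        + norm (l - (\<Sum>s\<le>N. c s * of_real (\<mu> s)))"
      by (metis (no_types, lifting) norm_triangle_mono norm_minus_cancel order_refl norm_triangle_ineq)
    also have "\<dots> \<le> B n" using elim(1) l[of N] by (simp add: B_def)
    finally show ?case using elim by (simp add: dist_norm)
  qed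
qed

text \<open>The moments of the Mittag-Leffler law divided by \<open>fact n\<close> are
  \<open>1 / Gamma (n * \<alpha> + 1)\<close>, so this is the tail condition of the moment method,
  at every argument \<open>x\<close>.\<close>

lemma power_over_Gamma_tendsto_0:
  fixes x \<alpha> :: real
  assumes x: "x \<ge> 0" and \<alpha>: "\<alpha> > 0"
  shows "(\<lambda>n. x ^ n / Gamma (real n * \<alpha> + 1)) \<longlonglongrightarrow> 0"
proof -
  \<comment> \<open>Chosen so that \<open>x ^ n \<le> B powr (\<alpha> * n)\<close>, which permits a
    comparison with \<open>B ^ m / fact m\<close> at
    \<open>m = \<lfloor>n * \<alpha>\<rfloor>\<close>.\<close>
  define B where "B = max 1 x powr (1 / \<alpha>)"
  have B: "B \<ge> 1" unfolding B_def using \<alpha> by (intro ge_one_powr_ge_zero) auto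
  define m where "m n = nat \<lfloor>real n * \<alpha>\<rfloor>" for n
  have "filterlim (\<lambda>n. real n * \<alpha>) at_top sequentially"
    using \<alpha> by (intro filterlim_at_top_mult_tendsto_pos[OF tendsto_const] filterlim_real_sequentially)
  then have m_lim: "filterlim m at_top sequentially"
    unfolding m_def by (intro filterlim_compose[OF filterlim_nat_sequentially] filterlim_compose[OF filterlim_floor_sequentially])
  have "(\<lambda>k. B ^ k / fact k) \<longlonglongrightarrow> 0"
    using summable_LIMSEQ_zero[OF summable_exp[of B]] by (simp add: field_simps)
  then have "(\<lambda>n. B * (B ^ m n / fact (m n))) \<longlonglongrightarrow> B * 0"
    by (intro tendsto_mult_left filterlim_compose[OF _ m_lim])
  then have lim: "(\<lambda>n. B * (B ^ m n / fact (m n))) \<longlonglongrightarrow> 0" by simp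
  show ?thesis
  proof (rule tendsto_sandwich[OF _ _ tendsto_const lim])
    show "\<forall>\<^sub>F n in sequentially. 0 \<le> x ^ n / Gamma (real n * \<alpha> + 1)"
      using x \<alpha> by (intro always_eventually allI divide_nonneg_nonneg zero_le_power less_imp_le[OF Gamma_real_pos] add_nonneg_pos) auto
    \<comment> \<open>\<open>Gamma\<close> increases only beyond a point between 1 and 2;
      \<open>m n \<ge> 1\<close> puts both arguments at 2 or more.\<close>
    have "\<forall>\<^sub>F n in sequentially. m n \<ge> 1" using m_lim by (simp add: filterlim_at_top)
    then show "\<forall>\<^sub>F n in sequentially. x ^ n / Gamma (real n * \<alpha> + 1) \<le> B * (B ^ m n / fact (m n))"
    proof eventually_elim
      case (elim n)
      have mn: "real (m n) \<le> real n * \<alpha>" "real n * \<alpha> \<le> real (m n) + 1"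
        using \<alpha> unfolding m_def by (auto simp: le_nat_floor)
      have "x ^ n \<le> max 1 x ^ n" using x by (intro power_mono) auto
      also have "\<dots> = B powr (\<alpha> * real n)"
        using \<alpha> by (simp add: B_def powr_powr powr_realpow)
      also have "\<dots> \<le> B powr (real (m n) + 1)"
        using B mn by (intro powr_mono) (auto simp: mult.commute)
      also have "\<dots> = B * B ^ m n" using B by (simp add: powr_add powr_realpow)
      finally have num: "x ^ n \<le> B * B ^ m n" .
      have "Gamma (real (m n) + 1) \<le> Gamma (real n * \<alpha> + 1)"
      proof (cases "real (m n) = real n * \<alpha>")
        case False
        then show ?thesis using mn elim by (intro less_imp_le Gamma_real_strict_mono) auto
      qed simp
      then have den: "fact (m n) \<le> Gamma (real n * \<alpha> + 1)"
        by (simp add: Gamma_fact add.commute)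
      have "x ^ n / Gamma (real n * \<alpha> + 1) \<le> (B * B ^ m n) / fact (m n)"
        using num den x B by (intro frac_le) auto
      then show ?case by simp
    qed
  qed
qed

section \<open>Power moments, factorial moments and the mixed Poisson law\<close>

lemma power_eq_sum_Stirling:
  "real k ^ s = (\<Sum>m\<le>s. real (Stirling s m) * (\<Prod>i<m. real k - real i))"
proof (induction s)
  case (Suc s)
  define P where "P m = (\<Prod>i<m. real k - real i)" for m
  \<comment> \<open>Writing the factor \<open>k\<close> as \<open>(k - m) + m\<close> reproduces the
    recurrence of the Stirling numbers of the second kind.\<close>
  have P: "real k * P m = P (Suc m) + real m * P m" for m
    by (simp add: P_def algebra_simps)
  have "real k ^ Suc s = (\<Sum>m\<le>s. real (Stirling s m) * (real k * P m))"
    using Suc by (simp add: P_def sum_distrib_left mult_ac)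
  also have "\<dots> = (\<Sum>m\<le>s. real (Stirling s m) * P (Suc m)) + (\<Sum>m\<le>s. real m * real (Stirling s m) * P m)"
    by (simp add: P algebra_simps sum.distrib)
  also have "(\<Sum>m\<le>s. real m * real (Stirling s m) * P m) = (\<Sum>m\<le>Suc s. real m * real (Stirling s m) * P m)"
    by simp
  also have "\<dots> = (\<Sum>m\<le>s. real (Suc m) * real (Stirling s (Suc m)) * P (Suc m))"
    by (subst sum.atMost_Suc_shift) simp
  also have "(\<Sum>m\<le>s. real (Stirling s m) * P (Suc m)) + \<dots> = (\<Sum>m\<le>s. real (Stirling (Suc s) (Suc m)) * P (Suc m))"
    by (simp add: algebra_simps sum.distrib)
  also have "\<dots> = (\<Sum>m\<le>Suc s. real (Stirling (Suc s) m) * P m)"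
    by (simp only: sum.atMost_Suc_shift) simp
  finally show ?case by (simp add: P_def)
qed simp

lemma prod_falling_eq_binomial: "(\<Prod>i<s. real k - real i) = fact s * real (k choose s)"
  using gbinomial_mult_fact[of s "real k"] by (simp add: binomial_gbinomial atLeast0LessThan)

text \<open>The factorial moment of a Poisson variable with mean \<open>y\<close>, without the
  normalising \<open>exp (- y)\<close>: the first \<open>s\<close> terms vanish and the rest is an
  exponential series.\<close>

lemma sums_falling_factorial_exp:
  fixes y :: real
  shows "(\<lambda>k. (\<Prod>i<s. real k - real i) * (y ^ k / fact k)) sums (y ^ s * exp y)"
proof -
  let ?f = "\<lambda>k. (\<Prod>i<s. real k - real i) * (y ^ k / fact k)"
  have "?f (l + s) = y ^ s * (inverse (fact l) * y ^ l)" for l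
  proof -
    have "real (l + s choose s) = fact (l + s) / (fact s * fact l)"
      by (simp add: binomial_fact)
    then show ?thesis unfolding prod_falling_eq_binomial by (simp add: power_add field_simps)
  qed
  moreover have "(\<lambda>l. y ^ s * (inverse (fact l) * y ^ l)) sums (y ^ s * exp y)"
    using exp_converges[of y] by (intro sums_mult) simp
  ultimately have "(\<lambda>l. ?f (l + s)) sums (y ^ s * exp y)" by simp
  moreover have "(\<Sum>k<s. ?f k) = 0"
    by (intro sum.neutral) (simp add: prod_falling_eq_binomial binomial_eq_0)
  ultimately show ?thesis by (subst (asm) sums_iff_shift) simp
qed

text \<open>Conditionally on \<open>X = x\<close> the variable is Poisson with mean
  \<open>\<xi> * x\<close>, whose factorial moment is \<open>(\<xi> * x) ^ s\<close>. Sum and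
  integral are exchanged for nonnegative integrals, so that integrability comes out together with
  the value.\<close>

lemma mixed_poisson_falling_factorial:
  assumes L: "real_distribution L" "AE x in L. 0 \<le> x" and \<xi>: "\<xi> \<ge> 0"
    and int: "integrable L (\<lambda>x. x ^ s)"
  shows "integrable (measure_pmf (mixed_poisson_pmf \<xi> L)) (\<lambda>k. \<Prod>i<s. real k - real i)"
    and "factorial_moment (mixed_poisson_pmf \<xi> L) s = \<xi> ^ s * (\<integral>x. x ^ s \<partial>L)"
proof -
  interpret real_distribution L by fact
  define ff where "ff k = (\<Prod>i<s. real k - real i)" for k
  have ff: "ff k \<ge> 0" for k by (simp add: ff_def prod_falling_eq_binomial)
  define f where "f l x = \<xi> ^ l / fact l * (x ^ l * exp (- \<xi> * x))" for l x
  have [measurable]: "f l \<in> borel_measurable L" for l unfolding f_def by measurable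
  have nonneg: "AE x in L. f l x \<ge> 0" for l
    using L(2) \<xi> by (auto simp: f_def)
  have pmf: "ennreal (pmf (mixed_poisson_pmf \<xi> L) l) = (\<integral>\<^sup>+x. ennreal (f l x) \<partial>L)" for l
  proof -
    have "norm (f l x) \<le> 1" if "x \<ge> 0" for x
    proof -
      have "(\<xi> * x) ^ l / fact l \<le> exp (\<xi> * x)"
      proof -
        have "(\<Sum>n\<in>{l}. inverse (fact n) * (\<xi> * x) ^ n) \<le> (\<Sum>n. inverse (fact n) * (\<xi> * x) ^ n)"
          using \<xi> that summable_exp[of "\<xi> * x"] by (intro sum_le_suminf) auto
        also have "\<dots> = exp (\<xi> * x)" by (simp add: exp_def)
        finally show ?thesis by (simp add: field_simps)
      qed
      then have "(\<xi> * x) ^ l / fact l * exp (- (\<xi> * x)) \<le> exp (\<xi> * x) * exp (- (\<xi> * x))"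
        by (intro mult_right_mono) auto
      then show ?thesis using \<xi> that by (simp add: f_def power_mult_distrib flip: exp_add)
    qed
    then have "integrable L (f l)" using L(2) by (intro integrable_const_bound[of _ 1]) auto
    then have "(\<integral>\<^sup>+x. ennreal (f l x) \<partial>L) = ennreal (\<integral>x. f l x \<partial>L)"
      using nonneg by (intro nn_integral_eq_integral)
    then show ?thesis
      using pmf_mixed_poisson_pmf[OF L \<xi>, of l] unfolding f_def by simp
  qed
  have "(\<integral>\<^sup>+k. ennreal (ff k) \<partial>measure_pmf (mixed_poisson_pmf \<xi> L)) =
      (\<Sum>l. (\<integral>\<^sup>+x. ennreal (f l x) \<partial>L) * ennreal (ff l))"
    by (simp add: nn_integral_measure_pmf nn_integral_count_space_nat pmf)
  also have "\<dots> = (\<Sum>l. \<integral>\<^sup>+x. ennreal (f l x) * ennreal (ff l) \<partial>L)"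
    by (simp add: nn_integral_multc)
  also have "\<dots> = (\<integral>\<^sup>+x. (\<Sum>l. ennreal (f l x) * ennreal (ff l)) \<partial>L)"
    by (intro nn_integral_suminf[symmetric]) measurable
  also have "\<dots> = (\<integral>\<^sup>+x. ennreal (\<xi> ^ s * x ^ s) \<partial>L)"
  proof (rule nn_integral_cong_AE)
    show "AE x in L. (\<Sum>l. ennreal (f l x) * ennreal (ff l)) = ennreal (\<xi> ^ s * x ^ s)"
      using L(2)
    proof eventually_elim
      case (elim x)
      then have f0: "f m x \<ge> 0" for m using \<xi> by (simp add: f_def)
      have "(\<lambda>l. ff l * ((\<xi> * x) ^ l / fact l) * exp (- (\<xi> * x))) sums ((\<xi> * x) ^ s * exp (\<xi> * x) * exp (- (\<xi> * x)))"
        unfolding ff_def by (intro sums_mult2 sums_falling_factorial_exp)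
      then have "(\<lambda>l. f l x * ff l) sums (\<xi> ^ s * x ^ s)"
        by (simp add: f_def power_mult_distrib mult_ac flip: exp_add)
      then have "(\<Sum>l. ennreal (f l x * ff l)) = ennreal (\<xi> ^ s * x ^ s)"
        using f0 ff by (intro suminf_ennreal_eq) auto
      then show ?case using f0 ff by (simp add: ennreal_mult)
    qed
  qed
  also have "\<dots> = ennreal (\<integral>x. \<xi> ^ s * x ^ s \<partial>L)"
    using L(2) \<xi> by (intro nn_integral_eq_integral integrable_mult_right int) auto
  also have "(\<integral>x. \<xi> ^ s * x ^ s \<partial>L) = \<xi> ^ s * (\<integral>x. x ^ s \<partial>L)" by simp
  finally have nn: "(\<integral>\<^sup>+k. ennreal (ff k) \<partial>measure_pmf (mixed_poisson_pmf \<xi> L)) = ennreal (\<xi> ^ s * (\<integral>x. x ^ s \<partial>L))" .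
  have pos: "\<xi> ^ s * (\<integral>x. x ^ s \<partial>L) \<ge> 0"
    using L(2) \<xi> by (intro mult_nonneg_nonneg integral_nonneg_AE) auto
  show "integrable (measure_pmf (mixed_poisson_pmf \<xi> L)) (\<lambda>k. \<Prod>i<s. real k - real i)"
    using nn ff unfolding ff_def by (intro integrableI_nonneg) auto
  show "factorial_moment (mixed_poisson_pmf \<xi> L) s = \<xi> ^ s * (\<integral>x. x ^ s \<partial>L)"
    using nn ff pos unfolding factorial_moment_def ff_def
    by (subst integral_eq_nn_integral) auto
qed

section \<open>Moments of the Mittag-Leffler law\<close>

lemma Laplace_power_nn_integral:
  fixes x q :: real
  assumes x: "x > 0" and q: "q > 0"
  shows "(\<integral>\<^sup>+t. ennreal (indicator {0..} t * t powr (q - 1) * exp (- t * x)) \<partial>lborel) = ennreal (x powr (- q) * Gamma q)"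
proof -
  let ?f = "\<lambda>t. ennreal (indicator {0..} t * t powr (q - 1) * exp (- t * x))"
  have "ennreal (Gamma q) = (\<integral>\<^sup>+u. ennreal (indicator {0..} u * u powr (q - 1) / exp u) \<partial>lborel)"
    using q by (simp add: Gamma_conv_nn_integral_real)
  also have "\<dots> = \<bar>x\<bar> * (\<integral>\<^sup>+t. ennreal (indicator {0..} (0 + x * t) * (0 + x * t) powr (q - 1) / exp (0 + x * t)) \<partial>lborel)"
    using x by (intro nn_integral_real_affine) auto
  also have "(\<lambda>t. ennreal (indicator {0..} (0 + x * t) * (0 + x * t) powr (q - 1) / exp (0 + x * t))) =
       (\<lambda>t. ennreal (x powr (q - 1)) * ?f t)"
    using x by (auto simp: fun_eq_iff powr_mult exp_minus field_simps zero_le_mult_iff indicator_def simp flip: ennreal_mult)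
  also have "ennreal \<bar>x\<bar> * (\<integral>\<^sup>+t. ennreal (x powr (q - 1)) * ?f t \<partial>lborel) = ennreal (x powr q) * (\<integral>\<^sup>+t. ?f t \<partial>lborel)"
    using x by (subst nn_integral_cmult) (auto simp: mult.assoc[symmetric] powr_mult_base simp flip: ennreal_mult)
  finally have *: "ennreal (Gamma q) = ennreal (x powr q) * (\<integral>\<^sup>+t. ?f t \<partial>lborel)" .
  have "ennreal (x powr (- q) * Gamma q) = ennreal (x powr (- q)) * ennreal (Gamma q)"
    using q by (simp add: ennreal_mult)
  also have "\<dots> = ennreal (x powr (- q) * x powr q) * (\<integral>\<^sup>+t. ?f t \<partial>lborel)"
    unfolding * by (simp add: ennreal_mult mult.assoc)
  also have "x powr (- q) * x powr q = 1" using x by (simp flip: powr_add)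
  finally show ?thesis by simp
qed

text \<open>
  Writing \<open>exp (- t\<^sup>\<alpha>)\<close> as the integral of \<open>exp (- y)\<close> over \<open>y \<ge> t\<^sup>\<alpha>\<close> and exchanging the
  integrals replaces a change of variables on an unbounded interval.
\<close>

lemma stretched_exp_nn_integral:
  fixes \<alpha> q :: real
  assumes \<alpha>: "\<alpha> > 0" and q: "q > 0"
  shows "(\<integral>\<^sup>+t. ennreal (indicator {0..} t * t powr (q - 1) * exp (- (t powr \<alpha>))) \<partial>lborel) =
    ennreal (Gamma (q / \<alpha> + 1) / q)"
proof -
  let ?g = "\<lambda>t y. ennreal (indicator {0..} t * t powr (q - 1)) * (ennreal (exp (- y)) * indicator {t powr \<alpha>..} y)"
  have "(\<integral>\<^sup>+t. ennreal (indicator {0..} t * t powr (q - 1) * exp (- (t powr \<alpha>))) \<partial>lborel) =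
     (\<integral>\<^sup>+t. (\<integral>\<^sup>+y. ?g t y \<partial>lborel) \<partial>lborel)"
  proof (rule nn_integral_cong)
    fix t :: real
    have "(\<integral>\<^sup>+y. ennreal (exp (- y)) * indicator {t powr \<alpha>..} y \<partial>lborel) = ennreal (0 - (- exp (- (t powr \<alpha>))))"
    proof (rule nn_integral_FTC_atLeast)
      have "((\<lambda>y::real. - exp (- y)) \<longlongrightarrow> - 0) at_top"
        by (intro tendsto_minus filterlim_compose[OF exp_at_bot] filterlim_uminus_at_bot_at_top)
      then show "((\<lambda>y::real. - exp (- y)) \<longlongrightarrow> 0) at_top" by simp
    qed (auto intro!: derivative_eq_intros)
    then show "ennreal (indicator {0..} t * t powr (q - 1) * exp (- (t powr \<alpha>))) = (\<integral>\<^sup>+y. ?g t y \<partial>lborel)"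
      by (subst nn_integral_cmult) (auto simp: ennreal_mult)
  qed
  also have "\<dots> = (\<integral>\<^sup>+y. (\<integral>\<^sup>+t. ?g t y \<partial>lborel) \<partial>lborel)"
  proof (rule lborel_pair.Fubini')
    have "(\<lambda>(y, t). ?g t y) = (\<lambda>(y, t). ennreal (indicator {0..} t * t powr (q - 1)) * (ennreal (exp (- y)) * (if t powr \<alpha> \<le> y then 1 else 0)))"
      by (auto simp: fun_eq_iff)
    also have "\<dots> \<in> borel_measurable (lborel \<Otimes>\<^sub>M lborel)" by measurable
    finally show "(\<lambda>(y, t). ?g t y) \<in> borel_measurable (lborel \<Otimes>\<^sub>M lborel)" .
  qed
  \<comment> \<open>The range of \<open>t\<close> is now
    \<open>0 \<le> t \<le> y powr (1 / \<alpha>)\<close>, so its integral is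
    \<open>y powr (q / \<alpha>) / q\<close>. The exponent stays \<open>q / \<alpha> + 1 - 1\<close>
    to match Euler's integral for \<open>Gamma (q / \<alpha> + 1)\<close>.\<close>
  also have "\<dots> = (\<integral>\<^sup>+y. ennreal (1 / q) * ennreal (indicator {0..} y * y powr (q / \<alpha> + 1 - 1) / exp y) \<partial>lborel)"
  proof (rule nn_integral_cong)
    fix y :: real
    show "(\<integral>\<^sup>+t. ?g t y \<partial>lborel) = ennreal (1 / q) * ennreal (indicator {0..} y * y powr (q / \<alpha> + 1 - 1) / exp y)"
    proof (cases "y \<ge> 0")
      case True
      have iff: "t powr \<alpha> \<le> y \<longleftrightarrow> t \<le> y powr (1 / \<alpha>)" if "t \<ge> 0" for t
      proof
        assume "t powr \<alpha> \<le> y"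
        then have "(t powr \<alpha>) powr (1 / \<alpha>) \<le> y powr (1 / \<alpha>)" using \<alpha> by (intro powr_mono2) auto
        then show "t \<le> y powr (1 / \<alpha>)" using that \<alpha> by (simp add: powr_powr)
      next
        assume "t \<le> y powr (1 / \<alpha>)"
        then have "t powr \<alpha> \<le> (y powr (1 / \<alpha>)) powr \<alpha>" using \<alpha> that by (intro powr_mono2) auto
        then show "t powr \<alpha> \<le> y" using True \<alpha> by (simp add: powr_powr)
      qed
      have "(\<integral>\<^sup>+t. ?g t y \<partial>lborel) = (\<integral>\<^sup>+t. ennreal (exp (- y)) * ennreal (indicator {0..y powr (1 / \<alpha>)} t * t powr (q - 1)) \<partial>lborel)"
        by (intro nn_integral_cong) (auto simp: indicator_def iff mult.commute)
      also have "\<dots> = ennreal (exp (- y)) * (\<integral>\<^sup>+t. ennreal (indicator {0..y powr (1 / \<alpha>)} t * t powr (q - 1)) \<partial>lborel)"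
        by (intro nn_integral_cmult) auto
      also have "(\<integral>\<^sup>+t. ennreal (indicator {0..y powr (1 / \<alpha>)} t * t powr (q - 1)) \<partial>lborel) =
          ennreal ((y powr (1 / \<alpha>)) powr (q - 1 + 1) / (q - 1 + 1))"
        using q by (intro nn_integral_has_integral_lebesgue[OF _ has_integral_powr_from_0]) auto
      also have "ennreal (exp (- y)) * \<dots> = ennreal (1 / q) * ennreal (indicator {0..} y * y powr (q / \<alpha> + 1 - 1) / exp y)"
        using True q by (auto simp: powr_powr exp_minus field_simps simp flip: ennreal_mult)
      finally show ?thesis .
    next
      case False
      have z: "?g t y = 0" for t :: real
      proof -
        have "\<not> t powr \<alpha> \<le> y" using False powr_ge_zero[of t \<alpha>] by linarith
        then show ?thesis by simp
      qed
      show ?thesis unfolding z using False by simp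
    qed
  qed
  also have "\<dots> = ennreal (1 / q) * ennreal (Gamma (q / \<alpha> + 1))"
    using \<alpha> q by (subst nn_integral_cmult) (auto simp: Gamma_conv_nn_integral_real add_pos_pos)
  also have "\<dots> = ennreal (Gamma (q / \<alpha> + 1) / q)"
    using \<alpha> q by (simp flip: ennreal_mult')
  finally show ?thesis .
qed

text \<open>Euler's integral writes \<open>Gamma q * x powr (- q)\<close> as the integral of
  \<open>t powr (q - 1) * exp (- t * x)\<close>. Averaging over \<open>S\<close> replaces the
  exponential by \<open>exp (- (t powr \<alpha>))\<close>, so the Laplace transform alone gives the
  moment.\<close>

lemma positive_stable_negative_moment:
  assumes S: "positive_stable \<alpha> S" and \<alpha>: "\<alpha> > 0" and q: "q > 0"
  shows "(\<integral>\<^sup>+x. ennreal (x powr (- q)) \<partial>S) = ennreal (Gamma (q / \<alpha> + 1) / Gamma (q + 1))"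
proof -
  interpret real_distribution S using S by (simp add: positive_stable_def)
  have pos: "AE x in S. 0 < x" using S by (simp add: positive_stable_def)
  let ?g = "\<lambda>t x. ennreal (indicator {0..} t * t powr (q - 1) * exp (- t * x))"
  interpret P: pair_sigma_finite S lborel ..
  have "ennreal (Gamma q) * (\<integral>\<^sup>+x. ennreal (x powr (- q)) \<partial>S) = (\<integral>\<^sup>+x. ennreal (x powr (- q) * Gamma q) \<partial>S)"
    using q by (subst nn_integral_cmult[symmetric]) (auto simp: ennreal_mult mult.commute)
  also have "\<dots> = (\<integral>\<^sup>+x. (\<integral>\<^sup>+t. ?g t x \<partial>lborel) \<partial>S)"
  proof (rule nn_integral_cong_AE)
    show "AE x in S. ennreal (x powr (- q) * Gamma q) = (\<integral>\<^sup>+t. ?g t x \<partial>lborel)"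
      using pos by eventually_elim (simp only: Laplace_power_nn_integral[OF _ q])
  qed
  also have "\<dots> = (\<integral>\<^sup>+t. (\<integral>\<^sup>+x. ?g t x \<partial>S) \<partial>lborel)"
    by (rule P.Fubini'[symmetric]) measurable
  also have "\<dots> = (\<integral>\<^sup>+t. ennreal (indicator {0..} t * t powr (q - 1) * exp (- (t powr \<alpha>))) \<partial>lborel)"
  proof (rule nn_integral_cong)
    fix t :: real
    show "(\<integral>\<^sup>+x. ?g t x \<partial>S) = ennreal (indicator {0..} t * t powr (q - 1) * exp (- (t powr \<alpha>)))"
    proof (cases "t \<ge> 0")
      case True
      have "integrable S (\<lambda>x. exp (- t * x))"
        using pos True by (intro integrable_const_bound[of _ 1]) (auto simp: mult_nonneg_nonneg elim!: eventually_mono)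
      then have "(\<integral>\<^sup>+x. ennreal (exp (- t * x)) \<partial>S) = ennreal (exp (- (t powr \<alpha>)))"
        using S True by (subst nn_integral_eq_integral) (auto simp: positive_stable_def)
      then show ?thesis
        by (simp add: ennreal_mult nn_integral_cmult)
    qed simp
  qed
  also have "\<dots> = ennreal (Gamma (q / \<alpha> + 1) / q)" by (rule stretched_exp_nn_integral[OF \<alpha> q])
  finally have *: "ennreal (Gamma q) * (\<integral>\<^sup>+x. ennreal (x powr (- q)) \<partial>S) = ennreal (Gamma (q / \<alpha> + 1) / q)" .
  have "(\<integral>\<^sup>+x. ennreal (x powr (- q)) \<partial>S) = ennreal (1 / Gamma q) * (ennreal (Gamma q) * (\<integral>\<^sup>+x. ennreal (x powr (- q)) \<partial>S))"
  proof -
    have "Gamma q \<noteq> 0" using Gamma_real_pos[OF q] by linarith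
    then have "ennreal (1 / Gamma q) * ennreal (Gamma q) = 1"
      using q by (subst ennreal_mult'[symmetric]) auto
    then show ?thesis by (simp only: mult.assoc[symmetric] mult_1_left)
  qed
  also have "\<dots> = ennreal (1 / Gamma q * (Gamma (q / \<alpha> + 1) / q))"
    unfolding * using q by (subst ennreal_mult') auto
  also have "1 / Gamma q * (Gamma (q / \<alpha> + 1) / q) = Gamma (q / \<alpha> + 1) / Gamma (q + 1)"
    using q Gamma_plus1[of q] by (auto simp: nonpos_Ints_def)
  finally show ?thesis .
qed

lemma mittag_leffler_props:
  assumes L: "mittag_leffler \<alpha> L" and \<alpha>: "\<alpha> > 0"
  shows "real_distribution L" and "AE x in L. 0 \<le> x" and "integrable L (\<lambda>x. x ^ s)"
    and "(\<integral>x. x ^ s \<partial>L) = Gamma (real s + 1) / Gamma (real s * \<alpha> + 1)"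
proof -
  from L obtain S where S: "positive_stable \<alpha> S" and LS: "L = distr S borel (\<lambda>x. x powr (- \<alpha>))"
    by (auto simp: mittag_leffler_def)
  interpret S: real_distribution S using S by (simp add: positive_stable_def)
  show rd: "real_distribution L"
    unfolding LS by (intro S.real_distribution_distr) measurable
  then interpret real_distribution L .
  show nn: "AE x in L. 0 \<le> x" unfolding LS by (subst AE_distr_iff) auto
  have "integrable L (\<lambda>x. x ^ s) \<and> (\<integral>x. x ^ s \<partial>L) = Gamma (real s + 1) / Gamma (real s * \<alpha> + 1)"
  \<comment> \<open>\<open>s = 0\<close> is set apart because the negative moment formula requires
    \<open>q = \<alpha> * s > 0\<close>.\<close>
  proof (cases "s = 0")
    case False
    have "(\<integral>\<^sup>+x. ennreal (x ^ s) \<partial>L) = (\<integral>\<^sup>+x. ennreal ((x powr (- \<alpha>)) ^ s) \<partial>S)"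
      unfolding LS by (subst nn_integral_distr) auto
    also have "\<dots> = (\<integral>\<^sup>+x. ennreal (x powr (- (\<alpha> * real s))) \<partial>S)"
      using S by (intro nn_integral_cong_AE) (auto simp: positive_stable_def powr_power mult.commute elim!: eventually_mono)
    also have "\<dots> = ennreal (Gamma (real s + 1) / Gamma (real s * \<alpha> + 1))"
      using positive_stable_negative_moment[OF S \<alpha>, of "\<alpha> * real s"] \<alpha> False by (simp add: mult.commute)
    finally have *: "(\<integral>\<^sup>+x. ennreal (x ^ s) \<partial>L) = ennreal (Gamma (real s + 1) / Gamma (real s * \<alpha> + 1))" .
    have "integrable L (\<lambda>x. x ^ s)"
      using * nn by (intro integrableI_nonneg) auto
    moreover have "Gamma (real s + 1) / Gamma (real s * \<alpha> + 1) \<ge> 0"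
      using \<alpha> by (intro divide_nonneg_nonneg less_imp_le[OF Gamma_real_pos] add_nonneg_pos) auto
    ultimately show ?thesis
      using * nn by (subst integral_eq_nn_integral) (auto elim!: eventually_mono)
  qed (use prob_space in simp)
  then show "integrable L (\<lambda>x. x ^ s)" "(\<integral>x. x ^ s \<partial>L) = Gamma (real s + 1) / Gamma (real s * \<alpha> + 1)" by auto
qed


section \<open>Characteristic functions and Levy continuity\<close>

lemma char_distr_nat_pmf: "char (distr (measure_pmf p) borel real) t = measure_pmf.expectation p (\<lambda>k. iexp t ^ k)"
  by (simp add: char_def integral_distr mult_ac flip: exp_of_nat_mult)

text \<open>With \<open>w = iexp t - 1\<close> the characteristic function is the mean of
  \<open>(1 + w) ^ k\<close>, where \<open>1 + w\<close> has modulus 1; the pointwise bound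
  \<open>norm_binomial_truncation_le\<close> is integrated.\<close>

lemma char_factorial_moments:
  fixes t :: real
  assumes int: "\<And>s. integrable (measure_pmf p) (\<lambda>k. \<Prod>i<s. real k - real i)"
  shows "norm (char (distr (measure_pmf p) borel real) t -
      (\<Sum>s<N. (iexp t - 1) ^ s / fact s * of_real (factorial_moment p s)))
    \<le> norm ((iexp t - 1) ^ N / fact N) * factorial_moment p N"
proof -
  define w where "w = iexp t - 1"
  have w: "norm (1 + w) \<le> 1" by (simp add: w_def)
  have intb: "integrable (measure_pmf p) (\<lambda>k. real (k choose s))" for s
  proof -
    have "integrable (measure_pmf p) (\<lambda>k. (\<Prod>i<s. real k - real i) / fact s)"
      by (intro integrable_divide int)
    then show ?thesis by (simp add: prod_falling_eq_binomial)
  qed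
  have Eb: "measure_pmf.expectation p (\<lambda>k. real (k choose s)) = factorial_moment p s / fact s" for s
    by (simp add: factorial_moment_def prod_falling_eq_binomial)
  have intc: "integrable (measure_pmf p) (\<lambda>k. of_nat (k choose s) * w ^ s)" for s
  proof -
    have "integrable (measure_pmf p) (\<lambda>k. complex_of_real (real (k choose s)) * w ^ s)"
      by (intro integrable_mult_left integrable_of_real intb)
    then show ?thesis by simp
  qed
  have Ec: "measure_pmf.expectation p (\<lambda>k. of_nat (k choose s) * w ^ s) = w ^ s / fact s * of_real (factorial_moment p s)" for s
  proof -
    have "measure_pmf.expectation p (\<lambda>k. complex_of_real (real (k choose s)) * w ^ s) =
        of_real (factorial_moment p s / fact s) * w ^ s"
      by (simp only: integral_mult_left_zero integral_complex_of_real Eb)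
    then show ?thesis by simp
  qed
  have intp: "integrable (measure_pmf p) (\<lambda>k. (1 + w) ^ k)"
    using w by (intro measure_pmf.integrable_const_bound[of _ 1]) (auto simp: norm_power power_le_one)
  have "(\<Sum>s<N. w ^ s / fact s * of_real (factorial_moment p s)) = measure_pmf.expectation p (\<lambda>k. \<Sum>s<N. of_nat (k choose s) * w ^ s)"
    unfolding Ec[symmetric] by (intro Bochner_Integration.integral_sum[symmetric] intc)
  then have "char (distr (measure_pmf p) borel real) t - (\<Sum>s<N. w ^ s / fact s * of_real (factorial_moment p s)) =
      measure_pmf.expectation p (\<lambda>k. (1 + w) ^ k) - measure_pmf.expectation p (\<lambda>k. \<Sum>s<N. of_nat (k choose s) * w ^ s)"
    by (simp add: char_distr_nat_pmf w_def)
  also have "\<dots> = measure_pmf.expectation p (\<lambda>k. (1 + w) ^ k - (\<Sum>s<N. of_nat (k choose s) * w ^ s))"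
    by (intro Bochner_Integration.integral_diff[symmetric] intp Bochner_Integration.integrable_sum intc)
  also have "norm \<dots> \<le> measure_pmf.expectation p (\<lambda>k. real (k choose N) * norm w ^ N)"
  proof (rule order_trans[OF integral_norm_bound integral_mono])
    show "integrable (measure_pmf p) (\<lambda>k. norm ((1 + w) ^ k - (\<Sum>s<N. of_nat (k choose s) * w ^ s)))"
      by (intro integrable_norm Bochner_Integration.integrable_diff intp Bochner_Integration.integrable_sum intc)
    show "integrable (measure_pmf p) (\<lambda>k. real (k choose N) * norm w ^ N)"
      by (intro integrable_mult_left intb)
  qed (rule norm_binomial_truncation_le[OF w])
  also have "\<dots> = norm (w ^ N / fact N) * factorial_moment p N"
    by (simp add: Eb norm_divide norm_power)
  finally show ?thesis by (simp add: w_def)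
qed

lemma factorial_moment_nonneg: "factorial_moment p s \<ge> 0"
  unfolding factorial_moment_def by (intro integral_nonneg_AE) (simp add: prod_falling_eq_binomial)

text \<open>Including the term \<open>N\<close> costs its own size once more. The form with the
  factor 2 is shared with the expansion in ordinary moments, so both feed
  \<open>tendsto_of_expansion\<close>.\<close>

lemma char_factorial_moments':
  fixes t :: real
  assumes int: "\<And>s. integrable (measure_pmf p) (\<lambda>k. \<Prod>i<s. real k - real i)"
  shows "norm (char (distr (measure_pmf p) borel real) t -
      (\<Sum>s\<le>N. (iexp t - 1) ^ s / fact s * of_real (factorial_moment p s)))
    \<le> 2 * norm ((iexp t - 1) ^ N / fact N) * factorial_moment p N"
proof -
  let ?c = "\<lambda>s. (iexp t - 1) ^ s / fact s :: complex"
  let ?m = "\<lambda>s. of_real (factorial_moment p s) :: complex"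
  have "char (distr (measure_pmf p) borel real) t - (\<Sum>s\<le>N. ?c s * ?m s) =
     (char (distr (measure_pmf p) borel real) t - (\<Sum>s<N. ?c s * ?m s)) - ?c N * ?m N"
    unfolding lessThan_Suc_atMost[symmetric] by simp
  also have "norm \<dots> \<le> norm (?c N) * factorial_moment p N + norm (?c N * ?m N)"
    by (intro order_trans[OF norm_triangle_ineq4] add_right_mono char_factorial_moments int)
  also have "norm (?c N * ?m N) = norm (?c N) * factorial_moment p N"
    by (simp only: norm_mult norm_of_real abs_of_nonneg[OF factorial_moment_nonneg])
  finally show ?thesis by (simp only: mult.assoc mult_2 distrib_right)
qed

lemma real_distribution_distr_pmf: "real_distribution (distr (measure_pmf p) borel (f :: nat \<Rightarrow> real))"
  by (intro prob_space.real_distribution_distr prob_space_measure_pmf) simp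

text \<open>The expansion is in powers of \<open>iexp t - 1\<close>, of modulus at most 2 for every
  \<open>t\<close>, hence the \<open>2 ^ N\<close>. Integrability is asked only eventually because
  \<open>component_pmf\<close> is unspecified where no structure of size \<open>n\<close>
  exists.\<close>

theorem weak_conv_factorial_moments:
  assumes int: "\<forall>\<^sub>F n in sequentially. \<forall>s. integrable (measure_pmf (p n)) (\<lambda>k. \<Prod>i<s. real k - real i)"
    and int': "\<And>s. integrable (measure_pmf q) (\<lambda>k. \<Prod>i<s. real k - real i)"
    and lim: "\<And>s. (\<lambda>n. factorial_moment (p n) s) \<longlonglongrightarrow> factorial_moment q s"
    and tail: "(\<lambda>N. 2 ^ N / fact N * factorial_moment q N) \<longlonglongrightarrow> 0"
  shows "weak_conv_m (\<lambda>n. distr (measure_pmf (p n)) borel real) (distr (measure_pmf q) borel real)"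
proof (rule levy_continuity)
  fix t :: real
  define c where "c s = (iexp t - 1) ^ s / fact s" for s
  show "(\<lambda>n. char (distr (measure_pmf (p n)) borel real) t) \<longlonglongrightarrow> char (distr (measure_pmf q) borel real) t"
  proof (rule tendsto_of_expansion[where c = c and m = "\<lambda>n. factorial_moment (p n)" and \<mu> = "factorial_moment q"])
    fix N
    show "\<forall>\<^sub>F n in sequentially. norm (char (distr (measure_pmf (p n)) borel real) t -
        (\<Sum>s\<le>N. c s * of_real (factorial_moment (p n) s))) \<le> 2 * norm (c N) * factorial_moment (p n) N"
      using int by eventually_elim (unfold c_def, rule char_factorial_moments', blast)
    show "norm (char (distr (measure_pmf q) borel real) t -
        (\<Sum>s\<le>N. c s * of_real (factorial_moment q s))) \<le> 2 * norm (c N) * factorial_moment q N"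
      unfolding c_def by (intro char_factorial_moments' int')
    have "norm (iexp t - 1) \<le> 2" using norm_triangle_ineq4[of "iexp t" 1] by simp
    then have "norm (c N) \<le> 2 ^ N / fact N" for N
      unfolding c_def norm_divide norm_power norm_fact by (intro divide_right_mono power_mono) auto
    then have "norm (c N) * factorial_moment q N \<le> 2 ^ N / fact N * factorial_moment q N" for N
      by (intro mult_right_mono factorial_moment_nonneg)
    then show "(\<lambda>N. norm (c N) * factorial_moment q N) \<longlonglongrightarrow> 0"
      by (intro tendsto_sandwich[OF _ _ tendsto_const tail] always_eventually allI
          mult_nonneg_nonneg factorial_moment_nonneg norm_ge_zero)
  qed (rule lim)
qed (rule real_distribution_distr_pmf)+

text \<open>First order of the same expansion: the distance of \<open>char\<close> from 1 is at most
  \<open>norm (iexp t - 1)\<close> times the mean. The mean is all that can be controlled for large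
  \<open>j\<close>.\<close>

theorem weak_conv_return_0:
  assumes int: "\<forall>\<^sub>F n in sequentially. \<forall>s. integrable (measure_pmf (p n)) (\<lambda>k. \<Prod>i<s. real k - real i)"
    and lim: "(\<lambda>n. factorial_moment (p n) 1) \<longlonglongrightarrow> 0"
  shows "weak_conv_m (\<lambda>n. distr (measure_pmf (p n)) borel real) (return borel 0)"
proof (rule levy_continuity)
  have "prob_space (return borel (0::real))" by (intro prob_space_return) simp
  then show "real_distribution (return borel 0)"
    by (simp add: real_distribution_def real_distribution_axioms_def)
  fix t :: real
  have c0: "char (return borel 0) t = 1"
    unfolding char_def by (subst integral_return) auto
  have "(\<lambda>n. char (distr (measure_pmf (p n)) borel real) t - 1) \<longlonglongrightarrow> 0"
  proof (rule Lim_null_comparison)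
    show "\<forall>\<^sub>F n in sequentially. norm (char (distr (measure_pmf (p n)) borel real) t - 1)
        \<le> norm (iexp t - 1) * factorial_moment (p n) 1"
      using int
    proof eventually_elim
      case (elim n)
      then show ?case
        using char_factorial_moments[of "p n" t 1] by (simp add: factorial_moment_def[of _ 0])
    qed
    show "(\<lambda>n. norm (iexp t - 1) * factorial_moment (p n) 1) \<longlonglongrightarrow> 0"
      using tendsto_mult_left[OF lim] by simp
  qed
  then show "(\<lambda>n. char (distr (measure_pmf (p n)) borel real) t) \<longlonglongrightarrow> char (return borel 0) t"
    unfolding c0 by (simp add: LIM_zero_iff)
qed (rule real_distribution_distr_pmf)

text \<open>Nonnegativity turns the absolute moments in the Taylor bound for \<open>char\<close>
  into ordinary ones, so \<open>tendsto_of_expansion\<close> applies with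
  \<open>c s = (\<i> * t) ^ s / fact s\<close>.\<close>

theorem weak_conv_moments:
  fixes M :: "nat \<Rightarrow> real measure"
  assumes M: "\<And>n. real_distribution (M n)" and M': "real_distribution M'"
    and int: "\<forall>\<^sub>F n in sequentially. (AE x in M n. 0 \<le> x) \<and> (\<forall>s. integrable (M n) (\<lambda>x. x ^ s))"
    and nn': "AE x in M'. 0 \<le> x" and int': "\<And>s. integrable M' (\<lambda>x. x ^ s)"
    and lim: "\<And>s. (\<lambda>n. \<integral>x. x ^ s \<partial>M n) \<longlonglongrightarrow> (\<integral>x. x ^ s \<partial>M')"
    and tail: "\<And>t. t \<ge> 0 \<Longrightarrow> (\<lambda>N. t ^ N / fact N * (\<integral>x. x ^ N \<partial>M')) \<longlonglongrightarrow> 0"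
  shows "weak_conv_m M M'"
proof (rule levy_continuity[OF M M'])
  fix t :: real
  define c where "c s = (\<i> * t) ^ s / fact s" for s
  have nc: "norm (c N) = \<bar>t\<bar> ^ N / fact N" for N
    by (simp add: c_def norm_divide norm_power norm_mult)
  have bd: "norm (char D t - (\<Sum>s\<le>N. c s * of_real (\<integral>x. x ^ s \<partial>D))) \<le> 2 * norm (c N) * (\<integral>x. x ^ N \<partial>D)"
    if D: "real_distribution D" "AE x in D. 0 \<le> x" "\<And>s. integrable D (\<lambda>x. x ^ s)" for D N
  proof -
    interpret D: real_distribution D by fact
    have "(\<integral>x. \<bar>x\<bar> ^ N \<partial>D) = (\<integral>x. x ^ N \<partial>D)"
      using D(2) by (intro integral_cong_AE) auto
    moreover have "norm (char D t - (\<Sum>s\<le>N. c s * of_real (\<integral>x. x ^ s \<partial>D))) \<le> 2 * \<bar>t\<bar> ^ N / fact N * (\<integral>x. \<bar>x\<bar> ^ N \<partial>D)"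
      unfolding c_def by (rule D.char_approx1) (rule D(3))
    ultimately show ?thesis by (simp add: nc)
  qed
  show "(\<lambda>n. char (M n) t) \<longlonglongrightarrow> char M' t"
  proof (rule tendsto_of_expansion[where c = c and m = "\<lambda>n s. \<integral>x. x ^ s \<partial>M n" and \<mu> = "\<lambda>s. \<integral>x. x ^ s \<partial>M'"])
    fix N
    show "\<forall>\<^sub>F n in sequentially. norm (char (M n) t - (\<Sum>s\<le>N. c s * of_real (\<integral>x. x ^ s \<partial>M n)))
        \<le> 2 * norm (c N) * (\<integral>x. x ^ N \<partial>M n)"
      using int by eventually_elim (auto intro!: bd M)
    show "norm (char M' t - (\<Sum>s\<le>N. c s * of_real (\<integral>x. x ^ s \<partial>M'))) \<le> 2 * norm (c N) * (\<integral>x. x ^ N \<partial>M')"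
      by (intro bd M' nn' int')
    show "(\<lambda>N. norm (c N) * (\<integral>x. x ^ N \<partial>M')) \<longlonglongrightarrow> 0"
      unfolding nc by (rule tail) simp
  qed (rule lim)
qed

lemma expectation_power_eq_sum_Stirling:
  assumes int: "\<And>s. integrable (measure_pmf p) (\<lambda>k. \<Prod>i<s. real k - real i)"
  shows "integrable (measure_pmf p) (\<lambda>k. real k ^ s)"
    and "measure_pmf.expectation p (\<lambda>k. real k ^ s) = (\<Sum>m\<le>s. real (Stirling s m) * factorial_moment p m)"
proof -
  have eq: "(\<lambda>k. real k ^ s) = (\<lambda>k. \<Sum>m\<le>s. real (Stirling s m) * (\<Prod>i<m. real k - real i))"
    by (intro ext power_eq_sum_Stirling)
  show "integrable (measure_pmf p) (\<lambda>k. real k ^ s)"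
    unfolding eq by (intro Bochner_Integration.integrable_sum integrable_mult_right int)
  have "measure_pmf.expectation p (\<lambda>k. real k ^ s) =
      (\<Sum>m\<le>s. measure_pmf.expectation p (\<lambda>k. real (Stirling s m) * (\<Prod>i<m. real k - real i)))"
    unfolding eq by (intro Bochner_Integration.integral_sum integrable_mult_right int)
  then show "measure_pmf.expectation p (\<lambda>k. real k ^ s) = (\<Sum>m\<le>s. real (Stirling s m) * factorial_moment p m)"
    by (simp only: integral_mult_right_zero factorial_moment_def)
qed

section \<open>Limit laws\<close>

context unit_delta_series
begin

text \<open>\<open>F(z, 1)\<close> does not involve \<open>j\<close>, so one threshold serves every
  choice of \<open>j n\<close>. Positivity of this coefficient makes \<open>component_pmf\<close>
  the intended law.\<close>

lemma eventually_cycle_fps: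
  "\<forall>\<^sub>F n in sequentially. \<forall>j. real n * poly (cycle_fps h j $ n) 1 > \<alpha> / 2"
proof -
  have "\<forall>\<^sub>F n in sequentially. (fps_X * fps_deriv (Abs_fps h) * inverse (1 - Abs_fps h)) $ n > \<alpha> / 2"
    using \<alpha> by (intro order_tendstoD(1)[OF log_deriv_asymp]) auto
  then show ?thesis by eventually_elim (simp add: poly_cycle_fps_1[of h, OF h_0])
qed

lemma integrable_component_pmf:
  fixes f :: "nat \<Rightarrow> real"
  assumes "poly (cycle_fps h j $ n) 1 \<noteq> 0"
  shows "integrable (measure_pmf (component_pmf h j n)) f"
proof (rule integrable_measure_pmf_finite)
  have "set_pmf (component_pmf h j n) \<subseteq> {..degree (cycle_fps h j $ n)}"
    using assms h_nonneg by (auto simp: set_pmf_iff pmf_component_pmf le_degree)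
  then show "finite (set_pmf (component_pmf h j n))" by (rule finite_subset) simp
qed

lemma eventually_integrable_component_pmf:
  "\<forall>\<^sub>F n in sequentially. \<forall>j. \<forall>f :: nat \<Rightarrow> real. integrable (measure_pmf (component_pmf h j n)) f"
  using eventually_cycle_fps
proof eventually_elim
  case (elim n)
  show ?case
  proof (intro allI integrable_component_pmf)
    fix j
    have "real n * poly (cycle_fps h j $ n) 1 > \<alpha> / 2" using elim by blast
    then show "poly (cycle_fps h j $ n) 1 \<noteq> 0" using \<alpha> by auto
  qed
qed

lemma h_upper: obtains B where "B > 0" "\<And>n. real n powr (1 + \<alpha>) * h n \<le> B"
proof -
  have "Bseq (\<lambda>n. real n powr (1 + \<alpha>) * h n)" using h_asymp by (intro convergent_imp_Bseq convergentI)
  then obtain B where "B > 0" "\<And>n. norm (real n powr (1 + \<alpha>) * h n) \<le> B" by (auto elim: BseqE)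
  then have "real n powr (1 + \<alpha>) * h n \<le> B" for n
    by (metis abs_ge_self order_trans real_norm_def)
  with \<open>B > 0\<close> show ?thesis by (rule that)
qed

text \<open>All but finitely many terms exceed half the limit; among the others, those with
  \<open>h n > 0\<close> have a positive minimum. Small indices matter because \<open>j n\<close>
  may stay bounded.\<close>

lemma h_lower: obtains B where "B > 0" "\<And>n. n \<ge> 1 \<Longrightarrow> h n > 0 \<Longrightarrow> B \<le> real n powr (1 + \<alpha>) * h n"
proof -
  let ?K = "- b * rGamma (- \<alpha>)"
  let ?f = "\<lambda>n. real n powr (1 + \<alpha>) * h n"
  have "\<forall>\<^sub>F n in sequentially. ?f n > ?K / 2"
    using h_limit_pos by (intro order_tendstoD(1)[OF h_asymp]) auto
  then obtain N where N: "\<And>n. n \<ge> N \<Longrightarrow> ?f n > ?K / 2"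
    unfolding eventually_sequentially by blast
  define A where "A = insert (?K / 2) (?f ` {n. n < N \<and> n \<ge> 1 \<and> h n > 0})"
  have A: "finite A" "A \<noteq> {}" unfolding A_def by auto
  have pos: "x > 0" if "x \<in> A" for x using that h_limit_pos unfolding A_def by auto
  show ?thesis
  proof (rule that[of "Min A"])
    show "Min A > 0" using A pos by simp
    fix n assume n: "n \<ge> 1" "h n > 0"
    show "Min A \<le> ?f n"
    proof (cases "n < N")
      case True
      then show ?thesis using n A by (intro Min_le) (auto simp: A_def)
    next
      case False
      have "Min A \<le> ?K / 2" using A by (intro Min_le) (auto simp: A_def)
      then show ?thesis using N[of n] False by linarith
    qed
  qed
qed

text \<open>The parameter \<open>\<xi>\<^sub>n\<^sub>,\<^sub>j\<close> for \<open>\<rho>\<^sub>H = 1\<close>.\<close>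

definition xi :: "nat \<Rightarrow> nat \<Rightarrow> real" where
  "xi j n = h j / b * real n powr \<alpha>"

lemma xi_nonneg: "xi j n \<ge> 0"
  using h_nonneg b_pos by (simp add: xi_def)

text \<open>This explains the threshold: \<open>h j\<close> has order
  \<open>j powr (- (1 + \<alpha>))\<close>, and \<open>n powr \<alpha>\<close> is the power
  \<open>1 + \<alpha>\<close> of \<open>n powr (\<alpha> / (1 + \<alpha>))\<close>, so the size of
  \<open>xi\<close> is governed by the ratio of \<open>j\<close> to the latter.\<close>

lemma xi_eq:
  assumes "j \<ge> 1" "n \<ge> 1"
  shows "xi j n = (real j powr (1 + \<alpha>) * h j) / b * (real j / real n powr (\<alpha> / (1 + \<alpha>))) powr (- (1 + \<alpha>))"
proof -
  have "(real n powr (\<alpha> / (1 + \<alpha>))) powr (- (1 + \<alpha>)) = real n powr (- \<alpha>)"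
  proof -
    have "\<alpha> / (1 + \<alpha>) * (1 + \<alpha>) = \<alpha>" using \<alpha> by simp
    then show ?thesis by (simp only: powr_powr mult_minus_right)
  qed
  then have "(real j / real n powr (\<alpha> / (1 + \<alpha>))) powr (- (1 + \<alpha>)) = real j powr (- (1 + \<alpha>)) / real n powr (- \<alpha>)"
    by (simp only: powr_divide)
  also have "\<dots> = real n powr \<alpha> / real j powr (1 + \<alpha>)"
    by (simp only: powr_minus_divide) simp
  finally show ?thesis using assms by (simp add: xi_def)
qed

text \<open>As \<open>j = o(n)\<close>, the index \<open>m = n - j * s\<close> is asymptotic to
  \<open>n\<close>, and \<open>inverse_power_asymp\<close> applies at \<open>m\<close>. Dividing by
  the coefficient of \<open>F(z, 1)\<close>, which is asymptotic to \<open>\<alpha> / n\<close>,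
  raises \<open>n powr (s * \<alpha> - 1)\<close> to \<open>n powr (s * \<alpha>)\<close>.\<close>

lemma factorial_moment_asymp:
  fixes j :: "nat \<Rightarrow> nat"
  assumes j1: "\<And>n. j n \<ge> 1" and hj: "\<And>n. h (j n) > 0"
    and jo: "(\<lambda>n. real (j n) / real n) \<longlonglongrightarrow> 0"
  shows "(\<lambda>n. factorial_moment (component_pmf h (j n) n) s / xi (j n) n ^ s)
    \<longlonglongrightarrow> Gamma (real s + 1) / Gamma (real s * \<alpha> + 1)"
proof (cases "s = 0")
  case True
  then show ?thesis by (simp add: factorial_moment_def)
next
  case False
  then have s: "s \<ge> 1" by simp
  define a where "a m = inverse ((1 - Abs_fps h) ^ s) $ m" for m
  define D where "D n = (fps_X * fps_deriv (Abs_fps h) * inverse (1 - Abs_fps h)) $ n" for n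
  define m where "m n = n - j n * s" for n
  have "(\<lambda>n. real s * (real (j n) / real n)) \<longlonglongrightarrow> real s * 0" by (intro tendsto_mult_left jo)
  then have jo': "(\<lambda>n. real s * (real (j n) / real n)) \<longlonglongrightarrow> 0" by simp
  then have "\<forall>\<^sub>F n in sequentially. real s * (real (j n) / real n) < 1 / 2" by (intro order_tendstoD) auto
  then have ev: "\<forall>\<^sub>F n in sequentially. j n * s \<le> n \<and> real (m n) \<ge> real n / 2 \<and> n \<ge> 1 \<and> real (m n) / real n = 1 - real s * (real (j n) / real n)"
    using eventually_gt_at_top[of 0]
  proof eventually_elim
    case (elim n)
    then have l: "real (j n * s) < real n / 2" by (simp add: field_simps)
    then have "real (j n * s) \<le> real n" by linarith
    then have le: "j n * s \<le> n" by (simp only: of_nat_le_iff)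
    then have "real (m n) = real n - real (j n * s)" by (simp only: m_def of_nat_diff)
    then have mn: "real (m n) = real n - real s * real (j n)" by (simp add: mult.commute)
    have n: "real n > 0" using elim by simp
    then have "real (m n) / real n = 1 - real s * (real (j n) / real n)"
      by (simp add: mn diff_divide_distrib)
    moreover have "real (m n) \<ge> real n / 2" using l by (simp add: mn mult.commute)
    ultimately show ?case using n le by simp
  qed
  have m_lim: "filterlim m at_top sequentially"
    unfolding filterlim_at_top
  proof
    fix Z
    show "\<forall>\<^sub>F n in sequentially. Z \<le> m n"
      using ev eventually_ge_at_top[of "2 * Z"]
    proof eventually_elim
      case (elim n)
      then have "real Z \<le> real (m n)" by linarith
      then show ?case by simp
    qed
  qed
  have 1: "(\<lambda>n. real (m n) powr (1 - real s * \<alpha>) * a (m n)) \<longlonglongrightarrow> rGamma (real s * \<alpha>) / b ^ s"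
    unfolding a_def by (rule filterlim_compose[OF inverse_power_asymp m_lim])
  have "(\<lambda>n. 1 - real s * (real (j n) / real n)) \<longlonglongrightarrow> 1 - 0" by (intro tendsto_diff tendsto_const jo')
  then have "(\<lambda>n. (1 - real s * (real (j n) / real n)) powr (real s * \<alpha> - 1)) \<longlonglongrightarrow> (1 - 0) powr (real s * \<alpha> - 1)"
    by (intro tendsto_powr tendsto_const) auto
  then have 2: "(\<lambda>n. (1 - real s * (real (j n) / real n)) powr (real s * \<alpha> - 1)) \<longlonglongrightarrow> 1" by simp
  have 3: "D \<longlonglongrightarrow> \<alpha>" unfolding D_def by (rule log_deriv_asymp)
  have "(\<lambda>n. fact (s - 1) * b ^ s * (real (m n) powr (1 - real s * \<alpha>) * a (m n)) *
      (1 - real s * (real (j n) / real n)) powr (real s * \<alpha> - 1) / D n) \<longlonglongrightarrow>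
      fact (s - 1) * b ^ s * (rGamma (real s * \<alpha>) / b ^ s) * 1 / \<alpha>"
    using \<alpha> by (intro tendsto_divide tendsto_mult tendsto_const 1 2 3) auto
  \<comment> \<open>Multiplying both \<open>fact (s - 1)\<close> and
    \<open>\<alpha> * Gamma (s * \<alpha>)\<close> by \<open>s\<close> completes them to the stated
    Gamma values.\<close>
  also have "fact (s - 1) * b ^ s * (rGamma (real s * \<alpha>) / b ^ s) * 1 / \<alpha> = Gamma (real s + 1) / Gamma (real s * \<alpha> + 1)"
  proof -
    have "Gamma (real s + 1) = real s * fact (s - 1)"
      using s Gamma_fact[of s, where ?'a = real] by (simp add: add.commute fact_reduce)
    moreover have "Gamma (real s * \<alpha> + 1) = real s * \<alpha> * Gamma (real s * \<alpha>)"
    proof (rule Gamma_plus1)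
      have "real s * \<alpha> > 0" using s \<alpha> by simp
      then show "real s * \<alpha> \<notin> \<int>\<^sub>\<le>\<^sub>0" by (metis nonpos_Ints_nonpos not_le)
    qed
    ultimately show ?thesis using b s by (simp add: rGamma_inverse_Gamma divide_inverse)
  qed
  finally show ?thesis
  proof (rule Lim_transform_eventually)
    show "\<forall>\<^sub>F n in sequentially. fact (s - 1) * b ^ s * (real (m n) powr (1 - real s * \<alpha>) * a (m n)) *
      (1 - real s * (real (j n) / real n)) powr (real s * \<alpha> - 1) / D n =
      factorial_moment (component_pmf h (j n) n) s / xi (j n) n ^ s"
      using ev eventually_cycle_fps
    proof eventually_elim
      case (elim n)
      let ?F = "poly (cycle_fps h (j n) $ n) 1"
      have F: "real n * ?F = D n" unfolding D_def by (rule poly_cycle_fps_1[of h, OF h_0])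
      have "real n * ?F > \<alpha> / 2" using elim by blast
      then have F0: "?F \<noteq> 0" using \<alpha> by auto
      then have n: "real n > 0" "real (m n) > 0" using elim by auto
      have "factorial_moment (component_pmf h (j n) n) s = fact (s - 1) * h (j n) ^ s * a (m n) / ?F"
        using factorial_moment_component_pmf[of h "j n" s n, OF h_nonneg h_0 j1 s F0] elim
        by (simp add: a_def m_def)
      also have "\<dots> = fact (s - 1) * h (j n) ^ s * a (m n) * real n / D n"
        using n F0 by (simp flip: F)
      finally have fm: "factorial_moment (component_pmf h (j n) n) s = fact (s - 1) * h (j n) ^ s * a (m n) * real n / D n" .
      have "(1 - real s * (real (j n) / real n)) powr (real s * \<alpha> - 1) = (real (m n) / real n) powr (real s * \<alpha> - 1)"
        using elim by simp
      also have "\<dots> = real (m n) powr (real s * \<alpha> - 1) / real n powr (real s * \<alpha> - 1)"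
        by (simp add: powr_divide)
      finally have r: "real (m n) powr (1 - real s * \<alpha>) * (1 - real s * (real (j n) / real n)) powr (real s * \<alpha> - 1) =
         1 / real n powr (real s * \<alpha> - 1)"
        using n by (simp flip: powr_add)
      have x: "xi (j n) n ^ s = h (j n) ^ s / b ^ s * real n powr (real s * \<alpha>)"
        using n by (simp add: xi_def power_mult_distrib power_divide powr_power mult.commute)
      have y: "real n powr (real s * \<alpha>) = real n * real n powr (real s * \<alpha> - 1)"
        using n by (simp add: powr_diff)
      have "fact (s - 1) * b ^ s * (real (m n) powr (1 - real s * \<alpha>) * a (m n)) *
        (1 - real s * (real (j n) / real n)) powr (real s * \<alpha> - 1) / D n =
        fact (s - 1) * b ^ s * a (m n) / D n * (real (m n) powr (1 - real s * \<alpha>) * (1 - real s * (real (j n) / real n)) powr (real s * \<alpha> - 1))"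
        by simp
      also have "\<dots> = factorial_moment (component_pmf h (j n) n) s / xi (j n) n ^ s"
        unfolding r fm x y using n hj[of n] b by (simp add: field_simps)
      finally show ?case .
    qed
  qed
qed

text \<open>
  Components of size up to \<open>n / 2\<close> account for the term \<open>xi j n\<close>, larger ones for \<open>n\<^sup>-\<^sup>\<alpha>\<close>.
\<close>

lemma mean_component_le:
  obtains C where "\<forall>\<^sub>F n in sequentially. \<forall>j\<ge>1.
    factorial_moment (component_pmf h j n) 1 \<le> C * (xi j n + real n powr (- \<alpha>))"
proof -
  define a where "a m = inverse (1 - Abs_fps h) $ m" for m
  have "Bseq (\<lambda>m. real m powr (1 - real 1 * \<alpha>) * inverse ((1 - Abs_fps h) ^ 1) $ m)"
    by (intro convergent_imp_Bseq convergentI[OF inverse_power_asymp[of 1]])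
  then obtain A0 where A0: "\<And>m. norm (real m powr (1 - real 1 * \<alpha>) * inverse ((1 - Abs_fps h) ^ 1) $ m) \<le> A0"
    unfolding Bseq_def by blast
  define A where "A = max 1 A0"
  have A: "A \<ge> 1" "\<And>m. real m powr (1 - \<alpha>) * a m \<le> A"
    using A0 by (auto simp: A_def a_def abs_le_iff le_max_iff_disj)
  \<comment> \<open>For \<open>j\<close> close to \<open>n\<close> the index \<open>n - j\<close>
    may be small or 0, where only boundedness of \<open>a\<close> helps; \<open>A \<ge> 1\<close>
    covers \<open>a 0 = 1\<close>.\<close>
  have a1: "a m \<le> A" for m
  proof (cases "m = 0")
    case True
    then show ?thesis using A(1) h_0 by (simp add: a_def)
  next
    case False
    show ?thesis
    proof (cases "a m \<ge> 0")
      case True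
      have "1 * a m \<le> real m powr (1 - \<alpha>) * a m"
        using False \<alpha> True by (intro mult_right_mono ge_one_powr_ge_zero) auto
      then show ?thesis using A(2)[of m] by simp
    qed (use A in auto)
  qed
  have a2: "a m \<le> A * real m powr (\<alpha> - 1)" if "m \<ge> 1" for m
  proof -
    have "a m = (real m powr (1 - \<alpha>) * a m) * real m powr (\<alpha> - 1)"
      using that by (simp add: mult_ac flip: powr_add)
    also have "\<dots> \<le> A * real m powr (\<alpha> - 1)" by (intro mult_right_mono A) auto
    finally show ?thesis .
  qed
  from h_upper obtain B where B: "B > 0" "\<And>n. real n powr (1 + \<alpha>) * h n \<le> B" by blast
  \<comment> \<open>Both entries contain the 2 of \<open>1 / F \<le> 2 * n / \<alpha>\<close>; the
    other factors 2 and 4 bound \<open>2 powr (1 - \<alpha>)\<close> and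
    \<open>2 powr (1 + \<alpha>)\<close>, the cost of passing from \<open>n / 2\<close> to
    \<open>n\<close>.\<close>
  define C where "C = max (4 * A * b / \<alpha>) (8 * B * A / \<alpha>)"
  have C: "C \<ge> 4 * A * b / \<alpha>" "C \<ge> 8 * B * A / \<alpha>" "C \<ge> 0"
    using A B \<alpha> by (auto simp: C_def le_max_iff_disj)
  show ?thesis
  proof (rule that[of C], use eventually_cycle_fps eventually_ge_at_top[of 1] in eventually_elim, intro allI impI)
    fix n j :: nat
    assume F0: "\<forall>j. real n * poly (cycle_fps h j $ n) 1 > \<alpha> / 2" and n: "1 \<le> n" and j: "1 \<le> j"
    define F where "F = poly (cycle_fps h j $ n) 1"
    have F: "real n * F > \<alpha> / 2" using F0 unfolding F_def by blast
    then have Fnz: "F \<noteq> 0" using \<alpha> by auto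
    have "real n * F > 0" using F \<alpha> by linarith
    then have Fpos: "F > 0" using n by (simp add: zero_less_mult_iff)
    have inv: "1 / F \<le> 2 * real n / \<alpha>" using F Fpos \<alpha> by (simp add: field_simps)
    have fm: "factorial_moment (component_pmf h j n) 1 = (if j \<le> n then h j * a (n - j) else 0) / F"
      using factorial_moment_component_pmf[of h j 1 n, OF h_nonneg h_0 j _ Fnz[unfolded F_def]]
      by (simp add: a_def F_def)
    have npos: "xi j n + real n powr (- \<alpha>) \<ge> 0" using xi_nonneg by simp
    show "factorial_moment (component_pmf h j n) 1 \<le> C * (xi j n + real n powr (- \<alpha>))"
    proof (cases "j \<le> n")
      case False
      then show ?thesis using fm C npos by simp
    next
      case jn: True
      have key: "factorial_moment (component_pmf h j n) 1 \<le> h j * Y * (2 * real n / \<alpha>)" if Y: "a (n - j) \<le> Y" "Y \<ge> 0" for Y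
      proof -
        have "factorial_moment (component_pmf h j n) 1 = h j * a (n - j) * (1 / F)" using fm jn by simp
        also have "\<dots> \<le> h j * Y * (1 / F)" using Y h_nonneg[of j] Fpos by (intro mult_right_mono mult_left_mono) auto
        also have "\<dots> \<le> h j * Y * (2 * real n / \<alpha>)" using Y h_nonneg[of j] inv by (intro mult_left_mono) auto
        finally show ?thesis .
      qed
      show ?thesis
      proof (cases "2 * j \<le> n")
        case True
        have "a (n - j) \<le> A * real (n - j) powr (\<alpha> - 1)" using True j by (intro a2) auto
        also have "\<dots> \<le> A * (real n / 2) powr (\<alpha> - 1)"
          using True A \<alpha> n by (intro mult_left_mono powr_mono2') (auto simp: of_nat_diff)
        also have "(real n / 2) powr (\<alpha> - 1) = real n powr (\<alpha> - 1) * 2 powr (1 - \<alpha>)"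
          by (simp add: powr_divide powr_diff)
        also have "A * \<dots> \<le> A * (real n powr (\<alpha> - 1) * 2 powr 1)"
          using A \<alpha> by (intro mult_left_mono powr_mono) auto
        finally have "a (n - j) \<le> 2 * A * real n powr (\<alpha> - 1)" by simp
        then have "factorial_moment (component_pmf h j n) 1 \<le> h j * (2 * A * real n powr (\<alpha> - 1)) * (2 * real n / \<alpha>)"
          using A by (intro key) auto
        also have "\<dots> = 4 * A * b / \<alpha> * xi j n"
          using n b by (simp add: xi_def powr_diff)
        also have "\<dots> \<le> C * xi j n" using C xi_nonneg by (intro mult_right_mono) auto
        also have "\<dots> \<le> C * (xi j n + real n powr (- \<alpha>))" using C by (intro mult_left_mono) auto
        finally show ?thesis .
      next
        case False
        have "h j = (real j powr (1 + \<alpha>) * h j) * real j powr (- (1 + \<alpha>))"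
          using j by (simp add: mult_ac flip: powr_add)
        also have "\<dots> \<le> B * real j powr (- (1 + \<alpha>))" by (intro mult_right_mono B) auto
        also have "\<dots> \<le> B * (real n / 2) powr (- (1 + \<alpha>))"
          using False B \<alpha> n by (intro mult_left_mono powr_mono2') auto
        also have "(real n / 2) powr (- (1 + \<alpha>)) = real n powr (- (1 + \<alpha>)) * 2 powr (1 + \<alpha>)"
          unfolding powr_divide powr_minus_divide by simp
        also have "B * \<dots> \<le> B * (real n powr (- (1 + \<alpha>)) * 2 powr 2)"
          using B \<alpha> by (intro mult_left_mono powr_mono) auto
        finally have hj: "h j \<le> 4 * B * real n powr (- (1 + \<alpha>))" by simp
        have "factorial_moment (component_pmf h j n) 1 \<le> h j * A * (2 * real n / \<alpha>)"
          using A a1 by (intro key) auto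
        also have "\<dots> \<le> (4 * B * real n powr (- (1 + \<alpha>))) * A * (2 * real n / \<alpha>)"
          using hj A \<alpha> by (intro mult_right_mono) auto
        also have "\<dots> = 8 * B * A / \<alpha> * (real n powr (- (1 + \<alpha>)) * real n powr 1)"
          using n by simp
        also have "real n powr (- (1 + \<alpha>)) * real n powr 1 = real n powr (- \<alpha>)"
          unfolding powr_add[symmetric] by simp
        also have "8 * B * A / \<alpha> * real n powr (- \<alpha>) \<le> C * real n powr (- \<alpha>)" using C by (intro mult_right_mono) auto
        also have "\<dots> \<le> C * (xi j n + real n powr (- \<alpha>))" using C xi_nonneg by (intro mult_left_mono) auto
        finally show ?thesis .
      qed
    qed
  qed
qed


lemma eventually_falling_integrable:
  "\<forall>\<^sub>F n in sequentially. \<forall>s. integrable (measure_pmf (component_pmf h (j n) n)) (\<lambda>k. \<Prod>i<s. real k - real i)"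
  using eventually_integrable_component_pmf by eventually_elim blast

lemma little_o_of_ratio_tendsto_0:
  assumes "(\<lambda>n. real (j n) / real n powr \<beta>) \<longlonglongrightarrow> 0" "\<beta> < 1"
  shows "(\<lambda>n. real (j n) / real n) \<longlonglongrightarrow> 0"
proof -
  have "(\<lambda>n. real n powr (\<beta> - 1)) \<longlonglongrightarrow> 0"
    using assms by (intro tendsto_neg_powr filterlim_real_sequentially) auto
  from tendsto_mult[OF assms(1) this] have "(\<lambda>n. real (j n) / real n powr \<beta> * real n powr (\<beta> - 1)) \<longlonglongrightarrow> 0" by simp
  then show ?thesis
  proof (rule Lim_transform_eventually)
    show "\<forall>\<^sub>F n in sequentially. real (j n) / real n powr \<beta> * real n powr (\<beta> - 1) = real (j n) / real n"
      using eventually_gt_at_top[of 0] by eventually_elim (simp add: powr_diff)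
  qed
qed

lemma beta_less_1: "\<alpha> / (1 + \<alpha>) < 1"
  using \<alpha> by (simp add: field_simps)

section \<open>The three regimes of \<open>j\<close>\<close>

context
  fixes j :: "nat \<Rightarrow> nat" and L :: "real measure"
  assumes j1: "\<And>n. j n \<ge> 1" and hj: "\<And>n. h (j n) > 0" and L: "mittag_leffler \<alpha> L"
begin

lemma L_moment: "(\<integral>x. x ^ s \<partial>L) = Gamma (real s + 1) / Gamma (real s * \<alpha> + 1)"
  using mittag_leffler_props(4)[OF L \<alpha>(1)] .

lemma L_moment_pos: "(\<integral>x. x ^ s \<partial>L) > 0"
  unfolding L_moment using \<alpha> by (intro divide_pos_pos Gamma_real_pos add_nonneg_pos) auto

lemma L_moment_tail:
  assumes "t \<ge> 0"
  shows "(\<lambda>N. t ^ N / fact N * (\<integral>x. x ^ N \<partial>L)) \<longlonglongrightarrow> 0"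
proof -
  have "Gamma (real N + 1) = fact N" for N
    using Gamma_fact[of N, where ?'a = real] by (simp add: add.commute)
  then show ?thesis
    using power_over_Gamma_tendsto_0[OF assms \<alpha>(1)] by (simp add: L_moment)
qed

lemma factorial_moment_limit:
  assumes "(\<lambda>n. real (j n) / real n) \<longlonglongrightarrow> 0"
  shows "(\<lambda>n. factorial_moment (component_pmf h (j n) n) s / xi (j n) n ^ s) \<longlonglongrightarrow> (\<integral>x. x ^ s \<partial>L)"
  unfolding L_moment by (rule factorial_moment_asymp[OF j1 hj assms])

lemma eventually_xi_pos: "\<forall>\<^sub>F n in sequentially. xi (j n) n > 0"
  using eventually_gt_at_top[of 0] by eventually_elim (use hj b_pos in \<open>simp add: xi_def\<close>)

lemma factorial_moment_equiv:
  assumes "(\<lambda>n. real (j n)) \<in> o(\<lambda>n. real n)"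
  shows "(\<lambda>n. factorial_moment (component_pmf h (j n) n) s) \<sim>[sequentially] (\<lambda>n. xi (j n) n ^ s * (\<integral>x. x ^ s \<partial>L))"
proof (rule asymp_equivI')
  have "(\<lambda>n. real (j n) / real n) \<longlonglongrightarrow> 0" using assms by (rule smalloD_tendsto)
  from tendsto_divide[OF factorial_moment_limit[OF this, of s] tendsto_const[of "\<integral>x. x ^ s \<partial>L"]] L_moment_pos[of s]
  show "(\<lambda>n. factorial_moment (component_pmf h (j n) n) s / (xi (j n) n ^ s * (\<integral>x. x ^ s \<partial>L))) \<longlonglongrightarrow> 1"
    by simp
qed

text \<open>\<open>xi_eq\<close> is combined with \<open>h_lower\<close> instead of
  \<open>h_asymp\<close>, because \<open>j n\<close> need not tend to infinity here.\<close>

lemma xi_at_top: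
  assumes x: "(\<lambda>n. real (j n) / real n powr (\<alpha> / (1 + \<alpha>))) \<longlonglongrightarrow> 0"
  shows "filterlim (\<lambda>n. xi (j n) n) at_top sequentially"
proof -
  let ?x = "\<lambda>n. real (j n) / real n powr (\<alpha> / (1 + \<alpha>))"
  from h_lower obtain B where B: "B > 0" "\<And>n. n \<ge> 1 \<Longrightarrow> h n > 0 \<Longrightarrow> B \<le> real n powr (1 + \<alpha>) * h n" by blast
  have xpos: "\<forall>\<^sub>F n in sequentially. ?x n > 0"
    using eventually_gt_at_top[of 0] by eventually_elim (use j1 in \<open>simp add: Suc_le_eq\<close>)
  have "(\<lambda>n. ?x n powr (1 + \<alpha>)) \<longlonglongrightarrow> 0"
    using \<alpha> xpos by (intro tendsto_zero_powrI[OF x tendsto_const]) (auto elim!: eventually_mono)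
  then have "filterlim (\<lambda>n. inverse (?x n powr (1 + \<alpha>))) at_top sequentially"
    by (rule filterlim_inverse_at_top) (use xpos in eventually_elim, metis powr_gt_zero less_irrefl)
  then have "filterlim (\<lambda>n. B / b * ?x n powr (- (1 + \<alpha>))) at_top sequentially"
    using B b_pos by (intro filterlim_tendsto_pos_mult_at_top[OF tendsto_const]) (auto simp: powr_minus[of _ "1 + \<alpha>"] simp del: minus_add_distrib)
  then show ?thesis
  proof (rule filterlim_at_top_mono)
    show "\<forall>\<^sub>F n in sequentially. B / b * ?x n powr (- (1 + \<alpha>)) \<le> xi (j n) n"
      using eventually_ge_at_top[of 1]
    proof eventually_elim
      case (elim n)
      then show ?case
        unfolding xi_eq[OF j1 elim] using B j1[of n] hj[of n] b_pos
        by (intro mult_right_mono divide_right_mono) auto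
    qed
  qed
qed

text \<open>The \<open>s\<close>-th moment of \<open>X / xi\<close> combines the ratios
  \<open>fm n m / xi ^ m\<close> with Stirling numbers and weights \<open>1 / xi ^ (s - m)\<close>;
  as \<open>xi\<close> tends to infinity only \<open>m = s\<close> survives.\<close>

lemma scaled_moment_limit:
  assumes x: "(\<lambda>n. real (j n) / real n powr (\<alpha> / (1 + \<alpha>))) \<longlonglongrightarrow> 0"
  shows "(\<lambda>n. measure_pmf.expectation (component_pmf h (j n) n) (\<lambda>k. (real k / xi (j n) n) ^ s)) \<longlonglongrightarrow> (\<integral>x. x ^ s \<partial>L)"
proof -
  define fm where "fm n m = factorial_moment (component_pmf h (j n) n) m" for n m
  have fm: "(\<lambda>n. fm n m / xi (j n) n ^ m) \<longlonglongrightarrow> (\<integral>x. x ^ m \<partial>L)" for m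
    unfolding fm_def by (intro factorial_moment_limit little_o_of_ratio_tendsto_0[OF x beta_less_1])
  have inv: "(\<lambda>n. inverse (xi (j n) n)) \<longlonglongrightarrow> 0"
    by (intro tendsto_inverse_0_at_top xi_at_top x)
  have "(\<lambda>n. \<Sum>m\<le>s. real (Stirling s m) * (fm n m / xi (j n) n ^ m) * inverse (xi (j n) n) ^ (s - m))
      \<longlonglongrightarrow> (\<Sum>m\<le>s. real (Stirling s m) * (\<integral>x. x ^ m \<partial>L) * 0 ^ (s - m))"
    by (intro tendsto_intros fm inv)
  also have "(\<Sum>m\<le>s. real (Stirling s m) * (\<integral>x. x ^ m \<partial>L) * 0 ^ (s - m)) =
      (\<Sum>m\<in>{s}. real (Stirling s m) * (\<integral>x. x ^ m \<partial>L) * 0 ^ (s - m))"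
    by (intro sum.mono_neutral_right) auto
  also have "\<dots> = (\<integral>x. x ^ s \<partial>L)" by simp
  finally show ?thesis
  proof (rule Lim_transform_eventually)
    show "\<forall>\<^sub>F n in sequentially. (\<Sum>m\<le>s. real (Stirling s m) * (fm n m / xi (j n) n ^ m) * inverse (xi (j n) n) ^ (s - m)) =
      measure_pmf.expectation (component_pmf h (j n) n) (\<lambda>k. (real k / xi (j n) n) ^ s)"
      using eventually_falling_integrable[of j] eventually_xi_pos
    proof eventually_elim
      case (elim n)
      have "measure_pmf.expectation (component_pmf h (j n) n) (\<lambda>k. (real k / xi (j n) n) ^ s) =
        (\<Sum>m\<le>s. real (Stirling s m) * fm n m) / xi (j n) n ^ s"
        using expectation_power_eq_sum_Stirling(2)[of "component_pmf h (j n) n" s] elim(1)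
        by (simp add: power_divide fm_def)
      also have "\<dots> = (\<Sum>m\<le>s. real (Stirling s m) * (fm n m / xi (j n) n ^ m) * inverse (xi (j n) n) ^ (s - m))"
        unfolding sum_divide_distrib
      proof (intro sum.cong refl)
        fix m assume "m \<in> {..s}"
        then have "xi (j n) n ^ s = xi (j n) n ^ m * xi (j n) n ^ (s - m)" by (simp flip: power_add)
        then show "real (Stirling s m) * fm n m / xi (j n) n ^ s =
          real (Stirling s m) * (fm n m / xi (j n) n ^ m) * inverse (xi (j n) n) ^ (s - m)"
          by (simp add: power_inverse divide_inverse)
      qed
      finally show ?case by simp
    qed
  qed
qed

lemma weak_conv_scaled:
  assumes x: "(\<lambda>n. real (j n) / real n powr (\<alpha> / (1 + \<alpha>))) \<longlonglongrightarrow> 0"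
  shows "weak_conv_m (\<lambda>n. distr (measure_pmf (component_pmf h (j n) n)) borel (\<lambda>k. real k / xi (j n) n)) L"
proof (rule weak_conv_moments)
  let ?X = "\<lambda>n. measure_pmf (component_pmf h (j n) n)"
  show "real_distribution (distr (?X n) borel (\<lambda>k. real k / xi (j n) n))" for n
    by (rule real_distribution_distr_pmf)
  show "real_distribution L" "AE x in L. 0 \<le> x" "\<And>s. integrable L (\<lambda>x. x ^ s)"
    by (rule mittag_leffler_props[OF L \<alpha>(1)])+
  show "\<forall>\<^sub>F n in sequentially. (AE x in distr (?X n) borel (\<lambda>k. real k / xi (j n) n). 0 \<le> x) \<and>
      (\<forall>s. integrable (distr (?X n) borel (\<lambda>k. real k / xi (j n) n)) (\<lambda>x. x ^ s))"
    using eventually_integrable_component_pmf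
  proof eventually_elim
    case (elim n)
    have "AE x in distr (?X n) borel (\<lambda>k. real k / xi (j n) n). 0 \<le> x"
      by (subst AE_distr_iff) (auto intro!: divide_nonneg_nonneg xi_nonneg)
    moreover have "integrable (distr (?X n) borel (\<lambda>k. real k / xi (j n) n)) (\<lambda>x. x ^ s)" for s
      using elim by (subst integrable_distr_eq) auto
    ultimately show ?case by blast
  qed
  show "(\<lambda>n. \<integral>x. x ^ s \<partial>distr (?X n) borel (\<lambda>k. real k / xi (j n) n)) \<longlonglongrightarrow> (\<integral>x. x ^ s \<partial>L)" for s
    using scaled_moment_limit[OF x, of s] by (subst integral_distr) auto
  show "(\<lambda>N. t ^ N / fact N * (\<integral>x. x ^ N \<partial>L)) \<longlonglongrightarrow> 0" if "t \<ge> 0" for t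
    using that by (rule L_moment_tail)
qed

context
  fixes r :: real
  assumes r: "r > 0" and jr: "(\<lambda>n. real (j n)) \<sim>[sequentially] (\<lambda>n. r * real n powr (\<alpha> / (1 + \<alpha>)))"
begin

abbreviation (input) xi_limit :: real where
  "xi_limit \<equiv> r powr (- (1 + \<alpha>)) * (1 / (- Gamma (- \<alpha>)))"

lemma ratio_tendsto_r: "(\<lambda>n. real (j n) / real n powr (\<alpha> / (1 + \<alpha>))) \<longlonglongrightarrow> r"
proof -
  have "(\<lambda>n. real (j n) / (r * real n powr (\<alpha> / (1 + \<alpha>)))) \<longlonglongrightarrow> 1"
    using jr by (rule asymp_equivD_strong) (use eventually_gt_at_top[of 0] in eventually_elim, use r in simp)
  from tendsto_mult_left[OF this, of r] show ?thesis using r by simp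
qed

lemma j_at_top: "filterlim j at_top sequentially"
proof -
  have "filterlim (\<lambda>n. real n powr (\<alpha> / (1 + \<alpha>))) at_top sequentially"
    using \<alpha> by (intro filterlim_compose[OF real_powr_at_top] filterlim_real_sequentially) auto
  then have "filterlim (\<lambda>n. r * real n powr (\<alpha> / (1 + \<alpha>))) at_top sequentially"
    by (rule filterlim_tendsto_pos_mult_at_top[OF tendsto_const r])
  then have "filterlim (\<lambda>n. real (j n)) at_top sequentially"
    using asymp_equiv_at_top_transfer[OF asymp_equiv_symI[OF jr]] by simp
  then show ?thesis
    by (simp add: filterlim_at_top) (metis (mono_tags, lifting) eventually_mono of_nat_le_iff)
qed

text \<open>Here \<open>j n\<close> tends to infinity, so \<open>h_asymp\<close> applies along it;
  \<open>b\<close> cancels and \<open>- rGamma (- \<alpha>)\<close> is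
  \<open>1 / (- Gamma (- \<alpha>))\<close>.\<close>

lemma xi_tendsto: "(\<lambda>n. xi (j n) n) \<longlonglongrightarrow> xi_limit"
proof -
  have "(\<lambda>n. (real (j n) powr (1 + \<alpha>) * h (j n)) / b * (real (j n) / real n powr (\<alpha> / (1 + \<alpha>))) powr (- (1 + \<alpha>)))
    \<longlonglongrightarrow> (- b * rGamma (- \<alpha>)) / b * r powr (- (1 + \<alpha>))"
    using b r by (intro tendsto_intros filterlim_compose[OF h_asymp j_at_top] ratio_tendsto_r) auto
  also have "(- b * rGamma (- \<alpha>)) / b * r powr (- (1 + \<alpha>)) = xi_limit"
    using b by (simp add: rGamma_inverse_Gamma divide_inverse)
  finally show ?thesis
    by (rule Lim_transform_eventually) (use eventually_ge_at_top[of 1] in eventually_elim, simp only: xi_eq[OF j1])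
qed

lemma xi_limit_nonneg: "xi_limit \<ge> 0"
  using xi_tendsto by (rule tendsto_lowerbound) (auto intro!: always_eventually xi_nonneg)

lemma Y_factorial_moment:
  "integrable (measure_pmf (mixed_poisson_pmf xi_limit L)) (\<lambda>k. \<Prod>i<s. real k - real i)"
  "factorial_moment (mixed_poisson_pmf xi_limit L) s = xi_limit ^ s * (\<integral>x. x ^ s \<partial>L)"
  using mixed_poisson_falling_factorial[OF mittag_leffler_props(1,2)[OF L \<alpha>(1)] xi_limit_nonneg mittag_leffler_props(3)[OF L \<alpha>(1)]]
  by auto

lemma factorial_moment_limit_Poisson:
  "(\<lambda>n. factorial_moment (component_pmf h (j n) n) s) \<longlonglongrightarrow> factorial_moment (mixed_poisson_pmf xi_limit L) s"
proof -
  have "(\<lambda>n. real n powr (\<alpha> / (1 + \<alpha>) - 1)) \<longlonglongrightarrow> 0"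
    using beta_less_1 by (intro tendsto_neg_powr filterlim_real_sequentially) auto
  from tendsto_mult[OF ratio_tendsto_r this]
  have "(\<lambda>n. real (j n) / real n powr (\<alpha> / (1 + \<alpha>)) * real n powr (\<alpha> / (1 + \<alpha>) - 1)) \<longlonglongrightarrow> 0" by simp
  then have "(\<lambda>n. real (j n) / real n) \<longlonglongrightarrow> 0"
    by (rule Lim_transform_eventually) (use eventually_gt_at_top[of 0] in eventually_elim, simp add: powr_diff)
  from tendsto_mult[OF tendsto_power[OF xi_tendsto, of s] factorial_moment_limit[OF this, of s]]
  show ?thesis
    unfolding Y_factorial_moment(2)
    by (rule Lim_transform_eventually) (use eventually_xi_pos in eventually_elim, simp)
qed

lemma weak_conv_Poisson:
  "weak_conv_m (\<lambda>n. distr (measure_pmf (component_pmf h (j n) n)) borel real)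
     (distr (measure_pmf (mixed_poisson_pmf xi_limit L)) borel real)"
proof (rule weak_conv_factorial_moments[OF eventually_falling_integrable Y_factorial_moment(1) factorial_moment_limit_Poisson])
  have "(\<lambda>N. (2 * xi_limit) ^ N / fact N * (\<integral>x. x ^ N \<partial>L)) \<longlonglongrightarrow> 0"
    using xi_limit_nonneg by (intro L_moment_tail) linarith
  then show "(\<lambda>N. 2 ^ N / fact N * factorial_moment (mixed_poisson_pmf xi_limit L) N) \<longlonglongrightarrow> 0"
    unfolding Y_factorial_moment(2) power_mult_distrib by (simp only: mult_ac times_divide_eq_left times_divide_eq_right)
qed

lemma moment_limit_Poisson:
  "integrable (measure_pmf (mixed_poisson_pmf xi_limit L)) (\<lambda>k. real k ^ s)"
  "(\<lambda>n. measure_pmf.expectation (component_pmf h (j n) n) (\<lambda>k. real k ^ s))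
     \<longlonglongrightarrow> measure_pmf.expectation (mixed_poisson_pmf xi_limit L) (\<lambda>k. real k ^ s)"
proof -
  show "integrable (measure_pmf (mixed_poisson_pmf xi_limit L)) (\<lambda>k. real k ^ s)"
    by (intro expectation_power_eq_sum_Stirling Y_factorial_moment)
  have "(\<lambda>n. \<Sum>m\<le>s. real (Stirling s m) * factorial_moment (component_pmf h (j n) n) m)
    \<longlonglongrightarrow> (\<Sum>m\<le>s. real (Stirling s m) * factorial_moment (mixed_poisson_pmf xi_limit L) m)"
    by (intro tendsto_sum tendsto_mult_left factorial_moment_limit_Poisson)
  also have "(\<Sum>m\<le>s. real (Stirling s m) * factorial_moment (mixed_poisson_pmf xi_limit L) m) =
      measure_pmf.expectation (mixed_poisson_pmf xi_limit L) (\<lambda>k. real k ^ s)"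
    by (intro expectation_power_eq_sum_Stirling(2)[symmetric] Y_factorial_moment)
  finally show "(\<lambda>n. measure_pmf.expectation (component_pmf h (j n) n) (\<lambda>k. real k ^ s))
     \<longlonglongrightarrow> measure_pmf.expectation (mixed_poisson_pmf xi_limit L) (\<lambda>k. real k ^ s)"
    by (rule Lim_transform_eventually)
       (use eventually_falling_integrable[of j] in eventually_elim, intro expectation_power_eq_sum_Stirling(2)[symmetric], blast)
qed

end

lemma xi_tendsto_0:
  assumes x: "filterlim (\<lambda>n. real (j n) / real n powr (\<alpha> / (1 + \<alpha>))) at_top sequentially"
  shows "(\<lambda>n. xi (j n) n) \<longlonglongrightarrow> 0"
proof -
  let ?x = "\<lambda>n. real (j n) / real n powr (\<alpha> / (1 + \<alpha>))"
  from h_upper obtain B where B: "B > 0" "\<And>n. real n powr (1 + \<alpha>) * h n \<le> B" by blast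
  have "(\<lambda>n. ?x n powr (- (1 + \<alpha>))) \<longlonglongrightarrow> 0"
    using \<alpha> by (intro tendsto_neg_powr x) auto
  from tendsto_mult_left[OF this, of "B / b"] have lim: "(\<lambda>n. B / b * ?x n powr (- (1 + \<alpha>))) \<longlonglongrightarrow> 0" by simp
  show ?thesis
  proof (rule tendsto_sandwich[OF _ _ tendsto_const lim])
    show "\<forall>\<^sub>F n in sequentially. xi (j n) n \<le> B / b * ?x n powr (- (1 + \<alpha>))"
      using eventually_ge_at_top[of 1]
    proof eventually_elim
      case (elim n)
      show ?case unfolding xi_eq[OF j1 elim] using B b_pos by (intro mult_right_mono divide_right_mono) auto
    qed
  qed (simp add: xi_nonneg)
qed

text \<open>In this regime \<open>j\<close> may be comparable to \<open>n\<close> or larger, beyond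
  the reach of \<open>factorial_moment_asymp\<close>; the mean bound for all
  \<open>j \<ge> 1\<close> still tends to 0 with \<open>xi\<close>.\<close>

lemma weak_conv_0:
  assumes x: "filterlim (\<lambda>n. real (j n) / real n powr (\<alpha> / (1 + \<alpha>))) at_top sequentially"
  shows "weak_conv_m (\<lambda>n. distr (measure_pmf (component_pmf h (j n) n)) borel real) (return borel 0)"
proof (rule weak_conv_return_0[OF eventually_falling_integrable])
  from mean_component_le obtain C where C: "\<forall>\<^sub>F n in sequentially. \<forall>j\<ge>1.
    factorial_moment (component_pmf h j n) 1 \<le> C * (xi j n + real n powr (- \<alpha>))" by blast
  have "(\<lambda>n. C * (xi (j n) n + real n powr (- \<alpha>))) \<longlonglongrightarrow> C * (0 + 0)"
    using \<alpha> by (intro tendsto_mult_left tendsto_add xi_tendsto_0 x tendsto_neg_powr filterlim_real_sequentially) auto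
  then have lim: "(\<lambda>n. C * (xi (j n) n + real n powr (- \<alpha>))) \<longlonglongrightarrow> 0" by simp
  show "(\<lambda>n. factorial_moment (component_pmf h (j n) n) 1) \<longlonglongrightarrow> 0"
  proof (rule tendsto_sandwich[OF _ _ tendsto_const lim])
    show "\<forall>\<^sub>F n in sequentially. factorial_moment (component_pmf h (j n) n) 1 \<le> C * (xi (j n) n + real n powr (- \<alpha>))"
      using C by eventually_elim (use j1 in blast)
  qed (simp add: factorial_moment_nonneg)
qed

end

end

section \<open>Back to the radius \<open>\<rho>\<close>\<close>

lemma Delta_domainI:
  assumes z: "z \<in> left_cone (cos \<theta>)" and \<theta>: "0 < \<theta>" "\<theta> < pi / 2" and \<rho>: "\<rho> > 0"
    and n: "norm (of_real \<rho> * z) < \<rho> + \<epsilon>"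
  shows "of_real \<rho> * z \<in> Delta_domain \<rho> \<epsilon> \<theta>"
proof -
  define u where "u = z - 1"
  have u0: "u \<noteq> 0" using z by (auto simp: left_cone_def u_def)
  have "of_real \<rho> * z - of_real \<rho> = of_real \<rho> * u" by (simp add: u_def algebra_simps)
  then have Arg: "Arg (of_real \<rho> * z - of_real \<rho>) = Arg u"
    using \<rho> by simp
  have "\<theta> < \<bar>Arg u\<bar>"
  proof (rule ccontr)
    assume "\<not> \<theta> < \<bar>Arg u\<bar>"
    \<comment> \<open>Cosine decreases on \<open>[0, pi]\<close> and
      \<open>Re u = norm u * cos (Arg u)\<close>: this turns the condition on \<open>Arg\<close>
      into the cone inequality.\<close>
    then have "cos \<theta> \<le> cos \<bar>Arg u\<bar>" using \<theta> by (intro cos_monotone_0_pi_le) auto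
    then have "cos \<theta> \<le> Re u / norm u" using u0 by (simp add: cos_Arg)
    then have "cos \<theta> * norm u \<le> Re u" using u0 by (simp add: field_simps)
    then show False using z by (simp add: left_cone_def u_def)
  qed
  then show ?thesis using n by (simp add: Delta_domain_def Arg)
qed

lemma unit_cball_subset_left_cone:
  assumes "0 < \<kappa>"
  shows "cball 0 1 - {1} \<subseteq> left_cone \<kappa>"
proof
  fix z :: complex assume z: "z \<in> cball 0 1 - {1}"
  have "Re z \<le> 1" using complex_Re_le_cmod[of z] z by simp
  moreover have "0 < \<kappa> * norm (z - 1)" using assms z by simp
  ultimately show "z \<in> left_cone \<kappa>" by (simp add: left_cone_def)
qed

lemma unit_delta_series_scale:
  fixes h :: "nat \<Rightarrow> real" and H :: "complex \<Rightarrow> complex"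
  assumes h: "\<And>n. h n \<ge> 0" "h 0 = 0" and \<rho>: "\<rho> > 0" and \<epsilon>: "\<epsilon> > 0" and \<theta>: "0 < \<theta>" "\<theta> < pi / 2"
    and ana: "H analytic_on Delta_domain \<rho> \<epsilon> \<theta>"
    and sums: "\<And>z. norm z < \<rho> \<Longrightarrow> (\<lambda>n. of_real (h n) * z ^ n) sums H z"
    and crit: "(\<lambda>n. h n * \<rho> ^ n) sums 1"
    and \<alpha>: "0 < \<alpha>" "\<alpha> < 1" and c: "c \<noteq> 0"
    and equiv: "(\<lambda>z. H z - 1) \<sim>[at (of_real \<rho>) within Delta_domain \<rho> \<epsilon> \<theta>]
           (\<lambda>z. of_real c * (1 - z / of_real \<rho>) powr of_real \<alpha>)"
  obtains U where "unit_delta_series (\<lambda>n. h n * \<rho> ^ n) (\<lambda>z. H (of_real \<rho> * z)) U (cos \<theta>) (\<epsilon> / \<rho>) \<alpha> (- c)"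
proof -
  \<comment> \<open>Analyticity on the domain supplies an open set around it, whose preimage under
    the scaling serves as \<open>U\<close>.\<close>
  from ana obtain T where T: "open T" "Delta_domain \<rho> \<epsilon> \<theta> \<subseteq> T" "H holomorphic_on T"
    by (auto simp: analytic_on_holomorphic)
  define U where "U = (\<lambda>z. of_real \<rho> * z) -` T"
  have \<kappa>: "0 < cos \<theta>" using \<theta> by (intro cos_gt_zero) auto
  have cone: "of_real \<rho> * z \<in> Delta_domain \<rho> \<epsilon> \<theta>" if "z \<in> left_cone (cos \<theta>) \<inter> ball 1 (\<epsilon> / \<rho>)" for z
  proof (rule Delta_domainI)
    have "norm z < 1 + \<epsilon> / \<rho>"
      using that norm_triangle_ineq[of "z - 1" 1] by (simp add: dist_norm norm_minus_commute)
    then have "\<rho> * norm z < \<rho> * (1 + \<epsilon> / \<rho>)" using \<rho> by (intro mult_strict_left_mono)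
    then show "norm (of_real \<rho> * z) < \<rho> + \<epsilon>" using \<rho> by (simp add: norm_mult algebra_simps)
  qed (use that \<theta> \<rho> in auto)
  have "unit_delta_series (\<lambda>n. h n * \<rho> ^ n) (\<lambda>z. H (of_real \<rho> * z)) U (cos \<theta>) (\<epsilon> / \<rho>) \<alpha> (- c)"
  proof
    show "open U" unfolding U_def using T by (intro open_vimage continuous_intros)
    show "cball 0 1 - {1} \<subseteq> U"
    proof
      fix z :: complex assume z: "z \<in> cball 0 1 - {1}"
      have "\<rho> * norm z \<le> \<rho> * 1" using z \<rho> by (intro mult_left_mono) auto
      then have "\<rho> * norm z < \<rho> + \<epsilon>" using \<epsilon> by linarith
      then have "norm (of_real \<rho> * z) < \<rho> + \<epsilon>" using \<rho> by (simp add: norm_mult)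
      then have "of_real \<rho> * z \<in> Delta_domain \<rho> \<epsilon> \<theta>"
        using z \<rho> \<theta> unit_cball_subset_left_cone[OF \<kappa>] by (intro Delta_domainI) auto
      then show "z \<in> U" using T by (auto simp: U_def)
    qed
    have "(H \<circ> (\<lambda>z. of_real \<rho> * z)) holomorphic_on U"
      by (rule holomorphic_on_compose_gen[OF _ T(3)]) (auto simp: U_def intro!: holomorphic_intros)
    then show "(\<lambda>z. H (of_real \<rho> * z)) holomorphic_on U" by (simp add: o_def)
    show "left_cone (cos \<theta>) \<inter> ball 1 (\<epsilon> / \<rho>) \<subseteq> U" using cone T(2) unfolding U_def by blast
    show "(\<lambda>n. of_real (h n * \<rho> ^ n) * z ^ n) sums H (of_real \<rho> * z)" if "norm z < 1" for z
      using sums[of "of_real \<rho> * z"] that \<rho> by (simp add: norm_mult power_mult_distrib mult_ac)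
    let ?S = "at 1 within left_cone (cos \<theta>)"
    have near: "\<forall>\<^sub>F z in ?S. z \<in> left_cone (cos \<theta>) \<inter> ball 1 (\<epsilon> / \<rho>) \<and> z \<noteq> 1"
      unfolding eventually_at using \<epsilon> \<rho> by (intro exI[of _ "\<epsilon> / \<rho>"]) (auto simp: dist_commute)
    have "((\<lambda>z. of_real \<rho> * z) \<longlongrightarrow> of_real \<rho> * 1) ?S" by (intro tendsto_intros)
    then have F: "filterlim (\<lambda>z. of_real \<rho> * z) (at (of_real \<rho>) within Delta_domain \<rho> \<epsilon> \<theta>) ?S"
      unfolding filterlim_at using near \<rho> cone by (auto elim!: eventually_mono)
    have "((\<lambda>z. (H (of_real \<rho> * z) - 1) / (of_real c * (1 - of_real \<rho> * z / of_real \<rho>) powr of_real \<alpha>)) \<longlongrightarrow> 1) ?S"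
    proof (rule asymp_equivD_strong)
      show "(\<lambda>z. H (of_real \<rho> * z) - 1) \<sim>[?S] (\<lambda>z. of_real c * (1 - of_real \<rho> * z / of_real \<rho>) powr of_real \<alpha>)"
        using asymp_equiv_compose'[OF equiv F] .
      show "\<forall>\<^sub>F z in ?S. H (of_real \<rho> * z) - 1 \<noteq> 0 \<or> of_real c * (1 - of_real \<rho> * z / of_real \<rho>) powr of_real \<alpha> \<noteq> 0"
        using near by eventually_elim (use c \<rho> in auto)
    qed
    \<comment> \<open>The factor \<open>- c\<close> turns the quotient, of limit 1, into
      \<open>(1 - H) * (1 - z) powr (- \<alpha>)\<close>, of limit \<open>b = - c\<close>.\<close>
    then have "((\<lambda>z. of_real (- c) * ((H (of_real \<rho> * z) - 1) / (of_real c * (1 - of_real \<rho> * z / of_real \<rho>) powr of_real \<alpha>))) \<longlongrightarrow> of_real (- c) * 1) ?S"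
      by (rule tendsto_mult_left)
    moreover have "(\<lambda>z. of_real (- c) * ((H (of_real \<rho> * z) - 1) / (of_real c * (1 - of_real \<rho> * z / of_real \<rho>) powr of_real \<alpha>))) =
        (\<lambda>z. (1 - H (of_real \<rho> * z)) * (1 - z) powr of_real (- \<alpha>))"
    proof
      fix z
      have cancel: "of_real (- c) * (x / (of_real c * p)) = - x * inverse p" for x p :: complex
        using c by (simp add: divide_inverse)
      show "of_real (- c) * ((H (of_real \<rho> * z) - 1) / (of_real c * (1 - of_real \<rho> * z / of_real \<rho>) powr of_real \<alpha>)) =
          (1 - H (of_real \<rho> * z)) * (1 - z) powr of_real (- \<alpha>)"
        unfolding cancel using \<rho> by (simp add: powr_minus algebra_simps)
    qed
    ultimately show "((\<lambda>z. (1 - H (of_real \<rho> * z)) * (1 - z) powr of_real (- \<alpha>)) \<longlongrightarrow> of_real (- c)) ?S"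
      by simp
  qed (use assms \<kappa> in auto)
  then show ?thesis by (rule that)
qed

text \<open>Criticality \<open>H(\<rho>) = 1\<close> enters as the sum of
  \<open>h n * \<rho> ^ n\<close> and as the constant 1 in the singular expansion. The first two
  regimes imply \<open>j = o(n)\<close> because \<open>\<beta> < 1\<close>.\<close>

theorem theorem7p3:
  fixes h :: "nat \<Rightarrow> real" and H :: "complex \<Rightarrow> complex" and j :: "nat \<Rightarrow> nat"
    and \<rho> \<epsilon> \<theta> c \<alpha> :: real and L :: "real measure"
  defines "\<xi> \<equiv> (\<lambda>n. \<rho> ^ j n / (- c) * h (j n) * real n powr \<alpha>)"
    and "\<beta> \<equiv> \<alpha> / (1 + \<alpha>)"
    and "X \<equiv> (\<lambda>n. component_pmf h (j n) n)"
  assumes "\<And>n. h n \<ge> 0" and "h 0 = 0"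
    and "\<rho> > 0" and "conv_radius h = ereal \<rho>"
    and "\<epsilon> > 0" and "0 < \<theta>" and "\<theta> < pi / 2"
    and "H analytic_on Delta_domain \<rho> \<epsilon> \<theta>"
    and "\<And>z. norm z < \<rho> \<Longrightarrow> (\<lambda>n. of_real (h n) * z ^ n) sums H z"
    and "(\<lambda>n. h n * \<rho> ^ n) sums 1"
    and "0 < \<alpha>" and "\<alpha> < 1" and "c \<noteq> 0"
    and "(\<lambda>z. H z - 1) \<sim>[at (of_real \<rho>) within Delta_domain \<rho> \<epsilon> \<theta>]
           (\<lambda>z. of_real c * (1 - z / of_real \<rho>) powr of_real \<alpha>)"
    and "\<And>n. j n \<ge> 1" and "\<And>n. h (j n) > 0"
    and "mittag_leffler \<alpha> L"
  shows
    "(\<forall>s. integrable L (\<lambda>x. x ^ s) \<and>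
        (\<integral>x. x ^ s \<partial>L) = Gamma (real s + 1) / Gamma (real s * \<alpha> + 1)) \<and>
     ((\<lambda>n. real (j n)) \<in> o(\<lambda>n. real n) \<longrightarrow>
        (\<forall>s\<ge>1. (\<lambda>n. factorial_moment (X n) s) \<sim>[sequentially]
                  (\<lambda>n. \<xi> n ^ s * (\<integral>x. x ^ s \<partial>L)))) \<and>
     ((\<lambda>n. real (j n) / real n powr \<beta>) \<longlonglongrightarrow> 0 \<longrightarrow>
        filterlim \<xi> at_top sequentially \<and>
        weak_conv_m (\<lambda>n. distr (measure_pmf (X n)) borel (\<lambda>k. real k / \<xi> n)) L \<and>
        (\<forall>s. (\<lambda>n. measure_pmf.expectation (X n) (\<lambda>k. (real k / \<xi> n) ^ s))
               \<longlonglongrightarrow> (\<integral>x. x ^ s \<partial>L))) \<and>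
     (\<forall>r>0. (\<lambda>n. real (j n)) \<sim>[sequentially] (\<lambda>n. r * real n powr \<beta>) \<longrightarrow>
        (let \<xi>' = r powr (- (1 + \<alpha>)) * (1 / (- Gamma (- \<alpha>))); Y = mixed_poisson_pmf \<xi>' L in
           \<xi> \<longlonglongrightarrow> \<xi>' \<and>
           weak_conv_m (\<lambda>n. distr (measure_pmf (X n)) borel real) (distr (measure_pmf Y) borel real) \<and>
           (\<forall>s. integrable (measure_pmf Y) (\<lambda>k. real k ^ s) \<and>
                (\<lambda>n. measure_pmf.expectation (X n) (\<lambda>k. real k ^ s))
                  \<longlonglongrightarrow> measure_pmf.expectation Y (\<lambda>k. real k ^ s)))) \<and>
     (filterlim (\<lambda>n. real (j n) / real n powr \<beta>) at_top sequentially \<longrightarrow>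
        \<xi> \<longlonglongrightarrow> 0 \<and>
        weak_conv_m (\<lambda>n. distr (measure_pmf (X n)) borel real) (return borel 0))"
proof -
  define g where "g n = h n * \<rho> ^ n" for n
  obtain U where "unit_delta_series g (\<lambda>z. H (of_real \<rho> * z)) U (cos \<theta>) (\<epsilon> / \<rho>) \<alpha> (- c)"
    using unit_delta_series_scale[of h \<rho> \<epsilon> \<theta> H \<alpha> c] assms(4-) unfolding g_def by blast
  then interpret unit_delta_series g "\<lambda>z. H (of_real \<rho> * z)" U "cos \<theta>" "\<epsilon> / \<rho>" \<alpha> "- c" .
  have j1: "j n \<ge> 1" and gj: "g (j n) > 0" for n
    using assms by (auto simp: g_def)
  have L: "mittag_leffler \<alpha> L" by fact
  have X: "X = (\<lambda>n. component_pmf g (j n) n)"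
    unfolding X_def g_def using \<open>\<rho> > 0\<close> by (simp add: component_pmf_scale)
  have xi: "\<xi> = (\<lambda>n. xi (j n) n)"
    by (simp add: \<xi>_def xi_def g_def fun_eq_iff)
  show ?thesis
    unfolding X xi \<beta>_def Let_def
  proof (intro conjI allI impI)
    show "integrable L (\<lambda>x. x ^ s)" "(\<integral>x. x ^ s \<partial>L) = Gamma (real s + 1) / Gamma (real s * \<alpha> + 1)" for s
      by (rule mittag_leffler_props[OF L \<alpha>(1)])+
  qed (rule factorial_moment_equiv[OF j1 gj L] xi_at_top[OF j1 gj L] weak_conv_scaled[OF j1 gj L]
      scaled_moment_limit[OF j1 gj L] xi_tendsto[OF j1 gj L] weak_conv_Poisson[OF j1 gj L]
      moment_limit_Poisson[OF j1 gj L] xi_tendsto_0[OF j1 gj L] weak_conv_0[OF j1 gj L]; assumption)+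
qed

end
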